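(* Let $\xi$ be a boundedly exchangeable graph process on $S$ directed by $\nu$. Let $B,C\subseteq S$ be disjoint bounded Borel sets such that $\mathbb{P}(\nu(B)=0)<1$ and $\mathbb{P}(\nu(C)=0)<1$, and let $A^{B\cup C}$ be a jointly exchangeable matrix associated with $\xi$ on $B\cup C$. Then there exists a random partition of $\mathbb{N}$ into (almost surely infinite) subsequences $(b_i)_{i\in\mathbb{N}}$ and $(c_i)_{i\in\mathbb{N}}$ such that the almost surely defined matrices $$A^B_{ij}:=A^{B\cup C}_{b_ib_j},\qquad A^C_{ij}:=A^{B\cup C}_{c_ic_j},\qquad i,j\in\mathbb{N},$$ are jointly exchangeable matrices associated with $\xi$ on $B$ and $C$, respectively. Moreover, the matrix $A^{BC}_{ij}:=A^{B\cup C}_{b_ic_j}$, $i,j\in\mathbb{N}$, is separately exchangeable.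
   Context: $\mathbb{N}=\{1,2,\dots\}$. Let $(S,d)$ be a complete separable metric space; "bounded" means bounded for $d$. A measure is locally finite if finite on bounded Borel sets, and simple if it is a locally finite countable sum of distinct unit point masses. All random elements live on a common probability space assumed rich enough that a distributional representation in terms of independent uniform variables can be realised almost surely. An adjacency measure on $S$ is a simple measure $\xi$ on $S^2\times\{0,1\}$ such that there is a simple measure $\nu$ on $S$ with $\xi(D\times\{0,1\})=\nu^{\otimes2}(D)$ for all Borel $D\subseteq S^2$, and $\xi$ is invariant under $(x,y,a)\mapsto(y,x,a)$; $\xi$ is directed by the (unique) $\nu$. For Borel $B$, $\xi|_B$ is the restriction of $\xi$ to $B\times B\times\{0,1\}$. A graph process connected by a symmetric measurable $W:S^2\to[0,1]$ is a random adjacency measure admitting a representation $\xi\overset{a.s.}{=}\sum_{i,j\le N}\delta_{(S_i,S_j,A_{ij})}$, with $N$ a random variable in $\{0,1,\dots\}\cup\{\infty\}$, $(S_i)$ a.s. distinct random elements of $S$, and, conditionally on $(N,(S_k))$, $A_{ii}=0$, $A_{ij}$ ($i<j$) independent $\mathrm{Bernoulli}(W(S_i,S_j))$, $A_{ji}=A_{ij}$; $(A,N)$ is the adjacency matrix of the representation. It is an i.i.d. representation if in addition the $(S_k)$ are i.i.d. and $N$ is independent of $(S_k)$. A mixed binomial process is a point process equal in law to $\sum_{i\le N}\delta_{S_i}$ with $N$ an a.s. finite $\{0,1,\dots\}$-valued random variable independent of an i.i.d. sequence $(S_i)$. A mixed Poisson process is, conditionally on a random variable $\delta\ge0$, a Poisson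 process with intensity measure $\delta\mu$, $\mu$ locally finite. $\xi$ is boundedly exchangeable if it is directed by a mixed Poisson or mixed binomial process $\nu$ and, for every bounded Borel $B$ with $\mathbb{P}(\nu(B)=0)<1$, $\mathbb{P}(\nu(B)=n)>0$ for all $n\in\mathbb{N}$. A random matrix $(X_{ij})_{i,j\in\mathbb{N}}$ is jointly exchangeable if its law is invariant under simultaneous finite permutations of rows and columns, and separately exchangeable if its law is invariant under finite permutations applied to rows and columns separately, i.e. $(X_{ij})\overset{d}{=}(X_{\pi(i)\sigma(j)})$ for all finitely supported permutations $\pi,\sigma$ of $\mathbb{N}$. For a boundedly exchangeable graph process $\xi$ on $S$ directed by $\nu$ and bounded Borel $B$ with $\mathbb{P}(\nu(B)=0)<1$, there is a unique distribution of an infinite jointly exchangeable matrix $A^B$ such that the adjacency matrix $(A,N)$ of any i.i.d. representation of $\xi|_B$ satisfies $A\mid(N=n)\overset{d}{=}(A^B_{ij})_{i,j\le n}$ for all $n\ge1$; any random matrix with this distribution is called a jointly exchangeable matrix associated with $\xi$ on $B$. *)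

theory Defs
  imports "HOL-Probability.Probability"
begin

section \<open>Spaces of measures and simple measures\<close>

text \<open>
  The space of all measures on \<open>K\<close> with the \<open>\<sigma>\<close>-algebra generated by the evaluations
  \<open>m \<mapsto> m D\<close>; the analogue of \<^const>\<open>subprob_algebra\<close> without the bound on the total mass.
\<close>

definition measures_algebra :: "'a measure \<Rightarrow> 'a measure measure" where
  "measures_algebra K =
     (SUP D \<in> sets K. vimage_algebra {m. sets m = sets K} (\<lambda>m. emeasure m D) borel)"

text \<open>
  The argument \<open>bd\<close> says which sets are bounded. For an index set \<open>I\<close>,
  \<open>distr (count_space I) K f\<close> is the sum of the unit masses at \<open>f i\<close>, \<open>i \<in> I\<close>; so
  with \<open>f\<close> the identity the points are distinct.
\<close>

definition simple_measure :: "'a measure \<Rightarrow> ('a set \<Rightarrow> bool) \<Rightarrow> 'a measure \<Rightarrow> bool" where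
  "simple_measure K bd m \<longleftrightarrow>
     (\<exists>X. countable X \<and> m = distr (count_space X) K (\<lambda>x. x)) \<and>
     (\<forall>D\<in>sets K. bd D \<longrightarrow> emeasure m D < \<infinity>)"


section \<open>Adjacency measures\<close>

text \<open>Marks in \<open>{0, 1}\<close> are booleans, with \<^const>\<open>True\<close> for 1 (an edge).\<close>

abbreviation adj_space :: "('s::polish_space \<times> 's \<times> bool) measure" where
  "adj_space \<equiv> borel \<Otimes>\<^sub>M (borel \<Otimes>\<^sub>M count_space UNIV)"

definition directed_by ::
    "('s::polish_space \<times> 's \<times> bool) measure \<Rightarrow> 's measure \<Rightarrow> bool" where
  "directed_by \<xi> \<nu> \<longleftrightarrow>
     simple_measure adj_space (\<lambda>D. bounded ((\<lambda>(x, y, a). (x, y)) ` D)) \<xi> \<and>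
     simple_measure borel bounded \<nu> \<and>
     (\<forall>D \<in> sets (borel \<Otimes>\<^sub>M borel).
        emeasure \<xi> {(x, y, a). (x, y) \<in> D} = emeasure (\<nu> \<Otimes>\<^sub>M \<nu>) D) \<and>
     distr \<xi> adj_space (\<lambda>(x, y, a). (y, x, a)) = \<xi>"

text \<open>Density 1 on \<open>B \<times> B \<times> {0, 1}\<close> and 0 elsewhere: the restriction, kept on the whole space.\<close>

definition adj_restrict ::
    "'s set \<Rightarrow> ('s::polish_space \<times> 's \<times> bool) measure \<Rightarrow> ('s \<times> 's \<times> bool) measure" where
  "adj_restrict B \<xi> = density \<xi> (indicator (B \<times> B \<times> UNIV))"


section \<open>Graph processes and their representations\<close>

definition connection_function :: "('s::polish_space \<times> 's \<Rightarrow> real) \<Rightarrow> bool" where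
  "connection_function W \<longleftrightarrow>
     W \<in> borel_measurable (borel \<Otimes>\<^sub>M borel) \<and>
     (\<forall>x y. W (x, y) = W (y, x)) \<and> (\<forall>p. 0 \<le> W p \<and> W p \<le> 1)"

text \<open>
  Points and matrix entries are indexed by all natural numbers, starting from 0, so the indices
  up to \<open>N\<close> are those \<open>i\<close> with \<open>enat i < N\<close>. The conditional law of the entries above the
  diagonal is given by its finite-dimensional distributions, conditionally on the
  \<open>\<sigma>\<close>-algebra generated by \<open>N\<close> and the whole sequence of points.
\<close>

definition representation ::
    "'w measure \<Rightarrow> ('s::polish_space \<times> 's \<Rightarrow> real) \<Rightarrow> ('w \<Rightarrow> ('s \<times> 's \<times> bool) measure) \<Rightarrow>
     ('w \<Rightarrow> enat) \<Rightarrow> (nat \<Rightarrow> 'w \<Rightarrow> 's) \<Rightarrow> ('w \<Rightarrow> nat \<times> nat \<Rightarrow> bool) \<Rightarrow> bool" where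
  "representation M W \<xi> N S A \<longleftrightarrow>
     N \<in> M \<rightarrow>\<^sub>M count_space UNIV \<and>
     (\<forall>i. S i \<in> M \<rightarrow>\<^sub>M borel) \<and>
     (\<forall>p. (\<lambda>\<omega>. A \<omega> p) \<in> M \<rightarrow>\<^sub>M count_space UNIV) \<and>
     (AE \<omega> in M. inj (\<lambda>i. S i \<omega>)) \<and>
     (AE \<omega> in M. \<forall>i. \<not> A \<omega> (i, i)) \<and>
     (AE \<omega> in M. \<forall>i j. A \<omega> (j, i) = A \<omega> (i, j)) \<and>
     (\<forall>I a. finite I \<longrightarrow> I \<subseteq> {(i, j). i < j} \<longrightarrow>
        (AE \<omega> in M.
           real_cond_exp M
             (vimage_algebra (space M) (\<lambda>\<omega>. (N \<omega>, \<lambda>i. S i \<omega>))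
                (count_space UNIV \<Otimes>\<^sub>M (\<Pi>\<^sub>M i\<in>UNIV. borel)))
             (indicator {\<omega> \<in> space M. \<forall>p\<in>I. A \<omega> p = a p}) \<omega> =
           (\<Prod>(i, j)\<in>I. pmf (bernoulli_pmf (W (S i \<omega>, S j \<omega>))) (a (i, j))))) \<and>
     (AE \<omega> in M.
        \<xi> \<omega> = distr (count_space {(i, j). enat i < N \<omega> \<and> enat j < N \<omega>}) adj_space
                (\<lambda>(i, j). (S i \<omega>, S j \<omega>, A \<omega> (i, j))))"

definition graph_process ::
    "'w measure \<Rightarrow> ('s::polish_space \<times> 's \<Rightarrow> real) \<Rightarrow> ('w \<Rightarrow> ('s \<times> 's \<times> bool) measure) \<Rightarrow> bool"
    where
  "graph_process M W \<xi> \<longleftrightarrow>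
     connection_function W \<and>
     \<xi> \<in> M \<rightarrow>\<^sub>M measures_algebra adj_space \<and>
     (\<forall>\<omega>\<in>space M. \<exists>\<nu>. directed_by (\<xi> \<omega>) \<nu>) \<and>
     (\<exists>N S A. representation M W \<xi> N S A)"

definition iid_representation ::
    "'w measure \<Rightarrow> ('w \<Rightarrow> ('s::polish_space \<times> 's \<times> bool) measure) \<Rightarrow>
     ('w \<Rightarrow> enat) \<Rightarrow> (nat \<Rightarrow> 'w \<Rightarrow> 's) \<Rightarrow> ('w \<Rightarrow> nat \<times> nat \<Rightarrow> bool) \<Rightarrow> bool" where
  "iid_representation M \<xi> N S A \<longleftrightarrow>
     (\<exists>W. connection_function W \<and> representation M W \<xi> N S A) \<and>
     prob_space.indep_vars M (\<lambda>_. borel) S UNIV \<and>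
     (\<forall>i. distr M borel (S i) = distr M borel (S 0)) \<and>
     prob_space.indep_set M
       (sets (vimage_algebra (space M) N (count_space UNIV)))
       (sets (vimage_algebra (space M) (\<lambda>\<omega> i. S i \<omega>) (\<Pi>\<^sub>M i\<in>UNIV. borel)))"


section \<open>Mixed binomial and mixed Poisson processes\<close>

text \<open>
  The product measure is the joint law of a finite count and an i.i.d. sequence independent of
  the count.
\<close>

definition mixed_binomial :: "'w measure \<Rightarrow> ('w \<Rightarrow> 's::polish_space measure) \<Rightarrow> bool" where
  "mixed_binomial M \<nu> \<longleftrightarrow>
     \<nu> \<in> M \<rightarrow>\<^sub>M measures_algebra borel \<and>
     (\<exists>(p :: nat pmf) \<sigma>. prob_space \<sigma> \<and> sets \<sigma> = sets borel \<and>
        distr M (measures_algebra borel) \<nu> =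
        distr (measure_pmf p \<Otimes>\<^sub>M (\<Pi>\<^sub>M i\<in>UNIV::nat set. \<sigma>)) (measures_algebra borel)
          (\<lambda>(n, s). distr (count_space {..<n}) borel s))"

text \<open>
  The Poisson weights are written out because \<^const>\<open>poisson_pmf\<close> excludes the rate 0, which
  here must give the unit mass at 0.
\<close>

definition mixed_poisson :: "'w measure \<Rightarrow> ('w \<Rightarrow> 's::polish_space measure) \<Rightarrow> bool" where
  "mixed_poisson M \<nu> \<longleftrightarrow>
     \<nu> \<in> M \<rightarrow>\<^sub>M measures_algebra borel \<and>
     (\<exists>(\<delta> :: 'w \<Rightarrow> real) \<mu>. \<delta> \<in> borel_measurable M \<and> (\<forall>\<omega>\<in>space M. 0 \<le> \<delta> \<omega>) \<and>
        sets \<mu> = sets borel \<and> (\<forall>D\<in>sets borel. bounded D \<longrightarrow> emeasure \<mu> D < \<infinity>) \<and>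
        (\<forall>\<D> k. finite \<D> \<longrightarrow> disjoint \<D> \<longrightarrow> (\<forall>D\<in>\<D>. D \<in> sets borel \<and> bounded D) \<longrightarrow>
          (AE \<omega> in M.
             real_cond_exp M (vimage_algebra (space M) \<delta> borel)
               (indicator {\<omega> \<in> space M. \<forall>D\<in>\<D>. emeasure (\<nu> \<omega>) D = of_nat (k D)}) \<omega> =
             (\<Prod>D\<in>\<D>. (\<delta> \<omega> * measure \<mu> D) ^ k D / fact (k D) * exp (- (\<delta> \<omega> * measure \<mu> D))))))"

definition boundedly_exchangeable ::
    "'w measure \<Rightarrow> ('w \<Rightarrow> ('s::polish_space \<times> 's \<times> bool) measure) \<Rightarrow> ('w \<Rightarrow> 's measure) \<Rightarrow> bool"
    where
  "boundedly_exchangeable M \<xi> \<nu> \<longleftrightarrow>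
     (\<forall>\<omega>\<in>space M. directed_by (\<xi> \<omega>) (\<nu> \<omega>)) \<and>
     (mixed_poisson M \<nu> \<or> mixed_binomial M \<nu>) \<and>
     (\<forall>B\<in>sets borel. bounded B \<longrightarrow>
        measure M {\<omega> \<in> space M. emeasure (\<nu> \<omega>) B = 0} < 1 \<longrightarrow>
        (\<forall>n\<ge>1. measure M {\<omega> \<in> space M. emeasure (\<nu> \<omega>) B = of_nat n} > 0))"


section \<open>Exchangeable matrices\<close>

abbreviation matrix_space :: "(nat \<times> nat \<Rightarrow> bool) measure" where
  "matrix_space \<equiv> \<Pi>\<^sub>M p\<in>UNIV. count_space UNIV"

definition finite_permutation :: "(nat \<Rightarrow> nat) \<Rightarrow> bool" where
  "finite_permutation \<pi> \<longleftrightarrow> bij \<pi> \<and> finite {i. \<pi> i \<noteq> i}"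

definition jointly_exchangeable_law :: "(nat \<times> nat \<Rightarrow> bool) measure \<Rightarrow> bool" where
  "jointly_exchangeable_law P \<longleftrightarrow>
     (\<forall>\<pi>. finite_permutation \<pi> \<longrightarrow>
        distr P matrix_space (\<lambda>X (i, j). X (\<pi> i, \<pi> j)) = P)"

definition separately_exchangeable :: "'w measure \<Rightarrow> ('w \<Rightarrow> nat \<times> nat \<Rightarrow> bool) \<Rightarrow> bool" where
  "separately_exchangeable M X \<longleftrightarrow>
     X \<in> M \<rightarrow>\<^sub>M matrix_space \<and>
     (\<forall>\<pi> \<sigma>. finite_permutation \<pi> \<longrightarrow> finite_permutation \<sigma> \<longrightarrow>
        distr M matrix_space (\<lambda>\<omega> (i, j). X \<omega> (\<pi> i, \<sigma> j)) = distr M matrix_space X)"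

text \<open>
  \<open>P\<close> is the law of a jointly exchangeable matrix whose upper left \<open>n \<times> n\<close> block is distributed
  as that of the adjacency matrix of any i.i.d. representation of the restriction of \<open>\<xi>\<close> to \<open>B\<close>,
  conditionally on the number of points being \<open>n\<close>.
\<close>

definition associated_law ::
    "'w measure \<Rightarrow> ('w \<Rightarrow> ('s::polish_space \<times> 's \<times> bool) measure) \<Rightarrow> 's set \<Rightarrow>
     (nat \<times> nat \<Rightarrow> bool) measure \<Rightarrow> bool" where
  "associated_law M \<xi> B P \<longleftrightarrow>
     prob_space P \<and> sets P = sets matrix_space \<and> jointly_exchangeable_law P \<and>
     (\<forall>N S A. iid_representation M (\<lambda>\<omega>. adj_restrict B (\<xi> \<omega>)) N S A \<longrightarrow>
        (\<forall>n\<ge>1.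
           distr (uniform_measure M {\<omega> \<in> space M. N \<omega> = enat n})
             (\<Pi>\<^sub>M p\<in>{..<n} \<times> {..<n}. count_space UNIV) (\<lambda>\<omega>. restrict (A \<omega>) ({..<n} \<times> {..<n})) =
           distr P
             (\<Pi>\<^sub>M p\<in>{..<n} \<times> {..<n}. count_space UNIV) (\<lambda>X. restrict X ({..<n} \<times> {..<n}))))"

text \<open>
  The law of the random matrix is the unique associated law. Uniqueness belongs to the notion:
  it excludes the degenerate case in which there is no i.i.d. representation and every jointly
  exchangeable law would qualify.
\<close>

definition associated_matrix ::
    "'w measure \<Rightarrow> ('w \<Rightarrow> ('s::polish_space \<times> 's \<times> bool) measure) \<Rightarrow> 's set \<Rightarrow>
     ('w \<Rightarrow> nat \<times> nat \<Rightarrow> bool) \<Rightarrow> bool" where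
  "associated_matrix M \<xi> B X \<longleftrightarrow>
     X \<in> M \<rightarrow>\<^sub>M matrix_space \<and>
     associated_law M \<xi> B (distr M matrix_space X) \<and>
     (\<forall>P. associated_law M \<xi> B P \<longrightarrow> P = distr M matrix_space X)"


section \<open>Rich probability spaces\<close>

text \<open>
  Every representation in law of the random element \<open>X\<close> by independent uniform variables
  \<open>u\<^sub>0, u\<^sub>1, \<dots>\<close> is realised almost surely by such variables on \<open>M\<close>. Taking
  functions that ignore some of the \<open>u\<^sub>k\<close>, one sees that this provides randomness independent
  of \<open>X\<close>.
\<close>

definition realises_representations :: "'w measure \<Rightarrow> 'e measure \<Rightarrow> ('w \<Rightarrow> 'e) \<Rightarrow> bool" where
  "realises_representations M E X \<longleftrightarrow>
     (\<forall>f \<in> (\<Pi>\<^sub>M k\<in>UNIV::nat set. borel) \<rightarrow>\<^sub>M E.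
        distr (\<Pi>\<^sub>M k\<in>UNIV. uniform_measure lborel {0..1}) E f = distr M E X \<longrightarrow>
        (\<exists>U :: 'w \<Rightarrow> nat \<Rightarrow> real.
           U \<in> M \<rightarrow>\<^sub>M (\<Pi>\<^sub>M k\<in>UNIV. borel) \<and>
           distr M (\<Pi>\<^sub>M k\<in>UNIV. borel) U = (\<Pi>\<^sub>M k\<in>UNIV. uniform_measure lborel {0..1}) \<and>
           (AE \<omega> in M. X \<omega> = f (U \<omega>))))"

end

theory Submission
  imports Defs
begin

text \<open>
  Let \<open>(N, S, A')\<close> be an i.i.d. representation of the restriction of \<open>\<xi>\<close> to \<open>B \<union> C\<close>, with \<open>\<sigma>\<close> the
  law of a point. Its infinite matrix \<open>A'\<close> has the associated law, because given the points the
  entries are independent coin tosses and the points do not depend on \<open>N\<close>. Label the index \<open>i\<close> by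
  whether \<open>S\<^sub>i\<close> lies in \<open>B\<close>, and let \<open>b\<close> and \<open>c\<close> list the indices with either label. The labels, the
  points with the first label and the points with the second are independent, and each of the two
  subsequences is i.i.d. from \<open>\<sigma>\<close> conditioned on its side (\<open>seq_law_split\<close>). Hence the points in
  \<open>B\<close>, their number, and the submatrix of \<open>A'\<close> along \<open>b\<close> form an i.i.d. representation of the
  restriction of \<open>\<xi>\<close> to \<open>B\<close> (\<open>iid_representation_thinned\<close>), and the same goes for \<open>C\<close>. The block of
  \<open>A'\<close> with rows \<open>b\<close> and columns \<open>c\<close> tosses coins for two independent i.i.d. sequences, so permuting
  one of them does not change its law (\<open>separately_exchangeable_cross_block\<close>). All three points
  need the conditional law of entries at indices that are chosen according to the points; this is
  \<open>emeasure_random_entries\<close>.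

  To be associated with \<open>\<xi>\<close> on a set is to have the law of the matrix of one i.i.d. representation
  there (\<open>associated_matrix_iff\<close>). This rests on the fact that all i.i.d. representations of one
  process have the same matrix law (\<open>iid_law_unique\<close>): given \<open>N = n\<close>, the probability of an
  \<open>n \<times> n\<close> pattern is by exchangeability the expected proportion of the orderings of the \<open>n\<close> points
  under which the pattern shows, and this proportion can be read off from the process. That a
  representation exists on \<open>B \<union> C\<close> at all follows from the uniqueness of the associated law, and
  \<open>\<sigma>\<close> charges both \<open>B\<close> and \<open>C\<close> because with positive probability \<open>\<nu>\<close> has a point in \<open>B\<close>, and
  likewise for \<open>C\<close>.

  The given matrix \<open>A\<close> is equal to \<open>A'\<close> in law only, and has no points. However, \<open>A'\<close> together with the
  labels is a countable array of bits, whose law is the image of a uniform variable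
  (\<open>bool_seq_law_from_uniform\<close>). Richness therefore provides labels \<open>I\<close> such that \<open>(A, I)\<close> has the
  law of \<open>A'\<close> with its labels (\<open>realised_pair\<close>), and everything carries over to \<open>A\<close>.
\<close>

section \<open>Laws of infinite arrays of bits\<close>

abbreviation bool_cube :: "('i \<Rightarrow> bool) measure" where
  "bool_cube \<equiv> \<Pi>\<^sub>M i\<in>UNIV. count_space UNIV"

lemma space_bool_cube [simp]: "space bool_cube = UNIV"
  by (simp add: space_PiM)

lemma measurable_cylinder [measurable]:
  fixes I :: "'i set" and x :: "'i \<Rightarrow> bool"
  assumes "finite I"
  shows "{X. \<forall>p\<in>I. X p = x p} \<in> sets bool_cube"
proof -
  have [measurable]: "(\<lambda>X. X p) \<in> bool_cube \<rightarrow>\<^sub>M count_space UNIV" for p :: 'i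
    by (rule measurable_component_singleton) simp
  have "{X \<in> space bool_cube. \<forall>p\<in>I. X p = x p} \<in> sets bool_cube"
    using assms by measurable
  then show ?thesis by simp
qed

lemma bool_cube_measure_eqI:
  fixes P Q :: "('i \<Rightarrow> bool) measure"
  assumes sets: "sets P = sets bool_cube" "sets Q = sets bool_cube"
    and fin: "finite_measure P"
    and cyl: "\<And>I x. finite I \<Longrightarrow>
      emeasure P {X. \<forall>p\<in>I. X p = x p} = emeasure Q {X. \<forall>p\<in>I. X p = x p}"
  shows "P = Q"
proof (rule measure_eqI_PiM_infinite[OF sets _ fin])
  fix A :: "'i \<Rightarrow> bool set" and J :: "'i set" assume J: "finite J"
  define cylinder where "cylinder y = {X :: 'i \<Rightarrow> bool. \<forall>p\<in>J. X p = y p}" for y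
  have eq: "prod_emb UNIV (\<lambda>_. count_space UNIV) J (Pi\<^sub>E J A) = (\<Union>y\<in>Pi\<^sub>E J A. cylinder y)"
    (is "?L = ?R")
  proof (intro set_eqI iffI)
    fix X assume "X \<in> ?L"
    then have "restrict X J \<in> Pi\<^sub>E J A" "X \<in> cylinder (restrict X J)"
      by (auto simp: prod_emb_def cylinder_def)
    then show "X \<in> ?R" by blast
  next
    fix X assume "X \<in> ?R"
    then obtain y where y: "y \<in> Pi\<^sub>E J A" "X \<in> cylinder y" by blast
    then have "restrict X J = y"
      by (auto simp: cylinder_def PiE_iff extensional_def restrict_def)
    with y show "X \<in> ?L" by (auto simp: prod_emb_def)
  qed
  have disj: "disjoint_family_on cylinder (Pi\<^sub>E J A)"
    unfolding disjoint_family_on_def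
  proof (intro ballI impI)
    fix y z assume "y \<in> Pi\<^sub>E J A" "z \<in> Pi\<^sub>E J A" "y \<noteq> z"
    then obtain p where "p \<in> J" "y p \<noteq> z p"
      using PiE_ext[of y J A z] by blast
    then show "cylinder y \<inter> cylinder z = {}"
      by (auto simp: cylinder_def)
  qed
  have finite: "finite (Pi\<^sub>E J A)"
    using J by (intro finite_PiE) auto
  have sums: "emeasure R ?L = (\<Sum>y\<in>Pi\<^sub>E J A. emeasure R (cylinder y))"
    if "sets R = sets bool_cube" for R
  proof -
    have "cylinder ` Pi\<^sub>E J A \<subseteq> sets R"
      using J that by (auto simp: cylinder_def intro: measurable_cylinder)
    then show ?thesis
      unfolding eq using disj finite by (intro sum_emeasure[symmetric])
  qed
  show "emeasure P ?L = emeasure Q ?L"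
    unfolding sums[OF sets(1)] sums[OF sets(2)] cylinder_def
    by (intro sum.cong refl cyl J)
qed

lemma emeasure_distr_cylinder:
  fixes X :: "'w \<Rightarrow> 'i \<Rightarrow> bool"
  assumes "X \<in> M \<rightarrow>\<^sub>M bool_cube" "finite I"
  shows "emeasure (distr M bool_cube X) {y. \<forall>p\<in>I. y p = x p} =
    emeasure M {\<omega>\<in>space M. \<forall>p\<in>I. X \<omega> p = x p}"
  using assms measurable_cylinder[OF assms(2), of x]
  by (auto simp: emeasure_distr intro!: arg_cong[where f="emeasure M"])

lemma measurable_bool_cubeI:
  assumes "\<And>p. (\<lambda>\<omega>. X \<omega> p) \<in> M \<rightarrow>\<^sub>M count_space UNIV"
  shows "X \<in> M \<rightarrow>\<^sub>M bool_cube"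
proof -
  have "(\<lambda>\<omega> p. X \<omega> p) \<in> M \<rightarrow>\<^sub>M bool_cube"
    by (rule measurable_PiM_single') (use assms in \<open>auto simp: PiE_def\<close>)
  then show ?thesis by simp
qed

lemma measurable_bool_cubeD:
  assumes "X \<in> M \<rightarrow>\<^sub>M bool_cube"
  shows "(\<lambda>\<omega>. X \<omega> p) \<in> M \<rightarrow>\<^sub>M count_space UNIV"
  by (rule measurable_compose[OF assms measurable_component_singleton]) simp

lemma measurable_reindex_matrix:
  "(\<lambda>X (i, j). X (f i, g j) :: bool) \<in> matrix_space \<rightarrow>\<^sub>M matrix_space"
proof (rule measurable_bool_cubeI)
  fix p :: "nat \<times> nat"
  show "(\<lambda>X. (\<lambda>(i, j). X (f i, g j) :: bool) p) \<in> matrix_space \<rightarrow>\<^sub>M count_space UNIV"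
    unfolding split_beta by (rule measurable_component_singleton) simp
qed

definition hollow_symmetric :: "(nat \<times> nat \<Rightarrow> bool) \<Rightarrow> bool" where
  "hollow_symmetric X \<longleftrightarrow> (\<forall>i. \<not> X (i, i)) \<and> (\<forall>i j. X (j, i) = X (i, j))"

text \<open>
  The matrix is a function of its strict upper triangle, so the finite patterns above the diagonal
  determine its law.
\<close>

lemma hollow_symmetric_law_eqI:
  assumes X [measurable]: "X \<in> M \<rightarrow>\<^sub>M matrix_space" and Y [measurable]: "Y \<in> M' \<rightarrow>\<^sub>M matrix_space"
    and fin: "finite_measure M"
    and sym: "AE \<omega> in M. hollow_symmetric (X \<omega>)" "AE \<omega> in M'. hollow_symmetric (Y \<omega>)"
    and cyl: "\<And>I x. finite I \<Longrightarrow> I \<subseteq> {(i, j). i < j} \<Longrightarrow>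
      emeasure M {\<omega>\<in>space M. \<forall>p\<in>I. X \<omega> p = x p} =
      emeasure M' {\<omega>\<in>space M'. \<forall>p\<in>I. Y \<omega> p = x p}"
  shows "distr M matrix_space X = distr M' matrix_space Y"
proof -
  define upper :: "(nat \<times> nat \<Rightarrow> bool) \<Rightarrow> nat \<times> nat \<Rightarrow> bool"
    where "upper X = (\<lambda>(i, j). i < j \<and> X (i, j))" for X
  define fill :: "(nat \<times> nat \<Rightarrow> bool) \<Rightarrow> nat \<times> nat \<Rightarrow> bool"
    where "fill X = (\<lambda>(i, j). X (i, j) \<or> X (j, i))" for X
  have [measurable]: "upper \<in> matrix_space \<rightarrow>\<^sub>M matrix_space"
      proof -
    have "(\<lambda>X. upper X p) \<in> matrix_space \<rightarrow>\<^sub>M count_space UNIV" for p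
      unfolding upper_def by (cases p) simp
    then show ?thesis by (rule measurable_bool_cubeI)
  qed
  have [measurable]: "fill \<in> matrix_space \<rightarrow>\<^sub>M matrix_space"
  proof -
    have "(\<lambda>X. fill X p) \<in> matrix_space \<rightarrow>\<^sub>M count_space UNIV" for p
      unfolding fill_def by (cases p) simp
    then show ?thesis by (rule measurable_bool_cubeI)
  qed
  have fill_upper: "fill (upper X) = X" if "hollow_symmetric X" for X
  proof
    fix p :: "nat \<times> nat"
    obtain i j where "p = (i, j)" by (cases p)
    moreover have "i < j \<or> j < i \<or> i = j" by auto
    ultimately show "fill (upper X) p = X p"
      using that unfolding hollow_symmetric_def fill_def upper_def by auto
  qed
  have *: "distr M matrix_space (\<lambda>\<omega>. upper (X \<omega>)) = distr M' matrix_space (\<lambda>\<omega>. upper (Y \<omega>))"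
  proof (rule bool_cube_measure_eqI)
    show "finite_measure (distr M matrix_space (\<lambda>\<omega>. upper (X \<omega>)))"
      using fin by (rule finite_measure.finite_measure_distr) measurable
    \<comment> \<open>The array \<open>upper X\<close> is constantly \<open>False\<close> outside the upper triangle, so a pattern
      that asks for an edge there has probability 0 on both sides.\<close>
    fix I :: "(nat \<times> nat) set" and x assume I: "finite I"
    let ?U = "{(i, j). i < (j::nat)}"
    show "emeasure (distr M matrix_space (\<lambda>\<omega>. upper (X \<omega>))) {y. \<forall>p\<in>I. y p = x p} =
      emeasure (distr M' matrix_space (\<lambda>\<omega>. upper (Y \<omega>))) {y. \<forall>p\<in>I. y p = x p}"
    proof (cases "\<exists>p\<in>I - ?U. x p")
      case True
      then have "{\<omega>\<in>space M. \<forall>p\<in>I. upper (X \<omega>) p = x p} = {}"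
        "{\<omega>\<in>space M'. \<forall>p\<in>I. upper (Y \<omega>) p = x p} = {}"
        by (auto simp: upper_def)
      then show ?thesis using I by (simp add: emeasure_distr_cylinder del: Collect_empty_eq)
    next
      case False
      then have "(\<forall>p\<in>I. upper Z p = x p) \<longleftrightarrow> (\<forall>p\<in>I \<inter> ?U. Z p = x p)" for Z
        by (auto simp: upper_def)
      then show ?thesis using I cyl[of "I \<inter> ?U" x] by (simp add: emeasure_distr_cylinder)
    qed
  qed simp_all
  have "distr M matrix_space X = distr M matrix_space (\<lambda>\<omega>. fill (upper (X \<omega>)))"
  proof (rule distr_cong_AE)
    show "AE \<omega> in M. X \<omega> = fill (upper (X \<omega>))"
      using sym(1) by eventually_elim (simp add: fill_upper)
  qed measurable
  also have "\<dots> = distr (distr M matrix_space (\<lambda>\<omega>. upper (X \<omega>))) matrix_space fill"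
    by (simp add: distr_distr comp_def)
  also have "\<dots> = distr (distr M' matrix_space (\<lambda>\<omega>. upper (Y \<omega>))) matrix_space fill"
    by (simp only: *)
  also have "\<dots> = distr M' matrix_space (\<lambda>\<omega>. fill (upper (Y \<omega>)))"
    by (simp add: distr_distr comp_def)
  also have "\<dots> = distr M' matrix_space Y"
  proof (rule distr_cong_AE)
    show "AE \<omega> in M'. fill (upper (Y \<omega>)) = Y \<omega>"
      using sym(2) by eventually_elim (simp add: fill_upper)
  qed measurable
  finally show ?thesis .
qed

text \<open>
  A finite pattern is a disjoint union of patterns on an initial segment.
\<close>

lemma bool_seq_measure_eqI:
  fixes P Q :: "(nat \<Rightarrow> bool) measure"
  assumes sets: "sets P = sets bool_cube" "sets Q = sets bool_cube"
    and fin: "finite_measure P"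
    and init: "\<And>xs. emeasure P {z. \<forall>i<length xs. z i = xs ! i} =
      emeasure Q {z. \<forall>i<length xs. z i = xs ! i}"
  shows "P = Q"
proof (rule bool_cube_measure_eqI[OF sets fin])
  fix I :: "nat set" and x assume "finite I"
  then obtain n where n: "I \<subseteq> {..<n}" using finite_nat_iff_bounded by blast
  define L where "L = {xs :: bool list. length xs = n \<and> (\<forall>p\<in>I. xs ! p = x p)}"
  define cylinder where "cylinder xs = {z. \<forall>i<length xs. z i = (xs ! i :: bool)}" for xs
  have union: "{z. \<forall>p\<in>I. z p = x p} = (\<Union>xs\<in>L. cylinder xs)"
  proof (intro set_eqI iffI)
    fix z assume "z \<in> {z. \<forall>p\<in>I. z p = x p}"
    then have "map z [0..<n] \<in> L" "z \<in> cylinder (map z [0..<n])"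
      using n by (auto simp: L_def cylinder_def)
    then show "z \<in> (\<Union>xs\<in>L. cylinder xs)" by blast
  next
    fix z assume "z \<in> (\<Union>xs\<in>L. cylinder xs)"
    then show "z \<in> {z. \<forall>p\<in>I. z p = x p}"
      using n by (fastforce simp: L_def cylinder_def)
  qed
  have disj: "disjoint_family_on cylinder L"
    unfolding disjoint_family_on_def
  proof (intro ballI impI)
    fix xs ys assume "xs \<in> L" "ys \<in> L" "xs \<noteq> ys"
    then obtain i where "i < n" "xs ! i \<noteq> ys ! i" "length xs = n" "length ys = n"
      by (auto simp: L_def list_eq_iff_nth_eq)
    then show "cylinder xs \<inter> cylinder ys = {}" by (auto simp: cylinder_def)
  qed
  have fin: "finite L"
    by (rule finite_subset[OF _ finite_lists_length_eq[of "UNIV :: bool set" n]])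
      (auto simp: L_def)
  have cyl: "cylinder xs \<in> sets bool_cube" for xs
    using measurable_cylinder[of "{..<length xs}" "\<lambda>i. xs ! i"]
    by (simp add: cylinder_def Ball_def)
  have sums: "emeasure R {z. \<forall>p\<in>I. z p = x p} = (\<Sum>xs\<in>L. emeasure R (cylinder xs))"
    if "sets R = sets bool_cube" for R
    unfolding union using disj fin cyl that by (intro sum_emeasure[symmetric]) auto
  show "emeasure P {z. \<forall>p\<in>I. z p = x p} = emeasure Q {z. \<forall>p\<in>I. z p = x p}"
    unfolding sums[OF sets(1)] sums[OF sets(2)] by (simp add: cylinder_def init)
qed

text \<open>
  Nested intervals: to the word \<open>xs\<close> belongs a subinterval of \<open>[0, 1)\<close> of length \<open>c xs\<close>, which is cut
  into the intervals of \<open>xs @ [False]\<close>, on the left, and of \<open>xs @ [True]\<close>. The state after \<open>k\<close> steps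
  is the word of length \<open>k\<close> whose interval contains \<open>v\<close>, and the distance of \<open>v\<close> from the left end
  of that interval.
\<close>

primrec interval_state :: "(bool list \<Rightarrow> real) \<Rightarrow> real \<Rightarrow> nat \<Rightarrow> bool list \<times> real" where
  "interval_state c v 0 = ([], v)"
| "interval_state c v (Suc k) =
    (let (xs, r) = interval_state c v k; p = c (xs @ [False])
     in if r < p then (xs @ [False], r) else (xs @ [True], r - p))"

lemma length_interval_state [simp]: "length (fst (interval_state c v k)) = k"
  by (induction k) (auto simp: Let_def split: prod.split)

lemma measurable_interval_state:
  "(\<lambda>v. interval_state c v k) \<in> borel \<rightarrow>\<^sub>M count_space UNIV \<Otimes>\<^sub>M borel"
proof (induction k)
  case (Suc k)
  note [measurable] = Suc
  define xs where "xs v = fst (interval_state c v k)" for v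
  define r where "r v = snd (interval_state c v k)" for v
  have xs [measurable]: "xs \<in> borel \<rightarrow>\<^sub>M count_space UNIV"
    unfolding xs_def by (rule measurable_compose[OF Suc measurable_fst])
  have [measurable]: "r \<in> borel_measurable borel"
    unfolding r_def by (rule measurable_compose[OF Suc measurable_snd])
  have [measurable]: "(\<lambda>v. c (xs v @ [False])) \<in> borel_measurable borel"
    by (rule measurable_compose[OF xs]) simp
  have [measurable]: "(\<lambda>v. xs v @ [b]) \<in> borel \<rightarrow>\<^sub>M count_space UNIV" for b
    by (rule measurable_compose[OF xs]) simp
  have "interval_state c v (Suc k) = (if r v < c (xs v @ [False]) then (xs v @ [False], r v)
      else (xs v @ [True], r v - c (xs v @ [False])))" for v
    by (simp add: Let_def xs_def r_def split: prod.split)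
  then have "(\<lambda>v. interval_state c v (Suc k)) =
      (\<lambda>v. if r v < c (xs v @ [False]) then (xs v @ [False], r v)
        else (xs v @ [True], r v - c (xs v @ [False])))"
    by blast
  then show ?case by (simp only:) measurable
qed simp

text \<open>
  The number \<open>l\<close> is the left end of the interval of the word \<open>xs\<close>.
\<close>

lemma interval_state_interval:
  assumes nonneg: "\<And>xs. 0 \<le> c xs" and Nil: "c [] = 1"
    and split: "\<And>xs. c (xs @ [False]) + c (xs @ [True]) = c xs"
  shows "\<exists>l\<ge>0. l + c xs \<le> 1 \<and> (\<forall>v\<in>{0..<1}.
    (fst (interval_state c v (length xs)) = xs \<longleftrightarrow> l \<le> v \<and> v < l + c xs) \<and>
    (fst (interval_state c v (length xs)) = xs \<longrightarrow> snd (interval_state c v (length xs)) = v - l))"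
proof (induction xs rule: rev_induct)
  case Nil
  then show ?case using assms by (intro exI[of _ 0]) auto
next
  case (snoc b xs)
  then obtain l where l: "l \<ge> 0" "l + c xs \<le> 1" and
    iff: "\<And>v. v \<in> {0..<1} \<Longrightarrow>
      fst (interval_state c v (length xs)) = xs \<longleftrightarrow> l \<le> v \<and> v < l + c xs" and
    snd: "\<And>v. v \<in> {0..<1} \<Longrightarrow> fst (interval_state c v (length xs)) = xs \<Longrightarrow>
      snd (interval_state c v (length xs)) = v - l"
    by blast
  let ?l = "if b then l + c (xs @ [False]) else l"
  have step: "(fst (interval_state c v (length (xs @ [b]))) = xs @ [b] \<longleftrightarrow>
      ?l \<le> v \<and> v < ?l + c (xs @ [b])) \<and>
    (fst (interval_state c v (length (xs @ [b]))) = xs @ [b] \<longrightarrow>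
      snd (interval_state c v (length (xs @ [b]))) = v - ?l)"
    if v: "v \<in> {0..<1}" for v
  proof -
    obtain ys r where state: "interval_state c v (length xs) = (ys, r)" by fastforce
    then have "ys = xs \<longleftrightarrow> l \<le> v \<and> v < l + c xs" "ys = xs \<Longrightarrow> r = v - l"
      using iff[OF v] snd[OF v] by auto
    then show ?thesis
      using split[of xs] nonneg[of "xs @ [False]"] nonneg[of "xs @ [True]"]
      by (cases b) (auto simp: state Let_def)
  qed
  have l_nonneg: "?l \<ge> 0"
    using l nonneg[of "xs @ [False]"] by (cases b) simp_all
  have l_le: "?l + c (xs @ [b]) \<le> 1"
  proof (cases b)
    case True
    then show ?thesis using l split[of xs] by simp
  next
    case False
    then show ?thesis using l split[of xs] nonneg[of "xs @ [True]"] by simp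
  qed
  have all: "\<forall>v\<in>{0..<1}.
    (fst (interval_state c v (length (xs @ [b]))) = xs @ [b] \<longleftrightarrow>
      ?l \<le> v \<and> v < ?l + c (xs @ [b])) \<and>
    (fst (interval_state c v (length (xs @ [b]))) = xs @ [b] \<longrightarrow>
      snd (interval_state c v (length (xs @ [b]))) = v - ?l)"
    by (rule ballI) (rule step)
  show ?case
    by (rule exI[of _ ?l], rule conjI[OF l_nonneg conjI[OF l_le all]])
qed

definition interval_digits :: "(bool list \<Rightarrow> real) \<Rightarrow> real \<Rightarrow> nat \<Rightarrow> bool" where
  "interval_digits c v k = last (fst (interval_state c v (Suc k)))"

lemma interval_state_digits:
  "fst (interval_state c v k) = map (interval_digits c v) [0..<k]"
proof (induction k)
  case (Suc k)
  obtain xs r where "interval_state c v k = (xs, r)" by fastforce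
  then have "fst (interval_state c v (Suc k)) = fst (interval_state c v k) @ [interval_digits c v k]"
    unfolding interval_digits_def by (simp add: Let_def)
  then show ?case using Suc by simp
qed simp

text \<open>
  Take for \<open>c xs\<close> the probability that a sequence begins with \<open>xs\<close>. A uniform \<open>v\<close> falls into the
  interval of \<open>xs\<close> with just this probability.
\<close>

lemma bool_seq_law_from_uniform:
  fixes Q :: "(nat \<Rightarrow> bool) measure"
  assumes "prob_space Q" and sets [measurable_cong]: "sets Q = sets bool_cube"
  obtains f where "f \<in> borel \<rightarrow>\<^sub>M bool_cube"
    "distr (uniform_measure lborel {0..1::real}) bool_cube f = Q"
proof -
  interpret Q: prob_space Q by fact
  have space: "space Q = UNIV" using sets_eq_imp_space_eq[OF sets] by simp
  define cyl where "cyl xs = {z. \<forall>i<length xs. z i = (xs ! i :: bool)}" for xs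
  have cyl_sets [measurable]: "cyl xs \<in> sets Q" for xs
    using measurable_cylinder[of "{..<length xs}" "\<lambda>i. xs ! i"] sets
    by (simp add: cyl_def Ball_def)
  define c where "c xs = Q.prob (cyl xs)" for xs
  have c: "0 \<le> c xs" "c [] = 1" "c (xs @ [False]) + c (xs @ [True]) = c xs" for xs
  proof -
    show "0 \<le> c xs" by (simp add: c_def)
    show "c [] = 1" using Q.prob_space unfolding space by (simp add: c_def cyl_def)
    have "z \<in> cyl (xs @ [b]) \<longleftrightarrow> z \<in> cyl xs \<and> z (length xs) = b" for z b
      unfolding cyl_def by (simp add: nth_append All_less_Suc) blast
    then have "cyl xs = cyl (xs @ [False]) \<union> cyl (xs @ [True])"
      "cyl (xs @ [False]) \<inter> cyl (xs @ [True]) = {}"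
      by auto
    then show "c (xs @ [False]) + c (xs @ [True]) = c xs"
      unfolding c_def using Q.finite_measure_Union[OF cyl_sets cyl_sets] by metis
  qed
  define f where "f = interval_digits c"
  have f: "f \<in> borel \<rightarrow>\<^sub>M bool_cube"
  proof (rule measurable_bool_cubeI)
    fix k
    have "(\<lambda>v. last (fst (interval_state c v (Suc k)))) \<in> borel \<rightarrow>\<^sub>M count_space UNIV"
      by (rule measurable_compose[OF measurable_compose[OF measurable_interval_state measurable_fst]])
        (rule measurable_count_space)
    then show "(\<lambda>v. f v k) \<in> borel \<rightarrow>\<^sub>M count_space UNIV"
      unfolding f_def interval_digits_def .
  qed
  have cyl_cube: "cyl xs \<in> sets bool_cube" for xs
    using cyl_sets[of xs] unfolding sets .
  have f_vimage: "f -` cyl xs \<in> sets borel" for xs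
    using measurable_sets[OF f cyl_cube[of xs]] by simp
  have f': "f \<in> uniform_measure lborel {0..1} \<rightarrow>\<^sub>M bool_cube"
    using f measurable_cong_sets[of "uniform_measure lborel {0..1}" borel bool_cube bool_cube]
    by simp
  have uniform: "prob_space (uniform_measure lborel {0..1::real})"
    by (rule prob_space_uniform_measure) auto
  have "distr (uniform_measure lborel {0..1::real}) bool_cube f = Q"
  proof (rule bool_seq_measure_eqI)
    show "finite_measure (distr (uniform_measure lborel {0..1::real}) bool_cube f)"
      using uniform f' by (intro finite_measure.finite_measure_distr prob_space.finite_measure)
    fix xs
    obtain l where l: "l \<ge> 0" "l + c xs \<le> 1" and
      all: "\<forall>v\<in>{0..<1}.
        (fst (interval_state c v (length xs)) = xs \<longleftrightarrow> l \<le> v \<and> v < l + c xs) \<and>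
        (fst (interval_state c v (length xs)) = xs \<longrightarrow>
          snd (interval_state c v (length xs)) = v - l)"
      using interval_state_interval[of c xs, OF c] by (elim exE conjE)
    have iff: "fst (interval_state c v (length xs)) = xs \<longleftrightarrow> l \<le> v \<and> v < l + c xs"
      if "v \<in> {0..<1}" for v
      using bspec[OF all that] by (rule conjunct1)
    have f_cyl: "f v \<in> cyl xs \<longleftrightarrow> fst (interval_state c v (length xs)) = xs" for v
    proof
      assume "f v \<in> cyl xs"
      then show "fst (interval_state c v (length xs)) = xs"
        unfolding interval_state_digits by (intro nth_equalityI) (simp_all add: cyl_def f_def)
    next
      assume "fst (interval_state c v (length xs)) = xs"
      then have eq: "map (f v) [0..<length xs] = xs"
        unfolding interval_state_digits f_def .
      have "f v i = xs ! i" if "i < length xs" for i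
      proof -
        have "f v i = map (f v) [0..<length xs] ! i" using that by simp
        also have "\<dots> = xs ! i" by (simp only: eq)
        finally show ?thesis .
      qed
      then show "f v \<in> cyl xs" unfolding cyl_def by blast
    qed
    have "emeasure (distr (uniform_measure lborel {0..1}) bool_cube f) (cyl xs) =
      emeasure (uniform_measure lborel {0..1}) (f -` cyl xs)"
      by (subst emeasure_distr[OF f' cyl_cube]) simp
    also have "\<dots> = emeasure lborel ({0..1} \<inter> f -` cyl xs)"
      using f_vimage[of xs] by (subst emeasure_uniform_measure) (simp_all add: divide_ennreal_def)
    also have "\<dots> = emeasure lborel {l..<l + c xs}"
    proof (rule emeasure_eq_AE)
      \<comment> \<open>The intervals cover \<open>[0, 1)\<close> only.\<close>
      have "AE v in lborel. v \<noteq> (1::real)" by (rule AE_lborel_singleton)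
      then show "AE v in lborel. (v \<in> {0..1} \<inter> f -` cyl xs) = (v \<in> {l..<l + c xs})"
      proof eventually_elim
        case (elim v)
        then show ?case using iff[of v] l f_cyl[of v] by auto
      qed
    qed (use f_vimage[of xs] in simp_all)
    also have "\<dots> = emeasure Q (cyl xs)"
      using c(1)[of xs] by (simp add: c_def Q.emeasure_eq_measure)
    finally show "emeasure (distr (uniform_measure lborel {0..1}) bool_cube f)
        {z. \<forall>i<length xs. z i = xs ! i} = emeasure Q {z. \<forall>i<length xs. z i = xs ! i}"
      by (simp add: cyl_def)
  qed (use sets in simp_all)
  with f show ?thesis by (rule that)
qed

section \<open>Splitting the index set by labels\<close>

definition both_infinite :: "(nat \<Rightarrow> bool) \<Rightarrow> bool" where
  "both_infinite j \<longleftrightarrow> infinite {i. j i} \<and> infinite {i. \<not> j i}"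

text \<open>
  The labels of an i.i.d. sequence almost surely take both values infinitely often. All other label
  sequences are replaced by the alternating sequence, so that \<open>pick j True\<close> and \<open>pick j False\<close> always list two
  complementary infinite sets.
\<close>

definition side :: "(nat \<Rightarrow> bool) \<Rightarrow> nat \<Rightarrow> bool" where
  "side j = (if both_infinite j then j else even)"

definition pick :: "(nat \<Rightarrow> bool) \<Rightarrow> bool \<Rightarrow> nat \<Rightarrow> nat" where
  "pick j k = enumerate {i. side j i = k}"

lemma infinite_side: "infinite {i. side j i = k}"
proof -
  have "\<exists>n>m. even n" "\<exists>n>m. odd n" for m :: nat
    by (rule exI[of _ "2 * Suc m"], simp) (rule exI[of _ "Suc (2 * m)"], simp)
  then have "infinite {i :: nat. even i}" "infinite {i :: nat. odd i}"
    by (simp_all add: infinite_nat_iff_unbounded)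
  then show ?thesis
    by (cases k) (auto simp: side_def both_infinite_def)
qed

lemma strict_mono_pick: "strict_mono (pick j k)"
  unfolding pick_def by (rule strict_mono_enumerate[OF infinite_side])

lemma pick_eq_iff [simp]: "pick j k i = pick j k i' \<longleftrightarrow> i = i'"
  using strict_mono_eq[OF strict_mono_pick] .

lemma range_pick: "range (pick j k) = {i. side j i = k}"
  unfolding pick_def by (rule range_enumerate[OF infinite_side])

lemma side_pick [simp]: "side j (pick j k i) = k"
  using range_pick[of j k] by blast

lemma pick_neq: "pick j True i \<noteq> pick j False i'"
  using side_pick[of j True i] side_pick[of j False i'] by metis

lemma le_pick: "i \<le> pick j k i"
  by (rule strict_mono_imp_increasing[OF strict_mono_pick])

lemma measurable_side [measurable]: "(\<lambda>j. side j i) \<in> bool_cube \<rightarrow>\<^sub>M count_space UNIV"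
proof -
  have [measurable]: "(\<lambda>j. j i) \<in> bool_cube \<rightarrow>\<^sub>M count_space UNIV" for i :: nat
    by (rule measurable_component_singleton) simp
  show ?thesis
    unfolding side_def both_infinite_def infinite_nat_iff_unbounded mem_Collect_eq
    by measurable
qed

lemma measurable_enumerate:
  fixes E :: "'x \<Rightarrow> nat set"
  assumes "\<And>n. (\<lambda>x. n \<in> E x) \<in> M \<rightarrow>\<^sub>M count_space UNIV"
  shows "(\<lambda>x. enumerate (E x) i) \<in> M \<rightarrow>\<^sub>M count_space UNIV"
  using assms
proof (induction i arbitrary: E)
  case 0
  note [measurable] = 0
  show ?case unfolding enumerate_0 by (rule measurable_Least) (rule 0)
next
  case (Suc i)
  note [measurable] = Suc.prems
  show ?case unfolding enumerate_Suc
  proof (rule Suc.IH)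
    fix n
    have [measurable]: "(\<lambda>x. LEAST m. m \<in> E x) \<in> M \<rightarrow>\<^sub>M count_space UNIV"
      by (rule measurable_Least) (rule Suc.prems)
    show "(\<lambda>x. n \<in> E x - {LEAST m. m \<in> E x}) \<in> M \<rightarrow>\<^sub>M count_space UNIV"
      unfolding Diff_iff singleton_iff by measurable
  qed
qed

lemma measurable_pick [measurable]: "(\<lambda>j. pick j k i) \<in> bool_cube \<rightarrow>\<^sub>M count_space UNIV"
  unfolding pick_def by (rule measurable_enumerate) (unfold mem_Collect_eq, measurable)

text \<open>
  The number of indices below \<open>N\<close> with label \<open>k\<close>, counted as the position of the first listed index
  that is not below \<open>N\<close>.
\<close>

definition pick_count :: "(nat \<Rightarrow> bool) \<Rightarrow> bool \<Rightarrow> enat \<Rightarrow> enat" where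
  "pick_count j k N = (case N of enat n \<Rightarrow> enat (LEAST i. n \<le> pick j k i) | \<infinity> \<Rightarrow> \<infinity>)"

lemma less_pick_count_iff: "enat i < pick_count j k N \<longleftrightarrow> enat (pick j k i) < N"
proof (cases N)
  case (enat n)
  let ?m = "LEAST i. n \<le> pick j k i"
  have "n \<le> pick j k ?m" by (rule LeastI[of _ n]) (rule le_pick)
  then have "i < ?m \<longleftrightarrow> pick j k i < n"
    using not_less_Least[of i "\<lambda>i. n \<le> pick j k i"] strict_mono_less[OF strict_mono_pick, of j k i ?m]
      strict_mono_less_eq[OF strict_mono_pick, of j k ?m i]
    by (metis leI le_less_trans not_le)
  then show ?thesis by (simp add: enat pick_count_def)
qed (simp add: pick_count_def)

lemma measurable_pick_count:
  assumes [measurable]: "J \<in> M \<rightarrow>\<^sub>M bool_cube" "N \<in> M \<rightarrow>\<^sub>M count_space UNIV"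
  shows "(\<lambda>x. pick_count (J x) k (N x)) \<in> M \<rightarrow>\<^sub>M count_space UNIV"
  unfolding pick_count_def by measurable

section \<open>Splitting an i.i.d. sequence of points\<close>

text \<open>
  Conditionally on \<open>s\<close> the second component has law \<open>R\<close>, whatever \<open>s\<close> is; so it is independent of
  every function of \<open>s\<close>.
\<close>

lemma distr_pair_skew:
  assumes P: "prob_space P" and Q: "prob_space Q" and R: "prob_space R"
    and g [measurable]: "g \<in> P \<rightarrow>\<^sub>M K"
    and h [measurable]: "(\<lambda>(s, q). h s q) \<in> P \<Otimes>\<^sub>M Q \<rightarrow>\<^sub>M R"
    and fibre: "\<And>s. s \<in> space P \<Longrightarrow> distr Q R (h s) = R"
  shows "distr (P \<Otimes>\<^sub>M Q) (K \<Otimes>\<^sub>M R) (\<lambda>(s, q). (g s, h s q)) = distr P K g \<Otimes>\<^sub>M R"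
proof (rule pair_measure_eqI[symmetric])
  interpret P: prob_space P by fact
  interpret Q: prob_space Q by fact
  interpret R: prob_space R by fact
  interpret D: prob_space "distr P K g" by (rule P.prob_space_distr) fact
  show "sigma_finite_measure (distr P K g)" "sigma_finite_measure R"
    by unfold_locales
  show "sets (distr P K g \<Otimes>\<^sub>M R) = sets (distr (P \<Otimes>\<^sub>M Q) (K \<Otimes>\<^sub>M R) (\<lambda>(s, q). (g s, h s q)))"
    by (simp cong: sets_pair_measure_cong)
  fix A B assume "A \<in> sets (distr P K g)" and B [measurable]: "B \<in> sets R"
  then have A [measurable]: "A \<in> sets K" by simp
  have [measurable]: "h s \<in> Q \<rightarrow>\<^sub>M R" if "s \<in> space P" for s
    using measurable_compose[OF measurable_Pair1'[OF that] h] by simp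
  have pair: "(\<lambda>(s, q). (g s, h s q)) \<in> P \<Otimes>\<^sub>M Q \<rightarrow>\<^sub>M K \<Otimes>\<^sub>M R"
    by measurable
  have "emeasure (distr (P \<Otimes>\<^sub>M Q) (K \<Otimes>\<^sub>M R) (\<lambda>(s, q). (g s, h s q))) (A \<times> B) =
     (\<integral>\<^sup>+s. emeasure Q (Pair s -` ((\<lambda>(s, q). (g s, h s q)) -` (A \<times> B) \<inter> space (P \<Otimes>\<^sub>M Q))) \<partial>P)"
    by (subst emeasure_distr[OF pair], simp)
      (intro Q.emeasure_pair_measure_alt measurable_sets[OF pair], simp)
  also have "\<dots> = (\<integral>\<^sup>+s. indicator (g -` A \<inter> space P) s * emeasure R B \<partial>P)"
  proof (rule nn_integral_cong)
    fix s assume s: "s \<in> space P"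
    have "emeasure R B = emeasure Q (h s -` B \<inter> space Q)"
      using s by (subst fibre[OF s, symmetric]) (simp add: emeasure_distr)
    moreover have "Pair s -` ((\<lambda>(s, q). (g s, h s q)) -` (A \<times> B) \<inter> space (P \<Otimes>\<^sub>M Q)) =
      (if g s \<in> A then h s -` B \<inter> space Q else {})"
      using s by (auto simp: space_pair_measure)
    ultimately show "emeasure Q (Pair s -` ((\<lambda>(s, q). (g s, h s q)) -` (A \<times> B) \<inter> space (P \<Otimes>\<^sub>M Q))) =
      indicator (g -` A \<inter> space P) s * emeasure R B"
      using s by (simp add: indicator_def)
  qed
  also have "\<dots> = emeasure (distr P K g) A * emeasure R B"
    by (simp add: nn_integral_multc emeasure_distr)
  finally show "emeasure (distr P K g) A * emeasure R B =
    emeasure (distr (P \<Otimes>\<^sub>M Q) (K \<Otimes>\<^sub>M R) (\<lambda>(s, q). (g s, h s q))) (A \<times> B)" ..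
qed

lemma distr_pair_snd:
  assumes "prob_space P" "prob_space Q"
  shows "distr (P \<Otimes>\<^sub>M Q) Q snd = Q"
proof (rule measure_eqI)
  interpret P: prob_space P by fact
  interpret Q: prob_space Q by fact
  fix X assume "X \<in> sets (distr (P \<Otimes>\<^sub>M Q) Q snd)"
  then have X: "X \<in> sets Q" by simp
  then have "snd -` X \<inter> space (P \<Otimes>\<^sub>M Q) = space P \<times> X"
    using sets.sets_into_space[OF X] by (auto simp: space_pair_measure)
  then show "emeasure (distr (P \<Otimes>\<^sub>M Q) Q snd) X = emeasure Q X"
    using X by (simp add: emeasure_distr Q.emeasure_pair_measure_Times P.emeasure_space_1)
qed simp

abbreviation seq_law :: "'a measure \<Rightarrow> (nat \<Rightarrow> 'a) measure" where
  "seq_law \<sigma> \<equiv> \<Pi>\<^sub>M i\<in>UNIV. \<sigma>"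

lemma prob_space_seq_law: "prob_space \<sigma> \<Longrightarrow> prob_space (seq_law \<sigma>)"
  by (rule prob_space_PiM)

lemma emeasure_seq_law_cylinder:
  assumes "prob_space \<sigma>" "finite J" "\<And>i. i \<in> J \<Longrightarrow> A i \<in> sets \<sigma>"
  shows "emeasure (seq_law \<sigma>) {s\<in>space (seq_law \<sigma>). \<forall>i\<in>J. s i \<in> A i} = (\<Prod>i\<in>J. emeasure \<sigma> (A i))"
proof -
  have "{s\<in>space (seq_law \<sigma>). \<forall>i\<in>J. s i \<in> A i} = prod_emb UNIV (\<lambda>_. \<sigma>) J (Pi\<^sub>E J A)"
    by (auto simp: prod_emb_def space_PiM)
  then show ?thesis
    using emeasure_PiM_emb[of UNIV "\<lambda>_. \<sigma>" J A] assms by simp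
qed

lemma distr_seq_law_reindex:
  assumes "prob_space \<sigma>" "inj f"
  shows "distr (seq_law \<sigma>) (seq_law \<sigma>) (\<lambda>s i. s (f i)) = seq_law \<sigma>"
  using distr_PiM_reindex[of UNIV "\<lambda>_. \<sigma>" f UNIV] assms by (simp add: restrict_UNIV)

lemma nn_integral_seq_law_prod:
  assumes "prob_space \<sigma>" "finite J" and h [measurable]: "\<And>k. k \<in> J \<Longrightarrow> h k \<in> borel_measurable \<sigma>"
  shows "(\<integral>\<^sup>+s. (\<Prod>k\<in>J. h k (s k)) \<partial>seq_law \<sigma>) = (\<Prod>k\<in>J. \<integral>\<^sup>+x. h k x \<partial>\<sigma>)"
proof -
  interpret S: prob_space \<sigma> by fact
  interpret P: product_prob_space "\<lambda>_::nat. \<sigma>" UNIV ..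
  have [measurable]: "(\<lambda>s. \<Prod>k\<in>J. h k (s k)) \<in> borel_measurable (\<Pi>\<^sub>M k\<in>J. \<sigma>)"
    using h by (intro borel_measurable_prod_ennreal measurable_compose[OF measurable_component_singleton]) auto
  have "(\<Prod>k\<in>J. \<integral>\<^sup>+x. h k x \<partial>\<sigma>) = (\<integral>\<^sup>+s. (\<Prod>k\<in>J. h k (s k)) \<partial>(\<Pi>\<^sub>M k\<in>J. \<sigma>))"
    using assms(2) h by (intro P.product_nn_integral_prod[symmetric])
  also have "\<dots> = (\<integral>\<^sup>+s. (\<Prod>k\<in>J. h k (s k)) \<partial>distr (seq_law \<sigma>) (\<Pi>\<^sub>M k\<in>J. \<sigma>) (\<lambda>s. restrict s J))"
    using P.distr_PiM_restrict_finite[of J] assms(2) by simp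
  also have "\<dots> = (\<integral>\<^sup>+s. (\<Prod>k\<in>J. h k (restrict s J k)) \<partial>seq_law \<sigma>)"
    by (intro nn_integral_distr measurable_restrict_subset) auto
  finally show ?thesis by simp
qed

text \<open>
  The probability that \<open>D\<close> is missed from the index \<open>m\<close> on is at most \<open>q ^ n\<close> for every \<open>n\<close>, where \<open>q < 1\<close>
  is the probability of missing \<open>D\<close> once.
\<close>

lemma AE_seq_law_infinitely_often:
  assumes "prob_space \<sigma>" and D [measurable]: "D \<in> sets \<sigma>" and pos: "emeasure \<sigma> D \<noteq> 0"
  shows "AE s in seq_law \<sigma>. infinite {i. s i \<in> D}"
proof -
  interpret S: prob_space \<sigma> by fact
  interpret P: prob_space "seq_law \<sigma>" by (rule prob_space_seq_law) fact
  have [measurable]: "(\<lambda>s. s i) \<in> seq_law \<sigma> \<rightarrow>\<^sub>M \<sigma>" for i :: nat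
    by (rule measurable_component_singleton) simp
  have "AE s in seq_law \<sigma>. \<exists>i\<ge>m. s i \<in> D" for m
  proof -
    let ?q = "S.prob (space \<sigma> - D)"
    let ?Z = "{s\<in>space (seq_law \<sigma>). \<forall>i\<ge>m. s i \<notin> D}"
    have [measurable]: "?Z \<in> sets (seq_law \<sigma>)" by measurable
    have "P.prob ?Z \<le> ?q ^ n" for n
    proof -
      have "P.prob ?Z \<le> P.prob {s\<in>space (seq_law \<sigma>). \<forall>i\<in>{m..<m+n}. s i \<in> space \<sigma> - D}"
      proof (rule P.finite_measure_mono)
        show "{s\<in>space (seq_law \<sigma>). \<forall>i\<in>{m..<m+n}. s i \<in> space \<sigma> - D} \<in> P.events"
          by measurable
      qed (auto simp: space_PiM)
      also have "\<dots> = ?q ^ n"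
        using emeasure_seq_law_cylinder[OF assms(1), of "{m..<m+n}" "\<lambda>_. space \<sigma> - D"]
        by (simp add: P.emeasure_eq_measure S.emeasure_eq_measure ennreal_power)
      finally show ?thesis .
    qed
    moreover have "(\<lambda>n. ?q ^ n) \<longlonglongrightarrow> 0"
    proof (rule LIMSEQ_realpow_zero)
      show "?q < 1"
        using pos by (simp add: S.prob_compl S.emeasure_eq_measure zero_less_measure_iff)
    qed simp
    ultimately have "P.prob ?Z \<le> 0"
      by (meson LIMSEQ_le_const)
    then have "emeasure (seq_law \<sigma>) ?Z = 0"
      by (simp add: P.emeasure_eq_measure measure_le_0_iff)
    then show ?thesis by (intro AE_I[of _ _ ?Z]) auto
  qed
  then have "AE s in seq_law \<sigma>. \<forall>m. \<exists>i\<ge>m. s i \<in> D"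
    by (simp add: AE_all_countable)
  then show ?thesis by eventually_elim (simp add: infinite_nat_iff_unbounded_le)
qed

text \<open>
  An i.i.d. sequence from \<open>\<sigma>\<close> may be produced in two steps: first an i.i.d. sequence \<open>s\<close> from \<open>\<sigma>\<close>
  decides on which side of the cut \<open>D\<close> each term lies, then the term is drawn afresh from the
  conditional law of that side. In this form the values are independent of the sides.
\<close>

lemma seq_law_resample:
  assumes \<sigma>: "prob_space \<sigma>" and \<sigma>1: "prob_space \<sigma>1" and \<sigma>2: "prob_space \<sigma>2"
    and sets1 [measurable_cong]: "sets \<sigma>1 = sets \<sigma>" and sets2 [measurable_cong]: "sets \<sigma>2 = sets \<sigma>"
    and D [measurable]: "D \<in> sets \<sigma>"
    and mixture: "\<And>E. E \<in> sets \<sigma> \<Longrightarrow>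
      emeasure \<sigma> E = emeasure \<sigma> D * emeasure \<sigma>1 E + emeasure \<sigma> (space \<sigma> - D) * emeasure \<sigma>2 E"
  shows "distr (seq_law \<sigma> \<Otimes>\<^sub>M (seq_law \<sigma>1 \<Otimes>\<^sub>M seq_law \<sigma>2)) (seq_law \<sigma>)
    (\<lambda>(s, x, y) i. if s i \<in> D then x i else y i) = seq_law \<sigma>"
proof -
  interpret S: prob_space "seq_law \<sigma>" by (rule prob_space_seq_law) fact
  interpret S1: prob_space "seq_law \<sigma>1" by (rule prob_space_seq_law) fact
  interpret S2: prob_space "seq_law \<sigma>2" by (rule prob_space_seq_law) fact
  interpret S12: pair_prob_space "seq_law \<sigma>1" "seq_law \<sigma>2" ..
  interpret R: pair_prob_space "seq_law \<sigma>" "seq_law \<sigma>1 \<Otimes>\<^sub>M seq_law \<sigma>2" ..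
  let ?R = "seq_law \<sigma> \<Otimes>\<^sub>M (seq_law \<sigma>1 \<Otimes>\<^sub>M seq_law \<sigma>2)"
  let ?T = "\<lambda>(s, x, y) i. if s i \<in> D then x i else y i"
  have space: "space \<sigma>1 = space \<sigma>" "space \<sigma>2 = space \<sigma>"
    using sets_eq_imp_space_eq[OF sets1] sets_eq_imp_space_eq[OF sets2] by auto
  have comp [measurable]: "(\<lambda>s. s i) \<in> seq_law \<tau> \<rightarrow>\<^sub>M \<tau>" for i :: nat and \<tau> :: "'a measure"
    by (rule measurable_component_singleton) simp
  have T [measurable]: "?T \<in> ?R \<rightarrow>\<^sub>M seq_law \<sigma>"
  proof -
    have "(\<lambda>z. ?T z i) \<in> ?R \<rightarrow>\<^sub>M \<sigma>" for i
      unfolding split_beta by measurable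
    then have "(\<lambda>z i. ?T z i) \<in> ?R \<rightarrow>\<^sub>M seq_law \<sigma>"
      by (intro measurable_PiM_single') (auto simp: space_pair_measure space_PiM space PiE_iff)
    then show ?thesis by simp
  qed
  show ?thesis
  proof (rule measure_eqI_PiM_infinite)
    show "finite_measure (distr ?R (seq_law \<sigma>) ?T)"
      by (rule R.finite_measure_distr[OF T])
    fix A and J :: "nat set" assume J: "finite J" and A: "\<And>i. i \<in> J \<Longrightarrow> A i \<in> sets \<sigma>"
    let ?C = "prod_emb UNIV (\<lambda>_. \<sigma>) J (Pi\<^sub>E J A)"
    have C: "?C = {s\<in>space (seq_law \<sigma>). \<forall>i\<in>J. s i \<in> A i}"
      by (auto simp: prod_emb_def space_PiM)
    have C_sets: "?C \<in> sets (seq_law \<sigma>)"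
      using J A by (intro sets_PiM_I) auto
    \<comment> \<open>\<open>h k (s k)\<close> is the conditional probability, given \<open>s\<close>, that the term \<open>k\<close> lies in \<open>A k\<close>.\<close>
    define h where "h k v = (if v \<in> D then emeasure \<sigma>1 (A k) else emeasure \<sigma>2 (A k))" for k v
    have "emeasure (distr ?R (seq_law \<sigma>) ?T) ?C =
      (\<integral>\<^sup>+s. emeasure (seq_law \<sigma>1 \<Otimes>\<^sub>M seq_law \<sigma>2) (Pair s -` (?T -` ?C \<inter> space ?R)) \<partial>seq_law \<sigma>)"
      by (subst emeasure_distr[OF T C_sets])
        (intro sigma_finite_measure.emeasure_pair_measure_alt prob_space_imp_sigma_finite S12.prob_space_axioms measurable_sets[OF T C_sets])
    also have "\<dots> = (\<integral>\<^sup>+s. (\<Prod>k\<in>J. h k (s k)) \<partial>seq_law \<sigma>)"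
    proof (rule nn_integral_cong)
      fix s assume s: "s \<in> space (seq_law \<sigma>)"
      let ?K = "J \<inter> {k. s k \<in> D}" and ?L = "J \<inter> - {k. s k \<in> D}"
      let ?X = "{x\<in>space (seq_law \<sigma>1). \<forall>i\<in>?K. x i \<in> A i}"
      let ?Y = "{y\<in>space (seq_law \<sigma>2). \<forall>i\<in>?L. y i \<in> A i}"
      have "Pair s -` (?T -` ?C \<inter> space ?R) = ?X \<times> ?Y"
        using s unfolding C by (auto simp: space_pair_measure space_PiM space PiE_iff split: if_splits)
      moreover have "?X \<in> sets (seq_law \<sigma>1)" "?Y \<in> sets (seq_law \<sigma>2)"
        using J A by (auto simp: sets1 sets2 intro!: sets.sets_Collect_finite_All' sets_Collect_single' )
      ultimately have "emeasure (seq_law \<sigma>1 \<Otimes>\<^sub>M seq_law \<sigma>2) (Pair s -` (?T -` ?C \<inter> space ?R)) =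
        emeasure (seq_law \<sigma>1) ?X * emeasure (seq_law \<sigma>2) ?Y"
        by (simp add: S2.emeasure_pair_measure_Times)
      also have "\<dots> = (\<Prod>k\<in>?K. emeasure \<sigma>1 (A k)) * (\<Prod>k\<in>?L. emeasure \<sigma>2 (A k))"
        using J A emeasure_seq_law_cylinder[OF \<sigma>1, of ?K A] emeasure_seq_law_cylinder[OF \<sigma>2, of ?L A]
        by (simp add: sets1 sets2)
      also have "\<dots> = (\<Prod>k\<in>J. h k (s k))"
        using J unfolding h_def by (rule prod.If_cases[symmetric])
      finally show "emeasure (seq_law \<sigma>1 \<Otimes>\<^sub>M seq_law \<sigma>2) (Pair s -` (?T -` ?C \<inter> space ?R)) =
        (\<Prod>k\<in>J. h k (s k))" .
    qed
    also have "\<dots> = (\<Prod>k\<in>J. \<integral>\<^sup>+v. h k v \<partial>\<sigma>)"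
      using \<sigma> J by (rule nn_integral_seq_law_prod) (simp add: h_def)
    also have "\<dots> = (\<Prod>k\<in>J. emeasure \<sigma> (A k))"
    proof (rule prod.cong[OF refl])
      fix k assume k: "k \<in> J"
      have "(\<integral>\<^sup>+v. h k v \<partial>\<sigma>) = (\<integral>\<^sup>+v. emeasure \<sigma>1 (A k) * indicator D v +
          emeasure \<sigma>2 (A k) * indicator (space \<sigma> - D) v \<partial>\<sigma>)"
        by (intro nn_integral_cong) (auto simp: h_def)
      also have "\<dots> = emeasure \<sigma> (A k)"
        unfolding mixture[OF A[OF k]]
        by (subst nn_integral_add, simp, simp, subst (1 2) nn_integral_cmult_indicator)
          (simp_all add: mult.commute)
      finally show "(\<integral>\<^sup>+v. h k v \<partial>\<sigma>) = emeasure \<sigma> (A k)" .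
    qed
    also have "\<dots> = emeasure (seq_law \<sigma>) ?C"
      unfolding C using emeasure_seq_law_cylinder[OF \<sigma> J A] by simp
    finally show "emeasure (distr ?R (seq_law \<sigma>) ?T) ?C = emeasure (seq_law \<sigma>) ?C" .
  qed simp_all
qed

lemma measurable_seqI:
  assumes "\<And>i. (\<lambda>z. f z i) \<in> N \<rightarrow>\<^sub>M \<sigma>"
  shows "f \<in> N \<rightarrow>\<^sub>M seq_law \<sigma>"
proof -
  have "(\<lambda>z i. f z i) \<in> N \<rightarrow>\<^sub>M seq_law \<sigma>"
  proof (rule measurable_PiM_single')
    show "(\<lambda>z i. f z i) \<in> space N \<rightarrow> (\<Pi>\<^sub>E i\<in>UNIV. space \<sigma>)"
      using measurable_space[OF assms] by (auto simp: PiE_UNIV_domain)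
  qed (rule assms)
  then show ?thesis .
qed

lemma measurable_seq_component: "(\<lambda>s. s i) \<in> seq_law \<sigma> \<rightarrow>\<^sub>M \<sigma>"
  by (rule measurable_component_singleton) (rule UNIV_I)

definition hits :: "'a set \<Rightarrow> (nat \<Rightarrow> 'a) \<Rightarrow> nat \<Rightarrow> bool" where
  "hits D s = (\<lambda>i. s i \<in> D)"

lemma measurable_hits:
  assumes "D \<in> sets \<sigma>"
  shows "hits D \<in> seq_law \<sigma> \<rightarrow>\<^sub>M bool_cube"
proof (rule measurable_bool_cubeI)
  fix p
  note [measurable] = assms measurable_seq_component
  show "(\<lambda>s. hits D s p) \<in> seq_law \<sigma> \<rightarrow>\<^sub>M count_space UNIV"
    unfolding hits_def by measurable
qed

lemma measurable_pick_seq: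
  assumes "J \<in> N \<rightarrow>\<^sub>M bool_cube" and "f \<in> N \<rightarrow>\<^sub>M seq_law \<sigma>"
  shows "(\<lambda>z i. f z (pick (J z) k i)) \<in> N \<rightarrow>\<^sub>M seq_law \<sigma>"
proof (rule measurable_seqI)
  fix i
  have f: "(\<lambda>z. f z n) \<in> N \<rightarrow>\<^sub>M \<sigma>" for n
    using assms(2) measurable_seq_component by (rule measurable_compose)
  have "(\<lambda>z. pick (J z) k i) \<in> N \<rightarrow>\<^sub>M count_space UNIV"
    using assms(1) measurable_pick by (rule measurable_compose)
  with f show "(\<lambda>z. f z (pick (J z) k i)) \<in> N \<rightarrow>\<^sub>M \<sigma>"
    by (rule measurable_compose_countable)
qed

lemma AE_pair_measure_fst:
  assumes "prob_space Q" and "AE x in P. A x"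
  shows "AE z in P \<Otimes>\<^sub>M Q. A (fst z)"
proof -
  interpret Q: prob_space Q by fact
  have "AE x in distr (P \<Otimes>\<^sub>M Q) P fst. A x"
    using assms(2) by (simp only: Q.distr_pair_fst)
  then show ?thesis by (rule AE_distrD[OF measurable_fst])
qed

lemma AE_pair_measure_snd:
  assumes "prob_space Q" and "AE x in Q. A x"
  shows "AE z in P \<Otimes>\<^sub>M Q. A (snd z)"
proof -
  interpret Q: prob_space Q by fact
  obtain N where N: "{x\<in>space Q. \<not> A x} \<subseteq> N" "N \<in> sets Q" "emeasure Q N = 0"
    using assms(2) by (auto elim: AE_E)
  have "{z\<in>space (P \<Otimes>\<^sub>M Q). \<not> A (snd z)} \<subseteq> space P \<times> N"
    using N(1) by (auto simp: space_pair_measure)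
  moreover have "emeasure (P \<Otimes>\<^sub>M Q) (space P \<times> N) = 0"
    using N by (simp add: Q.emeasure_pair_measure_Times)
  ultimately show ?thesis
    using N(2) by (intro AE_I[where N="space P \<times> N"]) auto
qed

lemma AE_seq_law_uniform_measure:
  assumes "prob_space (uniform_measure \<sigma> D)" "D \<in> sets \<sigma>"
  shows "AE s in seq_law (uniform_measure \<sigma> D). \<forall>i. s i \<in> D"
proof -
  have "AE x in uniform_measure \<sigma> D. x \<in> D"
    using assms(2) by (intro AE_uniform_measureI) auto
  then have "AE s in seq_law (uniform_measure \<sigma> D). s i \<in> D" for i
    using AE_PiM_component[of "UNIV :: nat set" "\<lambda>_. uniform_measure \<sigma> D" i "\<lambda>x. x \<in> D"] assms(1)
    by simp
  then show ?thesis by (simp add: AE_all_countable)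
qed

text \<open>
  Produce the sequence as in \<open>seq_law_resample\<close>. The labels are then a function of \<open>s\<close>, and the
  subsequence with label \<open>True\<close> reads \<open>x\<close> along indices that depend on \<open>s\<close> only. As \<open>x\<close> is i.i.d.,
  this reading has the law of \<open>x\<close> whatever \<open>s\<close> is; the other label reads \<open>y\<close> likewise.
\<close>

lemma seq_law_split:
  fixes \<sigma> :: "'a measure"
  defines "\<rho> \<equiv> \<lambda>E. seq_law (uniform_measure \<sigma> E)"
  assumes \<sigma>: "prob_space \<sigma>" and D [measurable]: "D \<in> sets \<sigma>"
    and pos: "emeasure \<sigma> D \<noteq> 0" "emeasure \<sigma> (space \<sigma> - D) \<noteq> 0"
  shows "distr (seq_law \<sigma>) (bool_cube \<Otimes>\<^sub>M (\<rho> D \<Otimes>\<^sub>M \<rho> (space \<sigma> - D)))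
      (\<lambda>s. (hits D s, \<lambda>i. s (pick (hits D s) True i), \<lambda>i. s (pick (hits D s) False i))) =
    distr (seq_law \<sigma>) bool_cube (hits D) \<Otimes>\<^sub>M (\<rho> D \<Otimes>\<^sub>M \<rho> (space \<sigma> - D))"
proof -
  interpret S: prob_space \<sigma> by fact
  have \<sigma>1: "prob_space (uniform_measure \<sigma> D)"
    and \<sigma>2: "prob_space (uniform_measure \<sigma> (space \<sigma> - D))"
    using pos by (auto intro!: prob_space_uniform_measure)
  interpret P: prob_space "seq_law \<sigma>" by (rule prob_space_seq_law) fact
  interpret S1: prob_space "\<rho> D" unfolding \<rho>_def by (rule prob_space_seq_law) fact
  interpret S2: prob_space "\<rho> (space \<sigma> - D)" unfolding \<rho>_def by (rule prob_space_seq_law) fact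
  interpret S12: pair_prob_space "\<rho> D" "\<rho> (space \<sigma> - D)" ..
  let ?Q = "\<rho> D \<Otimes>\<^sub>M \<rho> (space \<sigma> - D)"
  interpret R: pair_prob_space "seq_law \<sigma>" ?Q ..
  let ?T = "\<lambda>(s, x, y) i. if s i \<in> D then x i else y i :: 'a"
  let ?J = "hits D"
  define h where "h s q = (\<lambda>i. fst q (pick (?J s) True i) :: 'a, \<lambda>i. snd q (pick (?J s) False i) :: 'a)"
    for s q
  let ?g = "\<lambda>s. (?J s, h s (s, s))"
  have sets_\<rho>: "sets (\<rho> E) = sets (seq_law \<sigma>)" for E
    unfolding \<rho>_def by (intro sets_PiM_cong) simp_all
  have into_\<rho>: "N \<rightarrow>\<^sub>M \<rho> E = N \<rightarrow>\<^sub>M seq_law \<sigma>" for N :: "'b measure" and E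
    by (rule measurable_cong_sets[OF refl sets_\<rho>])
  have from_\<rho>: "\<rho> E \<rightarrow>\<^sub>M N = seq_law \<sigma> \<rightarrow>\<^sub>M N" for N :: "'b measure" and E
    by (rule measurable_cong_sets[OF sets_\<rho> refl])
  note J = measurable_hits[OF D]
  have coord: "fst \<in> seq_law \<sigma> \<Otimes>\<^sub>M ?Q \<rightarrow>\<^sub>M seq_law \<sigma>"
    "(\<lambda>z. fst (snd z)) \<in> seq_law \<sigma> \<Otimes>\<^sub>M ?Q \<rightarrow>\<^sub>M seq_law \<sigma>"
    "(\<lambda>z. snd (snd z)) \<in> seq_law \<sigma> \<Otimes>\<^sub>M ?Q \<rightarrow>\<^sub>M seq_law \<sigma>"
    using measurable_compose[OF measurable_snd measurable_fst, of "seq_law \<sigma>" "\<rho> D" "\<rho> (space \<sigma> - D)"]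
      measurable_compose[OF measurable_snd measurable_snd, of "seq_law \<sigma>" "\<rho> D" "\<rho> (space \<sigma> - D)"]
    by (simp_all only: into_\<rho> measurable_fst)
  have T: "?T \<in> seq_law \<sigma> \<Otimes>\<^sub>M ?Q \<rightarrow>\<^sub>M seq_law \<sigma>"
  proof (rule measurable_seqI)
    fix i
    note [measurable] = coord[THEN measurable_compose[OF _ measurable_seq_component[of i]]]
    show "(\<lambda>z. ?T z i) \<in> seq_law \<sigma> \<Otimes>\<^sub>M ?Q \<rightarrow>\<^sub>M \<sigma>"
      unfolding split_beta by measurable
  qed
  have h: "(\<lambda>(s, q). h s q) \<in> seq_law \<sigma> \<Otimes>\<^sub>M ?Q \<rightarrow>\<^sub>M ?Q"
    unfolding h_def split_beta
    by (intro measurable_Pair; unfold into_\<rho>;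
      intro measurable_pick_seq coord measurable_compose[OF coord(1) J])
  have g: "?g \<in> seq_law \<sigma> \<rightarrow>\<^sub>M bool_cube \<Otimes>\<^sub>M ?Q"
    unfolding h_def fst_conv snd_conv
    by (intro measurable_Pair J; unfold into_\<rho>; intro measurable_pick_seq J measurable_ident_sets[OF refl])
  have "distr (seq_law \<sigma>) (bool_cube \<Otimes>\<^sub>M ?Q) ?g =
    distr (distr (seq_law \<sigma> \<Otimes>\<^sub>M ?Q) (seq_law \<sigma>) ?T) (bool_cube \<Otimes>\<^sub>M ?Q) ?g"
  proof -
    have mixture: "emeasure \<sigma> E = emeasure \<sigma> D * emeasure (uniform_measure \<sigma> D) E +
      emeasure \<sigma> (space \<sigma> - D) * emeasure (uniform_measure \<sigma> (space \<sigma> - D)) E"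
      if E [measurable]: "E \<in> sets \<sigma>" for E
    proof -
      \<comment> \<open>\<open>\<sigma>\<close> is the mixture of its two conditional laws, which is the hypothesis of the
        resampling lemma.\<close>
      have sum: "emeasure \<sigma> E = emeasure \<sigma> (D \<inter> E) + emeasure \<sigma> ((space \<sigma> - D) \<inter> E)"
        using sets.sets_into_space[OF E] by (subst plus_emeasure) (auto intro!: arg_cong[where f="emeasure \<sigma>"])
      have weight: "emeasure \<sigma> F * emeasure (uniform_measure \<sigma> F) E = emeasure \<sigma> (F \<inter> E)"
        if "emeasure \<sigma> F \<noteq> 0" and [measurable]: "F \<in> sets \<sigma>" for F
      proof -
        have "emeasure \<sigma> F * emeasure (uniform_measure \<sigma> F) E =
            emeasure \<sigma> (F \<inter> E) * emeasure \<sigma> F / emeasure \<sigma> F"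
          using that(2) E by (simp only: emeasure_uniform_measure ennreal_times_divide mult.commute)
        then show ?thesis
          using mult_divide_eq_ennreal[OF that(1), of "emeasure \<sigma> (F \<inter> E)"] S.emeasure_finite[of F]
          by (simp add: infinity_ennreal_def)
      qed
      show ?thesis
        by (simp only: sum weight[OF pos(1) D] weight[OF pos(2) sets.compl_sets[OF D]])
    qed
    have "distr (seq_law \<sigma> \<Otimes>\<^sub>M ?Q) (seq_law \<sigma>) ?T = seq_law \<sigma>"
      unfolding \<rho>_def by (rule seq_law_resample[OF \<sigma> \<sigma>1 \<sigma>2 _ _ D mixture]) simp_all
    then show ?thesis by (simp only:)
  qed
  also have "\<dots> = distr (seq_law \<sigma> \<Otimes>\<^sub>M ?Q) (bool_cube \<Otimes>\<^sub>M ?Q) (\<lambda>z. ?g (?T z))"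
    by (simp only: distr_distr[OF g T] comp_def)
  also have "\<dots> = distr (seq_law \<sigma> \<Otimes>\<^sub>M ?Q) (bool_cube \<Otimes>\<^sub>M ?Q) (\<lambda>(s, q). (?J s, h s q))"
  proof (rule distr_cong_AE)
    have x: "AE x in \<rho> D. \<forall>i. x i \<in> D"
      unfolding \<rho>_def using \<sigma>1 D by (rule AE_seq_law_uniform_measure)
    have y: "AE y in \<rho> (space \<sigma> - D). \<forall>i. y i \<in> space \<sigma> - D"
      unfolding \<rho>_def using \<sigma>2 by (rule AE_seq_law_uniform_measure) simp
    have s: "AE s in seq_law \<sigma>. both_infinite (?J s)"
    proof -
      have "AE s in seq_law \<sigma>. infinite {i. s i \<in> D}"
        "AE s in seq_law \<sigma>. infinite {i. s i \<in> space \<sigma> - D}"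
        using AE_seq_law_infinitely_often[OF \<sigma> D pos(1)]
          AE_seq_law_infinitely_often[OF \<sigma> sets.compl_sets[OF D] pos(2)]
        by simp_all
      then show ?thesis
      proof eventually_elim
        case (elim s)
        have "{i. s i \<in> space \<sigma> - D} \<subseteq> {i. s i \<notin> D}" by blast
        with elim show ?case
          unfolding both_infinite_def hits_def using finite_subset by blast
      qed
    qed
    have "AE z in seq_law \<sigma> \<Otimes>\<^sub>M ?Q. both_infinite (?J (fst z))"
      using S12.prob_space_axioms s by (rule AE_pair_measure_fst)
    moreover have "AE z in seq_law \<sigma> \<Otimes>\<^sub>M ?Q. \<forall>i. fst (snd z) i \<in> D"
      by (rule AE_pair_measure_snd[OF _ AE_pair_measure_fst[OF _ x]]) unfold_locales
    moreover have "AE z in seq_law \<sigma> \<Otimes>\<^sub>M ?Q. \<forall>i. snd (snd z) i \<in> space \<sigma> - D"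
      by (rule AE_pair_measure_snd[OF _ AE_pair_measure_snd[OF _ y]]) unfold_locales
    ultimately have "AE z in seq_law \<sigma> \<Otimes>\<^sub>M ?Q. both_infinite (?J (fst z)) \<and>
        (\<forall>i. fst (snd z) i \<in> D) \<and> (\<forall>i. snd (snd z) i \<notin> D)"
      by eventually_elim blast
    then show "AE z in seq_law \<sigma> \<Otimes>\<^sub>M ?Q. ?g (?T z) = (case z of (s, q) \<Rightarrow> (?J s, h s q))"
    proof eventually_elim
      case (elim z)
      obtain s x y where z: "z = (s, x, y)" by (cases z)
      have JT: "?J (\<lambda>i. if s i \<in> D then x i else y i) = ?J s"
        using elim by (auto simp: z hits_def fun_eq_iff)
      have "s (pick (?J s) k i) \<in> D \<longleftrightarrow> k" for k i
        using side_pick[of "?J s" k i] elim by (simp add: z side_def hits_def)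
      then show ?case
        by (simp add: z h_def JT)
    qed
  next
    show "(\<lambda>z. ?g (?T z)) \<in> seq_law \<sigma> \<Otimes>\<^sub>M ?Q \<rightarrow>\<^sub>M bool_cube \<Otimes>\<^sub>M ?Q"
      using T g by (rule measurable_compose)
    show "(\<lambda>(s, q). (?J s, h s q)) \<in> seq_law \<sigma> \<Otimes>\<^sub>M ?Q \<rightarrow>\<^sub>M bool_cube \<Otimes>\<^sub>M ?Q"
      using measurable_Pair[OF measurable_compose[OF measurable_fst J] h]
      by (simp add: split_beta')
  qed (rule refl)+
  also have "\<dots> = distr (seq_law \<sigma>) bool_cube ?J \<Otimes>\<^sub>M ?Q"
  proof (rule distr_pair_skew[OF _ _ _ J h])
    fix s
    have reindex: "distr (\<rho> E) (\<rho> E) (\<lambda>x i. x (pick (?J s) k i)) = \<rho> E"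
      if "prob_space (uniform_measure \<sigma> E)" for E k
      unfolding \<rho>_def using that by (rule distr_seq_law_reindex) (simp add: inj_def)
    have meas: "(\<lambda>x i. x (pick (?J s) k i)) \<in> \<rho> E \<rightarrow>\<^sub>M \<rho> E" for E k
      unfolding into_\<rho> from_\<rho> by (intro measurable_seqI measurable_seq_component)
    have "distr ?Q ?Q (h s) = distr ?Q ?Q (\<lambda>(x, y).
        (\<lambda>i. x (pick (?J s) True i), \<lambda>i. y (pick (?J s) False i)))"
      by (intro arg_cong[where f="distr ?Q ?Q"] ext) (simp add: h_def split_beta)
    also have "\<dots> = ?Q"
      using pair_measure_distr[OF meas[of True D] meas[of False "space \<sigma> - D"]]
      by (simp only: reindex[OF \<sigma>1] reindex[OF \<sigma>2] S2.sigma_finite_measure_axioms)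
    finally show "distr ?Q ?Q (h s) = ?Q" .
  qed unfold_locales
  finally show ?thesis by (simp add: h_def)
qed

definition cell :: "'a set \<Rightarrow> bool \<Rightarrow> 'a set" where
  "cell D k = {x. (x \<in> D) = k}"

text \<open>
  The splitting of an i.i.d. sequence with the two sides named by the labels, for one side and for
  both.
\<close>

lemma seq_law_side:
  fixes \<sigma> :: "'a measure"
  assumes \<sigma>: "prob_space \<sigma>" and D: "D \<in> sets \<sigma>" and space: "space \<sigma> = UNIV"
    and pos: "\<And>k. emeasure \<sigma> (cell D k) \<noteq> 0"
  defines "\<rho> \<equiv> \<lambda>k. seq_law (uniform_measure \<sigma> (cell D k))"
  shows "distr (seq_law \<sigma>) (bool_cube \<Otimes>\<^sub>M \<rho> k) (\<lambda>s. (hits D s, \<lambda>i. s (pick (hits D s) k i))) =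
    distr (seq_law \<sigma>) bool_cube (hits D) \<Otimes>\<^sub>M \<rho> k" (is ?single)
    and "distr (seq_law \<sigma>) (bool_cube \<Otimes>\<^sub>M (\<rho> True \<Otimes>\<^sub>M \<rho> False))
      (\<lambda>s. (hits D s, \<lambda>i. s (pick (hits D s) True i), \<lambda>i. s (pick (hits D s) False i))) =
    distr (seq_law \<sigma>) bool_cube (hits D) \<Otimes>\<^sub>M (\<rho> True \<Otimes>\<^sub>M \<rho> False)" (is ?both)
proof -
  have parts: "cell D True = D" "cell D False = space \<sigma> - D"
    by (auto simp: cell_def space)
  show both: ?both
    using seq_law_split[OF \<sigma> D] pos[of True] pos[of False] unfolding \<rho>_def parts by blast
  interpret S: prob_space \<sigma> by fact
  have u: "prob_space (uniform_measure \<sigma> (cell D k))" for k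
    using pos by (rule prob_space_uniform_measure) simp
  have \<rho>: "prob_space (\<rho> k)" for k
    unfolding \<rho>_def using u by (rule prob_space_seq_law)
  interpret T: prob_space "\<rho> True" by (rule \<rho>)
  interpret F: prob_space "\<rho> False" by (rule \<rho>)
  interpret TF: pair_prob_space "\<rho> True" "\<rho> False" ..
  interpret L: prob_space "seq_law \<sigma>" using \<sigma> by (rule prob_space_seq_law)
  have J: "hits D \<in> seq_law \<sigma> \<rightarrow>\<^sub>M bool_cube" using D by (rule measurable_hits)
  interpret LJ: prob_space "distr (seq_law \<sigma>) bool_cube (hits D)" using J by (rule L.prob_space_distr)
  have sets_\<rho>: "sets (\<rho> k) = sets (seq_law \<sigma>)" for k
    unfolding \<rho>_def by (intro sets_PiM_cong) simp_all
  have sel: "(\<lambda>s i. s (pick (hits D s) k i)) \<in> seq_law \<sigma> \<rightarrow>\<^sub>M \<rho> k" for k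
    unfolding measurable_cong_sets[OF refl sets_\<rho>]
    by (rule measurable_pick_seq[OF J measurable_ident_sets[OF refl]])
  have f: "(\<lambda>s. (hits D s, \<lambda>i. s (pick (hits D s) True i), \<lambda>i. s (pick (hits D s) False i)))
      \<in> seq_law \<sigma> \<rightarrow>\<^sub>M bool_cube \<Otimes>\<^sub>M (\<rho> True \<Otimes>\<^sub>M \<rho> False)"
    by (intro measurable_Pair J sel)
  define pr where "pr = (\<lambda>(x, y). if k then x else y :: nat \<Rightarrow> 'a)"
  have pr: "pr \<in> \<rho> True \<Otimes>\<^sub>M \<rho> False \<rightarrow>\<^sub>M \<rho> k"
    unfolding pr_def by (cases k) (simp_all add: split_beta')
  have pr': "(\<lambda>z. pr (snd z)) \<in> L \<Otimes>\<^sub>M (\<rho> True \<Otimes>\<^sub>M \<rho> False) \<rightarrow>\<^sub>M \<rho> k" for L :: "'b measure"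
    using measurable_snd pr by (rule measurable_compose)
  let ?L = "distr (seq_law \<sigma>) bool_cube (hits D)"
  let ?pr = "\<lambda>(j :: nat \<Rightarrow> bool, q). (j, pr q)"
  have pr3: "?pr \<in> bool_cube \<Otimes>\<^sub>M (\<rho> True \<Otimes>\<^sub>M \<rho> False) \<rightarrow>\<^sub>M bool_cube \<Otimes>\<^sub>M \<rho> k"
    using measurable_Pair[OF measurable_fst pr'] by (simp add: split_beta')
  have "distr (seq_law \<sigma>) (bool_cube \<Otimes>\<^sub>M \<rho> k) (\<lambda>s. (hits D s, \<lambda>i. s (pick (hits D s) k i))) =
    distr (distr (seq_law \<sigma>) (bool_cube \<Otimes>\<^sub>M (\<rho> True \<Otimes>\<^sub>M \<rho> False))
      (\<lambda>s. (hits D s, \<lambda>i. s (pick (hits D s) True i), \<lambda>i. s (pick (hits D s) False i))))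
      (bool_cube \<Otimes>\<^sub>M \<rho> k) ?pr"
    unfolding distr_distr[OF pr3 f] comp_def by (cases k) (simp_all add: pr_def)
  also have "\<dots> = distr (?L \<Otimes>\<^sub>M (\<rho> True \<Otimes>\<^sub>M \<rho> False)) (bool_cube \<Otimes>\<^sub>M \<rho> k) ?pr"
    by (simp only: both)
  also have "\<dots> = distr ?L bool_cube (\<lambda>j. j) \<Otimes>\<^sub>M \<rho> k"
  proof (rule distr_pair_skew[OF LJ.prob_space_axioms TF.prob_space_axioms \<rho>])
    show "(\<lambda>j. j) \<in> ?L \<rightarrow>\<^sub>M bool_cube"
      by (rule measurable_ident_sets) (rule sets_distr)
    show "(\<lambda>(s :: nat \<Rightarrow> bool, q). pr q) \<in> ?L \<Otimes>\<^sub>M (\<rho> True \<Otimes>\<^sub>M \<rho> False) \<rightarrow>\<^sub>M \<rho> k"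
      using pr' by (simp add: split_beta')
    show "distr (\<rho> True \<Otimes>\<^sub>M \<rho> False) (\<rho> k) pr = \<rho> k"
    proof (cases k)
      case True
      then have "pr = fst" by (auto simp: pr_def)
      then show ?thesis using True F.distr_pair_fst by simp
    next
      case False
      then have "pr = snd" by (auto simp: pr_def)
      then show ?thesis using False distr_pair_snd[OF \<rho> \<rho>] by simp
    qed
  qed
  also have "distr ?L bool_cube (\<lambda>j. j) = ?L"
    by (subst distr_distr[OF measurable_ident_sets[OF refl] J]) (simp add: comp_def)
  finally show ?single .
qed

section \<open>The entries of a representation given its points\<close>

abbreviation point_algebra ::
    "'w measure \<Rightarrow> ('w \<Rightarrow> enat) \<Rightarrow> (nat \<Rightarrow> 'w \<Rightarrow> 's::polish_space) \<Rightarrow> 'w measure" where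
  "point_algebra M N S \<equiv> vimage_algebra (space M) (\<lambda>\<omega>. (N \<omega>, \<lambda>i. S i \<omega>))
     (count_space UNIV \<Otimes>\<^sub>M (\<Pi>\<^sub>M i\<in>UNIV. borel))"

text \<open>
  The conditional probability that the entry for two points in the places \<open>s\<close> and \<open>t\<close> is \<open>x\<close>.
\<close>

definition edge_weight :: "('s \<times> 's \<Rightarrow> real) \<Rightarrow> bool \<Rightarrow> 's \<Rightarrow> 's \<Rightarrow> ennreal" where
  "edge_weight W x s t = ennreal (pmf (bernoulli_pmf (W (s, t))) x)"

lemma edge_weight_commute:
  "connection_function W \<Longrightarrow> edge_weight W x s t = edge_weight W x t s"
  by (simp add: edge_weight_def connection_function_def)

lemma measurable_edge_weight:
  fixes W :: "'s::polish_space \<times> 's \<Rightarrow> real"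
  assumes W: "connection_function W"
    and f: "f \<in> M \<rightarrow>\<^sub>M borel" "g \<in> M \<rightarrow>\<^sub>M borel"
  shows "(\<lambda>\<omega>. edge_weight W x (f \<omega>) (g \<omega>)) \<in> borel_measurable M"
proof -
  have [measurable]: "W \<in> borel_measurable (borel \<Otimes>\<^sub>M borel)"
    using W by (simp add: connection_function_def)
  note [measurable] = f
  have "edge_weight W x s t = ennreal (if x then W (s, t) else 1 - W (s, t))" for s t
    using W by (cases x) (simp_all add: edge_weight_def connection_function_def)
  then have "(\<lambda>\<omega>. edge_weight W x (f \<omega>) (g \<omega>)) =
      (\<lambda>\<omega>. ennreal (if x then W (f \<omega>, g \<omega>) else 1 - W (f \<omega>, g \<omega>)))"
    by simp
  then show ?thesis by simp
qed

lemma
  assumes "representation M W \<xi> N S A"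
  shows representation_count: "N \<in> M \<rightarrow>\<^sub>M count_space UNIV"
    and representation_point: "S i \<in> M \<rightarrow>\<^sub>M borel"
    and representation_entry: "(\<lambda>\<omega>. A \<omega> p) \<in> M \<rightarrow>\<^sub>M count_space UNIV"
    and representation_hollow_symmetric: "AE \<omega> in M. hollow_symmetric (A \<omega>)"
proof -
  show "N \<in> M \<rightarrow>\<^sub>M count_space UNIV" "S i \<in> M \<rightarrow>\<^sub>M borel"
    "(\<lambda>\<omega>. A \<omega> p) \<in> M \<rightarrow>\<^sub>M count_space UNIV"
    using assms unfolding representation_def by blast+
  have "AE \<omega> in M. \<forall>i. \<not> A \<omega> (i, i)" "AE \<omega> in M. \<forall>i j. A \<omega> (j, i) = A \<omega> (i, j)"
    using assms unfolding representation_def by blast+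
  then show "AE \<omega> in M. hollow_symmetric (A \<omega>)"
    unfolding hollow_symmetric_def by eventually_elim (rule conjI)
qed

lemma
  fixes S :: "nat \<Rightarrow> 'w \<Rightarrow> 's::polish_space"
  assumes N: "N \<in> M \<rightarrow>\<^sub>M count_space UNIV" and S: "\<And>i. S i \<in> M \<rightarrow>\<^sub>M borel"
  shows subalgebra_point_algebra: "subalgebra M (point_algebra M N S)"
    and point_algebra_count: "N \<in> point_algebra M N S \<rightarrow>\<^sub>M count_space UNIV"
    and point_algebra_points: "(\<lambda>\<omega> i. S i \<omega>) \<in> point_algebra M N S \<rightarrow>\<^sub>M seq_law borel"
    and measurable_point_algebra:
      "(\<lambda>\<omega>. (N \<omega>, \<lambda>i. S i \<omega>)) \<in> M \<rightarrow>\<^sub>M count_space UNIV \<Otimes>\<^sub>M seq_law borel"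
proof -
  let ?f = "\<lambda>\<omega>. (N \<omega>, \<lambda>i. S i \<omega>)"
  have seq: "(\<lambda>\<omega> i. S i \<omega>) \<in> M \<rightarrow>\<^sub>M seq_law borel"
    by (rule measurable_seqI) (rule S)
  show f: "?f \<in> M \<rightarrow>\<^sub>M count_space UNIV \<Otimes>\<^sub>M seq_law borel"
    using N seq by (rule measurable_Pair)
  show "subalgebra M (point_algebra M N S)"
    unfolding subalgebra_def using sets_image_in_sets[OF refl f] by simp
  have "?f \<in> point_algebra M N S \<rightarrow>\<^sub>M count_space UNIV \<Otimes>\<^sub>M seq_law borel"
    using measurable_space[OF f] by (intro measurable_vimage_algebra1) auto
  from measurable_compose[OF this measurable_fst] measurable_compose[OF this measurable_snd]
  show "N \<in> point_algebra M N S \<rightarrow>\<^sub>M count_space UNIV"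
    "(\<lambda>\<omega> i. S i \<omega>) \<in> point_algebra M N S \<rightarrow>\<^sub>M seq_law borel"
    by simp_all
qed

text \<open>
  The conditional law of a representation, in integrated form: events \<open>E\<close> of the conditioning
  \<open>\<sigma>\<close>-algebra replace conditional expectations.
\<close>

lemma emeasure_upper_entries:
  assumes "prob_space M" and W: "connection_function W" and rep: "representation M W \<xi> N S A"
    and I: "finite I" "I \<subseteq> {(i, j). i < j}" and E: "E \<in> sets (point_algebra M N S)"
  shows "emeasure M {\<omega>\<in>E. \<forall>p\<in>I. A \<omega> p = a p} =
    (\<integral>\<^sup>+\<omega>\<in>E. (\<Prod>(i, j)\<in>I. edge_weight W (a (i, j)) (S i \<omega>) (S j \<omega>)) \<partial>M)"
proof -
  interpret M: prob_space M by fact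
  note meas = representation_count[OF rep] representation_point[OF rep]
  let ?G = "point_algebra M N S"
  have sub: "subalgebra M ?G" using meas by (rule subalgebra_point_algebra)
  interpret G: finite_measure_subalgebra M ?G
    using sub by unfold_locales
  let ?F = "{\<omega>\<in>space M. \<forall>p\<in>I. A \<omega> p = a p}"
  have F: "?F \<in> sets M"
  proof -
    note [measurable] = representation_entry[OF rep]
    show ?thesis using I(1) by measurable
  qed
  have E_M: "E \<in> sets M" using sub E by (auto simp: subalgebra_def)
  let ?g = "\<lambda>\<omega>. \<Prod>(i, j)\<in>I. pmf (bernoulli_pmf (W (S i \<omega>, S j \<omega>))) (a (i, j))"
  have g: "ennreal (?g \<omega>) = (\<Prod>(i, j)\<in>I. edge_weight W (a (i, j)) (S i \<omega>) (S j \<omega>))" for \<omega>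
    by (simp add: edge_weight_def split_beta prod_ennreal)
  have cond: "AE \<omega> in M. real_cond_exp M ?G (indicator ?F) \<omega> = ?g \<omega>"
    using rep I unfolding representation_def by blast
  have "ennreal (M.prob (E \<inter> ?F)) = (\<integral>\<^sup>+\<omega>\<in>E. ennreal (?g \<omega>) \<partial>M)"
  proof -
    have "M.prob (E \<inter> ?F) = (\<integral>\<omega>\<in>E. indicator ?F \<omega> \<partial>M)"
      using E_M F by (simp add: set_lebesgue_integral_def indicator_inter_arith[symmetric])
    also have "\<dots> = (\<integral>\<omega>\<in>E. real_cond_exp M ?G (indicator ?F) \<omega> \<partial>M)"
      using F E by (intro G.real_cond_exp_intA integrable_real_indicator) (auto simp: M.emeasure_eq_measure)
    finally have "ennreal (M.prob (E \<inter> ?F)) =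
      ennreal (\<integral>\<omega>. indicator E \<omega> * real_cond_exp M ?G (indicator ?F) \<omega> \<partial>M)"
      by (simp add: set_lebesgue_integral_def)
    also have "\<dots> = (\<integral>\<^sup>+\<omega>. ennreal (indicator E \<omega> * real_cond_exp M ?G (indicator ?F) \<omega>) \<partial>M)"
    proof (rule nn_integral_eq_integral[symmetric])
      show "integrable M (\<lambda>\<omega>. indicator E \<omega> * real_cond_exp M ?G (indicator ?F) \<omega>)"
        using integrable_mult_indicator[OF E_M G.real_cond_exp_int(1)[of "indicator ?F"]] F
        by (simp add: integrable_real_indicator M.emeasure_eq_measure)
      show "AE \<omega> in M. 0 \<le> indicator E \<omega> * real_cond_exp M ?G (indicator ?F) \<omega>"
        using cond by eventually_elim (simp add: prod_nonneg split_beta)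
    qed
    also have "\<dots> = (\<integral>\<^sup>+\<omega>\<in>E. ennreal (?g \<omega>) \<partial>M)"
      using cond by (intro nn_integral_cong_AE, eventually_elim) (auto simp: indicator_def)
    finally show ?thesis .
  qed
  moreover have "{\<omega>\<in>E. \<forall>p\<in>I. A \<omega> p = a p} = E \<inter> ?F"
    using sets.sets_into_space[OF E_M] by blast
  ultimately show ?thesis by (simp only: g M.emeasure_eq_measure)
qed

definition distinct_pairs :: "'k set \<Rightarrow> ('k \<Rightarrow> nat) \<Rightarrow> ('k \<Rightarrow> nat) \<Rightarrow> bool" where
  "distinct_pairs K \<alpha> \<beta> \<longleftrightarrow> (\<forall>k\<in>K. \<alpha> k \<noteq> \<beta> k) \<and> inj_on (\<lambda>k. {\<alpha> k, \<beta> k}) K"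

text \<open>
  By symmetry of the matrix and of \<open>W\<close> each pair may be sorted, which leads to positions above the
  diagonal. Distinctness of the unordered pairs makes these positions distinct.
\<close>

lemma emeasure_fixed_entries:
  fixes K :: "'k set"
  assumes "prob_space M" and W: "connection_function W" and rep: "representation M W \<xi> N S A"
    and K: "finite K" "distinct_pairs K \<alpha> \<beta>" and E: "E \<in> sets (point_algebra M N S)"
  shows "emeasure M {\<omega>\<in>E. \<forall>k\<in>K. A \<omega> (\<alpha> k, \<beta> k) = x k} =
    (\<integral>\<^sup>+\<omega>\<in>E. (\<Prod>k\<in>K. edge_weight W (x k) (S (\<alpha> k) \<omega>) (S (\<beta> k) \<omega>)) \<partial>M)"
proof -
  interpret M: prob_space M by fact
  define m where "m k = (min (\<alpha> k) (\<beta> k), max (\<alpha> k) (\<beta> k))" for k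
  have m_cases: "m k = (\<alpha> k, \<beta> k) \<or> m k = (\<beta> k, \<alpha> k)" for k
    by (auto simp: m_def min_def max_def)
  have upper: "m ` K \<subseteq> {(i, j). i < j}"
    using K(2) by (auto simp: m_def distinct_pairs_def min_def max_def nat_neq_iff)
  have inj: "inj_on m K"
  proof (rule inj_onI)
    fix k l assume "k \<in> K" "l \<in> K" and eq: "m k = m l"
    moreover have "{\<alpha> k, \<beta> k} = {\<alpha> l, \<beta> l}"
      using m_cases[of k] m_cases[of l] eq by auto
    ultimately show "k = l"
      using K(2) by (auto simp: distinct_pairs_def dest: inj_onD)
  qed
  define a where "a p = x (the_inv_into K m p)" for p
  have a: "a (m k) = x k" if "k \<in> K" for k
    using the_inv_into_f_f[OF inj that] by (simp add: a_def)
  have E_M: "E \<in> sets M"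
  proof -
    have "subalgebra M (point_algebra M N S)"
      using representation_count[OF rep] representation_point[OF rep] by (rule subalgebra_point_algebra)
    then show ?thesis using E by (auto simp: subalgebra_def)
  qed
  have "emeasure M {\<omega>\<in>E. \<forall>k\<in>K. A \<omega> (\<alpha> k, \<beta> k) = x k} =
    emeasure M {\<omega>\<in>E. \<forall>p\<in>m ` K. A \<omega> p = a p}"
  proof (rule emeasure_eq_AE)
    show "AE \<omega> in M. (\<omega> \<in> {\<omega>\<in>E. \<forall>k\<in>K. A \<omega> (\<alpha> k, \<beta> k) = x k}) =
        (\<omega> \<in> {\<omega>\<in>E. \<forall>p\<in>m ` K. A \<omega> p = a p})"
      using representation_hollow_symmetric[OF rep]
    proof eventually_elim
      case (elim \<omega>)
      then have "A \<omega> (m k) = A \<omega> (\<alpha> k, \<beta> k)" for k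
        using m_cases[of k] by (auto simp: hollow_symmetric_def)
      then show ?case using a by auto
    qed
    have "{\<omega>\<in>E. \<forall>k\<in>K. A \<omega> (f k) = y k} \<in> sets M" for f :: "'k \<Rightarrow> nat \<times> nat" and y
    proof -
      note [measurable] = representation_entry[OF rep]
      have "{\<omega>\<in>space M. \<forall>k\<in>K. A \<omega> (f k) = y k} \<in> sets M" using K(1) by measurable
      moreover have "{\<omega>\<in>E. \<forall>k\<in>K. A \<omega> (f k) = y k} = E \<inter> {\<omega>\<in>space M. \<forall>k\<in>K. A \<omega> (f k) = y k}"
        using sets.sets_into_space[OF E_M] by blast
      ultimately show ?thesis using E_M by simp
    qed
    from this[of "\<lambda>k. (\<alpha> k, \<beta> k)" x] this[of m "\<lambda>k. a (m k)"]
    show "{\<omega>\<in>E. \<forall>k\<in>K. A \<omega> (\<alpha> k, \<beta> k) = x k} \<in> sets M"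
      "{\<omega>\<in>E. \<forall>p\<in>m ` K. A \<omega> p = a p} \<in> sets M"
      by simp_all
  qed
  also have "\<dots> = (\<integral>\<^sup>+\<omega>\<in>E. (\<Prod>(i, j)\<in>m ` K. edge_weight W (a (i, j)) (S i \<omega>) (S j \<omega>)) \<partial>M)"
    using assms(1) W rep finite_imageI[OF K(1)] upper E by (rule emeasure_upper_entries)
  also have "\<dots> = (\<integral>\<^sup>+\<omega>\<in>E. (\<Prod>k\<in>K. edge_weight W (x k) (S (\<alpha> k) \<omega>) (S (\<beta> k) \<omega>)) \<partial>M)"
  proof -
    have "(\<Prod>(i, j)\<in>m ` K. edge_weight W (a (i, j)) (S i \<omega>) (S j \<omega>)) =
        (\<Prod>k\<in>K. edge_weight W (x k) (S (\<alpha> k) \<omega>) (S (\<beta> k) \<omega>))" for \<omega>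
      unfolding prod.reindex[OF inj] comp_def
    proof (rule prod.cong[OF refl])
      fix k assume k: "k \<in> K"
      show "(case m k of (i, j) \<Rightarrow> edge_weight W (a (i, j)) (S i \<omega>) (S j \<omega>)) =
          edge_weight W (x k) (S (\<alpha> k) \<omega>) (S (\<beta> k) \<omega>)"
        using m_cases[of k] a[OF k] edge_weight_commute[OF W] by auto
    qed
    then show ?thesis by simp
  qed
  finally show ?thesis .
qed

text \<open>
  The positions may depend on the count and the points, since these are held fixed: cut \<open>E\<close> into the
  countably many events on which the positions are constant.
\<close>

lemma emeasure_random_entries:
  fixes K :: "'k set"
  assumes prob: "prob_space M" and W: "connection_function W" and rep: "representation M W \<xi> N S A"
    and K: "finite K" and distinct: "\<And>\<omega>. \<omega> \<in> space M \<Longrightarrow> distinct_pairs K (\<lambda>k. \<alpha> k \<omega>) (\<lambda>k. \<beta> k \<omega>)"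
    and \<alpha>: "\<And>k. k \<in> K \<Longrightarrow> \<alpha> k \<in> point_algebra M N S \<rightarrow>\<^sub>M count_space UNIV"
    and \<beta>: "\<And>k. k \<in> K \<Longrightarrow> \<beta> k \<in> point_algebra M N S \<rightarrow>\<^sub>M count_space UNIV"
    and E: "E \<in> sets (point_algebra M N S)"
  shows "emeasure M {\<omega>\<in>E. \<forall>k\<in>K. A \<omega> (\<alpha> k \<omega>, \<beta> k \<omega>) = x k} =
    (\<integral>\<^sup>+\<omega>\<in>E. (\<Prod>k\<in>K. edge_weight W (x k) (S (\<alpha> k \<omega>) \<omega>) (S (\<beta> k \<omega>) \<omega>)) \<partial>M)"
proof -
  interpret M: prob_space M by fact
  let ?G = "point_algebra M N S"
  have sub: "subalgebra M ?G"
    using representation_count[OF rep] representation_point[OF rep] by (rule subalgebra_point_algebra)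
  define V where "V = (\<Pi>\<^sub>E k\<in>K. UNIV :: (nat \<times> nat) set)"
  define Ev where "Ev v = {\<omega>\<in>E. \<forall>k\<in>K. (\<alpha> k \<omega>, \<beta> k \<omega>) = v k}" for v
  define F where "F = {\<omega>\<in>E. \<forall>k\<in>K. A \<omega> (\<alpha> k \<omega>, \<beta> k \<omega>) = x k}"
  define g where "g \<omega> = (\<Prod>k\<in>K. edge_weight W (x k) (S (\<alpha> k \<omega>) \<omega>) (S (\<beta> k \<omega>) \<omega>))" for \<omega>
  have V: "countable V" unfolding V_def using K by (intro countable_PiE) auto
  have space: "E \<subseteq> space M" using sets.sets_into_space[OF E] by simp
  have Ev_G: "Ev v \<in> sets ?G" for v
  proof -
    note [measurable] = \<alpha> \<beta>
    have "{\<omega>\<in>space ?G. \<forall>k\<in>K. \<alpha> k \<omega> = fst (v k) \<and> \<beta> k \<omega> = snd (v k)} \<in> sets ?G"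
      using K by measurable
    moreover have "Ev v = E \<inter> {\<omega>\<in>space ?G. \<forall>k\<in>K. \<alpha> k \<omega> = fst (v k) \<and> \<beta> k \<omega> = snd (v k)}"
      using space by (auto simp: Ev_def prod_eq_iff)
    ultimately show ?thesis using E by simp
  qed
  then have Ev_M: "Ev v \<in> sets M" for v using sub by (auto simp: subalgebra_def)
  \<comment> \<open>The event \<open>Ev v\<close> fixes all the positions to \<open>v\<close>.\<close>
  have disj: "disjoint_family_on Ev V"
    unfolding disjoint_family_on_def
  proof (intro ballI impI)
    fix v w assume "v \<in> V" "w \<in> V" "v \<noteq> w"
    then obtain k where "k \<in> K" "v k \<noteq> w k"
      using PiE_ext[of v K _ w] unfolding V_def by blast
    then show "Ev v \<inter> Ev w = {}" by (auto simp: Ev_def)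
  qed
  have union: "E = (\<Union>v\<in>V. Ev v)"
  proof
    show "E \<subseteq> (\<Union>v\<in>V. Ev v)"
    proof
      fix \<omega> assume "\<omega> \<in> E"
      then have "restrict (\<lambda>k. (\<alpha> k \<omega>, \<beta> k \<omega>)) K \<in> V" "\<omega> \<in> Ev (restrict (\<lambda>k. (\<alpha> k \<omega>, \<beta> k \<omega>)) K)"
        by (auto simp: V_def Ev_def)
      then show "\<omega> \<in> (\<Union>v\<in>V. Ev v)" by blast
    qed
  qed (auto simp: Ev_def)
  have [measurable]: "g \<in> borel_measurable M"
    unfolding g_def
  proof (intro borel_measurable_prod_ennreal measurable_edge_weight W)
    fix k assume k: "k \<in> K"
    show "(\<lambda>\<omega>. S (\<alpha> k \<omega>) \<omega>) \<in> M \<rightarrow>\<^sub>M borel"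
      by (rule measurable_compose_countable[OF representation_point[OF rep] measurable_from_subalg[OF sub \<alpha>[OF k]]])
    show "(\<lambda>\<omega>. S (\<beta> k \<omega>) \<omega>) \<in> M \<rightarrow>\<^sub>M borel"
      by (rule measurable_compose_countable[OF representation_point[OF rep] measurable_from_subalg[OF sub \<beta>[OF k]]])
  qed
  have F_v: "F \<inter> Ev v = {\<omega>\<in>Ev v. \<forall>k\<in>K. A \<omega> (fst (v k), snd (v k)) = x k}" for v
    by (auto simp: F_def Ev_def prod_eq_iff)
  have F_v_sets: "F \<inter> Ev v \<in> sets M" for v
  proof -
    note [measurable] = representation_entry[OF rep]
    have "{\<omega>\<in>space M. \<forall>k\<in>K. A \<omega> (fst (v k), snd (v k)) = x k} \<in> sets M" using K by measurable
    moreover have "F \<inter> Ev v = Ev v \<inter> {\<omega>\<in>space M. \<forall>k\<in>K. A \<omega> (fst (v k), snd (v k)) = x k}"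
      using space unfolding F_v by (auto simp: Ev_def)
    ultimately show ?thesis using Ev_M by simp
  qed
  have "F = (\<Union>v\<in>V. F \<inter> Ev v)" using union by (auto simp: F_def)
  then have "emeasure M F = emeasure M (\<Union>v\<in>V. F \<inter> Ev v)" by simp
  also have "\<dots> = (\<integral>\<^sup>+v. emeasure M (F \<inter> Ev v) \<partial>count_space V)"
    using disj by (intro emeasure_UN_countable F_v_sets V) (auto simp: disjoint_family_on_def)
  also have "\<dots> = (\<integral>\<^sup>+v. emeasure (density M g) (Ev v) \<partial>count_space V)"
  proof (rule nn_integral_cong)
    fix v
    show "emeasure M (F \<inter> Ev v) = emeasure (density M g) (Ev v)"
    proof (cases "Ev v = {}")
      case False
      then obtain \<omega> where \<omega>: "\<omega> \<in> Ev v" by blast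
      then have "distinct_pairs K (\<lambda>k. fst (v k)) (\<lambda>k. snd (v k))"
        using distinct[of \<omega>] space unfolding distinct_pairs_def Ev_def inj_on_def
        by (auto simp: prod_eq_iff)
      from emeasure_fixed_entries[OF prob W rep K this Ev_G]
      have "emeasure M (F \<inter> Ev v) =
          (\<integral>\<^sup>+\<omega>\<in>Ev v. (\<Prod>k\<in>K. edge_weight W (x k) (S (fst (v k)) \<omega>) (S (snd (v k)) \<omega>)) \<partial>M)"
        by (simp only: F_v)
      also have "\<dots> = (\<integral>\<^sup>+\<omega>\<in>Ev v. g \<omega> \<partial>M)"
      proof (rule nn_integral_cong)
        fix \<omega>
        have "(\<Prod>k\<in>K. edge_weight W (x k) (S (fst (v k)) \<omega>) (S (snd (v k)) \<omega>)) = g \<omega>"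
          if "\<omega> \<in> Ev v"
          unfolding g_def using that by (intro prod.cong refl) (auto simp: Ev_def prod_eq_iff)
        then show "(\<Prod>k\<in>K. edge_weight W (x k) (S (fst (v k)) \<omega>) (S (snd (v k)) \<omega>)) *
            indicator (Ev v) \<omega> = g \<omega> * indicator (Ev v) \<omega>"
          by (auto simp: indicator_def)
      qed
      also have "\<dots> = emeasure (density M g) (Ev v)"
        using Ev_M by (simp add: emeasure_density)
      finally show ?thesis .
    qed simp
  qed
  also have "\<dots> = emeasure (density M g) (\<Union>v\<in>V. Ev v)"
    using disj V Ev_M by (intro emeasure_UN_countable[symmetric]) auto
  also have "\<dots> = (\<integral>\<^sup>+\<omega>\<in>E. g \<omega> \<partial>M)"
    using E sub unfolding union[symmetric] by (intro emeasure_density) (auto simp: subalgebra_def)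
  finally show ?thesis by (simp only: F_def g_def)
qed

section \<open>The matrix of an i.i.d. representation\<close>

lemma nn_integral_distr_cod:
  assumes "T \<in> M \<rightarrow>\<^sub>M M'" "f \<in> borel_measurable M'"
  shows "(\<integral>\<^sup>+x. f x \<partial>distr M M' T) = (\<integral>\<^sup>+x. f (T x) \<partial>M)"
  using assms by (simp add: nn_integral_distr)

lemma (in prob_space) indep_set_vimage_iff_distr_eq:
  assumes X: "X \<in> M \<rightarrow>\<^sub>M S" and Y: "Y \<in> M \<rightarrow>\<^sub>M T"
  shows "indep_set (sets (vimage_algebra (space M) X S)) (sets (vimage_algebra (space M) Y T)) \<longleftrightarrow>
    distr M (S \<Otimes>\<^sub>M T) (\<lambda>\<omega>. (X \<omega>, Y \<omega>)) = distr M S X \<Otimes>\<^sub>M distr M T Y"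
proof -
  interpret DX: prob_space "distr M S X" using X by (rule prob_space_distr)
  interpret DY: prob_space "distr M T Y" using Y by (rule prob_space_distr)
  have XY: "(\<lambda>\<omega>. (X \<omega>, Y \<omega>)) \<in> M \<rightarrow>\<^sub>M S \<Otimes>\<^sub>M T" using X Y by (rule measurable_Pair)
  have sets_X: "sets (vimage_algebra (space M) X S) = {X -` A \<inter> space M | A. A \<in> sets S}"
    using measurable_space[OF X] by (intro sets_vimage_algebra2) auto
  have sets_Y: "sets (vimage_algebra (space M) Y T) = {Y -` A \<inter> space M | A. A \<in> sets T}"
    using measurable_space[OF Y] by (intro sets_vimage_algebra2) auto
  have "indep_set (sets (vimage_algebra (space M) X S)) (sets (vimage_algebra (space M) Y T)) \<longleftrightarrow>
    (\<forall>A\<in>sets S. \<forall>B\<in>sets T. prob ((X -` A \<inter> space M) \<inter> (Y -` B \<inter> space M)) =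
      prob (X -` A \<inter> space M) * prob (Y -` B \<inter> space M))"
    unfolding indep_sets2_eq sets_X sets_Y using measurable_sets[OF X] measurable_sets[OF Y] by blast
  also have "\<dots> \<longleftrightarrow> (\<forall>A\<in>sets S. \<forall>B\<in>sets T.
      emeasure (distr M (S \<Otimes>\<^sub>M T) (\<lambda>\<omega>. (X \<omega>, Y \<omega>))) (A \<times> B) =
      emeasure (distr M S X) A * emeasure (distr M T Y) B)"
  proof (intro ball_cong refl)
    fix A B assume A: "A \<in> sets S" and B: "B \<in> sets T"
    have "(\<lambda>\<omega>. (X \<omega>, Y \<omega>)) -` (A \<times> B) \<inter> space M = (X -` A \<inter> space M) \<inter> (Y -` B \<inter> space M)"
      by auto
    then show "prob ((X -` A \<inter> space M) \<inter> (Y -` B \<inter> space M)) =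
        prob (X -` A \<inter> space M) * prob (Y -` B \<inter> space M) \<longleftrightarrow>
      emeasure (distr M (S \<Otimes>\<^sub>M T) (\<lambda>\<omega>. (X \<omega>, Y \<omega>))) (A \<times> B) =
        emeasure (distr M S X) A * emeasure (distr M T Y) B"
      using A B X Y XY
      by (simp add: emeasure_distr emeasure_eq_measure ennreal_mult[symmetric] measure_nonneg)
  qed
  also have "\<dots> \<longleftrightarrow> distr M (S \<Otimes>\<^sub>M T) (\<lambda>\<omega>. (X \<omega>, Y \<omega>)) = distr M S X \<Otimes>\<^sub>M distr M T Y"
  proof
    assume rect: "\<forall>A\<in>sets S. \<forall>B\<in>sets T.
      emeasure (distr M (S \<Otimes>\<^sub>M T) (\<lambda>\<omega>. (X \<omega>, Y \<omega>))) (A \<times> B) =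
      emeasure (distr M S X) A * emeasure (distr M T Y) B"
    have "distr M S X \<Otimes>\<^sub>M distr M T Y = distr M (S \<Otimes>\<^sub>M T) (\<lambda>\<omega>. (X \<omega>, Y \<omega>))"
    proof (rule pair_measure_eqI)
      show "sigma_finite_measure (distr M S X)" "sigma_finite_measure (distr M T Y)"
        by unfold_locales
      show "sets (distr M S X \<Otimes>\<^sub>M distr M T Y) = sets (distr M (S \<Otimes>\<^sub>M T) (\<lambda>\<omega>. (X \<omega>, Y \<omega>)))"
        by (simp cong: sets_pair_measure_cong)
    qed (use rect in simp)
    then show "distr M (S \<Otimes>\<^sub>M T) (\<lambda>\<omega>. (X \<omega>, Y \<omega>)) = distr M S X \<Otimes>\<^sub>M distr M T Y" ..
  next
    assume "distr M (S \<Otimes>\<^sub>M T) (\<lambda>\<omega>. (X \<omega>, Y \<omega>)) = distr M S X \<Otimes>\<^sub>M distr M T Y"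
    then show "\<forall>A\<in>sets S. \<forall>B\<in>sets T.
      emeasure (distr M (S \<Otimes>\<^sub>M T) (\<lambda>\<omega>. (X \<omega>, Y \<omega>))) (A \<times> B) =
      emeasure (distr M S X) A * emeasure (distr M T Y) B"
      by (simp add: DY.emeasure_pair_measure_Times)
  qed
  finally show ?thesis .
qed

lemma iid_representation_law:
  assumes "prob_space M" and iid: "iid_representation M \<xi> N S A"
  defines "\<sigma> \<equiv> distr M borel (S 0)"
  shows "distr M (count_space UNIV \<Otimes>\<^sub>M seq_law borel) (\<lambda>\<omega>. (N \<omega>, \<lambda>i. S i \<omega>)) =
    distr M (count_space UNIV) N \<Otimes>\<^sub>M seq_law \<sigma>"
    and "distr M (seq_law borel) (\<lambda>\<omega> i. S i \<omega>) = seq_law \<sigma>"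
proof -
  interpret M: prob_space M by fact
  obtain W where rep: "representation M W \<xi> N S A"
    using iid unfolding iid_representation_def by blast
  note N = representation_count[OF rep] and S = representation_point[OF rep]
  have seq: "(\<lambda>\<omega> i. S i \<omega>) \<in> M \<rightarrow>\<^sub>M seq_law borel"
    by (rule measurable_seqI) (rule S)
  have "M.indep_vars (\<lambda>_. borel) S UNIV"
    using iid unfolding iid_representation_def by blast
  then have "distr M (seq_law borel) (\<lambda>\<omega>. \<lambda>i\<in>UNIV. S i \<omega>) = (\<Pi>\<^sub>M i\<in>UNIV. distr M borel (S i))"
    using M.indep_vars_iff_distr_eq_PiM'[where I=UNIV and M'="\<lambda>_. borel" and X=S] S by blast
  moreover have "distr M borel (S i) = \<sigma>" for i
    using iid unfolding iid_representation_def \<sigma>_def by blast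
  ultimately show law: "distr M (seq_law borel) (\<lambda>\<omega> i. S i \<omega>) = seq_law \<sigma>"
    by (simp add: restrict_UNIV)
  have "M.indep_set (sets (vimage_algebra (space M) N (count_space UNIV)))
      (sets (vimage_algebra (space M) (\<lambda>\<omega> i. S i \<omega>) (seq_law borel)))"
    using iid unfolding iid_representation_def by blast
  then show "distr M (count_space UNIV \<Otimes>\<^sub>M seq_law borel) (\<lambda>\<omega>. (N \<omega>, \<lambda>i. S i \<omega>)) =
    distr M (count_space UNIV) N \<Otimes>\<^sub>M seq_law \<sigma>"
    unfolding M.indep_set_vimage_iff_distr_eq[OF N seq] law .
qed

lemma nn_integral_count_points:
  assumes prob: "prob_space M" and iid: "iid_representation M \<xi> N S A"
    and G: "G \<in> borel_measurable (seq_law borel)"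
  shows "(\<integral>\<^sup>+\<omega>\<in>{\<omega>\<in>space M. N \<omega> \<in> T}. G (\<lambda>i. S i \<omega>) \<partial>M) =
    emeasure M {\<omega>\<in>space M. N \<omega> \<in> T} * (\<integral>\<^sup>+s. G s \<partial>seq_law (distr M borel (S 0)))"
proof -
  interpret M: prob_space M by fact
  obtain W where rep: "representation M W \<xi> N S A"
    using iid unfolding iid_representation_def by blast
  let ?\<sigma> = "distr M borel (S 0)"
  note N = representation_count[OF rep] and S = representation_point[OF rep]
  have \<sigma>: "prob_space ?\<sigma>" using S by (rule M.prob_space_distr)
  interpret P: prob_space "seq_law ?\<sigma>" using \<sigma> by (rule prob_space_seq_law)
  have sets_\<sigma>: "sets (seq_law ?\<sigma>) = sets (seq_law borel)"
    by (intro sets_PiM_cong) simp_all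
  have G': "G \<in> borel_measurable (seq_law ?\<sigma>)"
    using G measurable_cong_sets[OF sets_\<sigma> refl] by blast
  have f: "(\<lambda>\<omega>. (N \<omega>, \<lambda>i. S i \<omega>)) \<in> M \<rightarrow>\<^sub>M count_space UNIV \<Otimes>\<^sub>M seq_law borel"
    by (rule measurable_point_algebra[OF N S])
  have "(\<integral>\<^sup>+\<omega>\<in>{\<omega>\<in>space M. N \<omega> \<in> T}. G (\<lambda>i. S i \<omega>) \<partial>M) =
    (\<integral>\<^sup>+\<omega>. (\<lambda>(n, s). indicator T n * G s) (N \<omega>, \<lambda>i. S i \<omega>) \<partial>M)"
    by (intro nn_integral_cong) (auto simp: indicator_def)
  also have "\<dots> = (\<integral>\<^sup>+z. (\<lambda>(n, s). indicator T n * G s) z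
      \<partial>distr M (count_space UNIV \<Otimes>\<^sub>M seq_law borel) (\<lambda>\<omega>. (N \<omega>, \<lambda>i. S i \<omega>)))"
  proof -
    note [measurable] = G
    have [measurable]: "indicator T \<in> borel_measurable (count_space (UNIV :: enat set))" by simp
    have "(\<lambda>(n, s). indicator T n * G s) \<in> borel_measurable (count_space UNIV \<Otimes>\<^sub>M seq_law borel)"
      by measurable
    from nn_integral_distr_cod[OF f this] show ?thesis by (simp only:)
  qed
  also have "\<dots> = (\<integral>\<^sup>+z. (\<lambda>(n, s). indicator T n * G s) z \<partial>(distr M (count_space UNIV) N \<Otimes>\<^sub>M seq_law ?\<sigma>))"
    by (simp only: iid_representation_law(1)[OF prob iid])
  also have "\<dots> = (\<integral>\<^sup>+n. \<integral>\<^sup>+s. indicator T n * G s \<partial>seq_law ?\<sigma> \<partial>distr M (count_space UNIV) N)"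
  proof -
    note [measurable] = G'
    have [measurable]: "indicator T \<in> borel_measurable (distr M (count_space (UNIV :: enat set)) N)" by simp
    have "(\<lambda>(n, s). indicator T n * G s) \<in> borel_measurable (distr M (count_space UNIV) N \<Otimes>\<^sub>M seq_law ?\<sigma>)"
      by measurable
    from P.nn_integral_fst[OF this] show ?thesis by simp
  qed
  also have "\<dots> = (\<integral>\<^sup>+n. indicator T n * (\<integral>\<^sup>+s. G s \<partial>seq_law ?\<sigma>) \<partial>distr M (count_space UNIV) N)"
    using G' by (simp add: nn_integral_cmult)
  also have "\<dots> = emeasure (distr M (count_space UNIV) N) T * (\<integral>\<^sup>+s. G s \<partial>seq_law ?\<sigma>)"
    by (simp add: nn_integral_multc)
  also have "emeasure (distr M (count_space UNIV) N) T = emeasure M {\<omega>\<in>space M. N \<omega> \<in> T}"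
    using N by (simp add: emeasure_distr vimage_def Int_def conj_commute)
  finally show ?thesis .
qed

lemma measurable_edge_weight_prod:
  fixes W :: "'s::polish_space \<times> 's \<Rightarrow> real"
  assumes "connection_function W"
  shows "(\<lambda>s. \<Prod>k\<in>K. edge_weight W (x k) (s (\<alpha> k)) (s (\<beta> k))) \<in> borel_measurable (seq_law borel)"
  by (intro borel_measurable_prod_ennreal measurable_edge_weight[OF assms] measurable_seq_component)

lemma emeasure_iid_entries:
  fixes K :: "'k set"
  assumes prob: "prob_space M" and iid: "iid_representation M \<xi> N S A"
    and W: "connection_function W" and rep: "representation M W \<xi> N S A"
    and K: "finite K" "distinct_pairs K \<alpha> \<beta>"
  shows "emeasure M {\<omega>\<in>space M. N \<omega> \<in> T \<and> (\<forall>k\<in>K. A \<omega> (\<alpha> k, \<beta> k) = x k)} =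
    emeasure M {\<omega>\<in>space M. N \<omega> \<in> T} *
    (\<integral>\<^sup>+s. (\<Prod>k\<in>K. edge_weight W (x k) (s (\<alpha> k)) (s (\<beta> k))) \<partial>seq_law (distr M borel (S 0)))"
proof -
  note meas = representation_count[OF rep] representation_point[OF rep]
  have "{\<omega>\<in>space M. N \<omega> \<in> T} \<in> sets (point_algebra M N S)"
    using measurable_sets[OF point_algebra_count[OF meas], of T]
    by (simp add: vimage_def Int_def conj_commute)
  from emeasure_fixed_entries[OF prob W rep K this, of x]
  show ?thesis
    using nn_integral_count_points[OF prob iid
      measurable_edge_weight_prod[OF W, where K=K and x=x and \<alpha>=\<alpha> and \<beta>=\<beta>], of T]
    by (simp add: conj_assoc)
qed

lemma distinct_pairs_upper:
  fixes I :: "(nat \<times> nat) set"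
  assumes I: "I \<subseteq> {(i, j). i < j}" and f: "inj f"
  shows "distinct_pairs I (\<lambda>p. f (fst p)) (\<lambda>p. f (snd p))"
proof -
  have less: "fst p < snd p" if "p \<in> I" for p using I that by auto
  have eq: "f i = f j \<longleftrightarrow> i = j" for i j using f by (rule inj_eq)
  show ?thesis
    unfolding distinct_pairs_def inj_on_def
  proof (intro conjI ballI impI)
    fix p assume "p \<in> I"
    from less[OF this] show "f (fst p) \<noteq> f (snd p)" by (simp add: eq)
  next
    fix p q assume "p \<in> I" "q \<in> I" "{f (fst p), f (snd p)} = {f (fst q), f (snd q)}"
    then show "p = q"
      using less[of p] less[of q] by (auto simp: doubleton_eq_iff eq prod_eq_iff)
  qed
qed

lemma measurable_representation_matrix:
  assumes "representation M W \<xi> N S A"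
  shows "A \<in> M \<rightarrow>\<^sub>M matrix_space"
  by (rule measurable_bool_cubeI) (rule representation_entry[OF assms])

text \<open>
  Given the points, the law of the matrix does not involve the count, which is independent of the
  points.
\<close>

lemma iid_conditional_law:
  assumes prob: "prob_space M" and iid: "iid_representation M \<xi> N S A"
    and pos: "emeasure M {\<omega>\<in>space M. N \<omega> = enat n} \<noteq> 0"
  shows "distr (uniform_measure M {\<omega>\<in>space M. N \<omega> = enat n}) matrix_space A = distr M matrix_space A"
proof -
  interpret M: prob_space M by fact
  obtain W where W: "connection_function W" and rep: "representation M W \<xi> N S A"
    using iid unfolding iid_representation_def by blast
  let ?E = "{\<omega>\<in>space M. N \<omega> = enat n}"
  let ?U = "uniform_measure M ?E"
  note A = measurable_representation_matrix[OF rep]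
  have E: "?E \<in> sets M"
  proof -
    note [measurable] = representation_count[OF rep]
    show ?thesis by measurable
  qed
  have U: "prob_space ?U"
    using pos by (rule prob_space_uniform_measure) simp
  show ?thesis
  proof (rule hollow_symmetric_law_eqI)
    show "A \<in> ?U \<rightarrow>\<^sub>M matrix_space"
      using A measurable_cong_sets[of ?U M matrix_space matrix_space] by simp
    show "finite_measure ?U" using U by (rule prob_space.finite_measure)
    show "AE \<omega> in ?U. hollow_symmetric (A \<omega>)"
      using representation_hollow_symmetric[OF rep] E
      by (intro AE_uniform_measureI) auto
    fix I :: "(nat \<times> nat) set" and x assume I: "finite I" "I \<subseteq> {(i, j). i < j}"
    have distinct: "distinct_pairs I fst snd"
      using distinct_pairs_upper[OF I(2) inj_on_id] by simp
    note entries = emeasure_iid_entries[OF prob iid W rep I(1) distinct, of _ x]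
    have cyl: "{\<omega>\<in>space M. \<forall>p\<in>I. A \<omega> p = x p} \<in> sets M"
      using measurable_sets[OF A measurable_cylinder[OF I(1), of x]]
      by (simp add: vimage_def Int_def conj_commute)
    let ?c = "\<integral>\<^sup>+s. (\<Prod>k\<in>I. edge_weight W (x k) (s (fst k)) (s (snd k))) \<partial>seq_law (distr M borel (S 0))"
    have "emeasure ?U {\<omega>\<in>space ?U. \<forall>p\<in>I. A \<omega> p = x p} =
        emeasure M (?E \<inter> {\<omega>\<in>space M. \<forall>p\<in>I. A \<omega> p = x p}) / emeasure M ?E"
      using E cyl by simp
    also have "?E \<inter> {\<omega>\<in>space M. \<forall>p\<in>I. A \<omega> p = x p} =
        {\<omega>\<in>space M. N \<omega> \<in> {enat n} \<and> (\<forall>k\<in>I. A \<omega> (fst k, snd k) = x k)}"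
      by auto
    also have "emeasure M \<dots> = ?c * emeasure M ?E"
      unfolding entries by (simp add: mult.commute)
    also have "?c * emeasure M ?E / emeasure M ?E = ?c"
      using pos M.emeasure_finite[of ?E] by (intro mult_divide_eq_ennreal) (auto simp: infinity_ennreal_def)
    also have "?c = emeasure M {\<omega>\<in>space M. \<forall>p\<in>I. A \<omega> p = x p}"
      using entries[of UNIV] M.emeasure_space_1 by simp
    finally show "emeasure ?U {\<omega>\<in>space ?U. \<forall>p\<in>I. A \<omega> p = x p} =
        emeasure M {\<omega>\<in>space M. \<forall>p\<in>I. A \<omega> p = x p}" .
  qed (fact A representation_hollow_symmetric[OF rep])+
qed

text \<open>
  A pattern has as probability an integral of edge weights over the i.i.d. points, and an i.i.d.
  sequence may be reordered.
\<close>

lemma jointly_exchangeable_iid: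
  assumes prob: "prob_space M" and iid: "iid_representation M \<xi> N S A"
  shows "jointly_exchangeable_law (distr M matrix_space A)"
  unfolding jointly_exchangeable_law_def
proof (intro allI impI)
  fix \<pi> assume "finite_permutation \<pi>"
  then have inj: "inj \<pi>" by (simp add: finite_permutation_def bij_is_inj)
  interpret M: prob_space M by fact
  obtain W where W: "connection_function W" and rep: "representation M W \<xi> N S A"
    using iid unfolding iid_representation_def by blast
  note A = measurable_representation_matrix[OF rep]
  let ?\<sigma> = "distr M borel (S 0)"
  have \<sigma>: "prob_space ?\<sigma>" using representation_point[OF rep] by (rule M.prob_space_distr)
  have sets_\<sigma>: "sets (seq_law ?\<sigma>) = sets (seq_law borel)"
    by (intro sets_PiM_cong) simp_all
  define permute where "permute = (\<lambda>X (i, j). X (\<pi> i, \<pi> j) :: bool)"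
  have permute: "permute \<in> matrix_space \<rightarrow>\<^sub>M matrix_space"
    unfolding permute_def by (rule measurable_reindex_matrix)
  have "distr M matrix_space (\<lambda>\<omega>. permute (A \<omega>)) = distr M matrix_space A"
  proof (rule hollow_symmetric_law_eqI)
    show "(\<lambda>\<omega>. permute (A \<omega>)) \<in> M \<rightarrow>\<^sub>M matrix_space"
      using A permute by (rule measurable_compose)
    show "AE \<omega> in M. hollow_symmetric (permute (A \<omega>))"
      using representation_hollow_symmetric[OF rep]
      by eventually_elim (simp add: hollow_symmetric_def permute_def)
    fix I :: "(nat \<times> nat) set" and x assume I: "finite I" "I \<subseteq> {(i, j). i < j}"
    let ?c = "\<lambda>f. \<integral>\<^sup>+s. (\<Prod>k\<in>I. edge_weight W (x k) (s (f (fst k))) (s (f (snd k)))) \<partial>seq_law ?\<sigma>"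
    have entries: "emeasure M {\<omega>\<in>space M. \<forall>k\<in>I. A \<omega> (f (fst k), f (snd k)) = x k} = ?c f"
      if "inj f" for f
      using emeasure_iid_entries[OF prob iid W rep I(1) distinct_pairs_upper[OF I(2) that], of UNIV x] M.emeasure_space_1
      by simp
    have "?c (\<lambda>i. i) = (\<integral>\<^sup>+s. (\<Prod>k\<in>I. edge_weight W (x k) (s (fst k)) (s (snd k)))
        \<partial>distr (seq_law ?\<sigma>) (seq_law ?\<sigma>) (\<lambda>s i. s (\<pi> i)))"
      by (simp only: distr_seq_law_reindex[OF \<sigma> inj])
    also have "\<dots> = ?c \<pi>"
    proof -
      have reindex: "(\<lambda>s i. s (\<pi> i)) \<in> seq_law ?\<sigma> \<rightarrow>\<^sub>M seq_law ?\<sigma>"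
        by (intro measurable_seqI measurable_seq_component)
      have "(\<lambda>s. \<Prod>k\<in>I. edge_weight W (x k) (s (fst k)) (s (snd k))) \<in> borel_measurable (seq_law ?\<sigma>)"
        using measurable_edge_weight_prod[OF W] measurable_cong_sets[OF sets_\<sigma> refl] by blast
      from nn_integral_distr_cod[OF reindex this] show ?thesis by (simp only:)
    qed
    finally show "emeasure M {\<omega>\<in>space M. \<forall>p\<in>I. permute (A \<omega>) p = x p} =
        emeasure M {\<omega>\<in>space M. \<forall>p\<in>I. A \<omega> p = x p}"
      using entries[OF inj] entries[of "\<lambda>i. i"] by (simp add: permute_def split_beta)
  qed (fact A M.finite_measure_axioms representation_hollow_symmetric[OF rep])+
  then show "distr (distr M matrix_space A) matrix_space (\<lambda>X (i, j). X (\<pi> i, \<pi> j)) = distr M matrix_space A"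
    using distr_distr[OF permute A] by (simp add: permute_def comp_def)
qed

section \<open>Uniqueness of the law of the matrix\<close>

text \<open>
  The right-hand side of the representation of a process, for one realisation of count, points and
  matrix.
\<close>

definition edge_sum :: "enat \<Rightarrow> (nat \<Rightarrow> 's::polish_space) \<Rightarrow> (nat \<times> nat \<Rightarrow> bool) \<Rightarrow> ('s \<times> 's \<times> bool) measure" where
  "edge_sum N s a = distr (count_space {(i, j). enat i < N \<and> enat j < N}) adj_space
     (\<lambda>(i, j). (s i, s j, a (i, j)))"

lemma singleton_adj_space: "{z} \<in> sets (adj_space :: ('s::polish_space \<times> 's \<times> bool) measure)"
proof -
  obtain x y b where z: "z = (x, y, b)" by (cases z)
  have "{x} \<times> {y} \<times> {b} \<in> sets (adj_space :: ('s \<times> 's \<times> bool) measure)"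
    by (intro pair_measureI) auto
  then show ?thesis by (simp add: z)
qed

lemma emeasure_edge_sum:
  assumes "D \<in> sets adj_space"
  shows "emeasure (edge_sum N s a) D =
    emeasure (count_space UNIV) {(i, j). enat i < N \<and> enat j < N \<and> (s i, s j, a (i, j)) \<in> D}"
proof -
  let ?I = "{(i, j). enat i < N \<and> enat j < N}"
  let ?f = "\<lambda>(i, j). (s i, s j, a (i, j))"
  have "emeasure (edge_sum N s a) D = emeasure (count_space ?I) (?f -` D \<inter> ?I)"
    unfolding edge_sum_def using assms by (subst emeasure_distr) (auto simp: space_pair_measure)
  also have "?f -` D \<inter> ?I = {(i, j). enat i < N \<and> enat j < N \<and> (s i, s j, a (i, j)) \<in> D}"
    by auto
  also have "emeasure (count_space ?I) \<dots> = emeasure (count_space UNIV) \<dots>"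
    by (subst (1 2) emeasure_count_space) auto
  finally show ?thesis .
qed

lemma edge_sum_atom_iff:
  "emeasure (edge_sum N s a) {z} \<noteq> 0 \<longleftrightarrow>
    (\<exists>i j. enat i < N \<and> enat j < N \<and> z = (s i, s j, a (i, j)))"
  unfolding emeasure_edge_sum[OF singleton_adj_space] by (auto simp: emeasure_count_space_eq_0)

text \<open>
  The atoms of the measure determine the set of points, hence their number, and together with the
  points also the edges; only the order of the points is lost.
\<close>

lemma edge_sum_eq_imp_permuted:
  assumes inj: "inj s" "inj t" and eq: "edge_sum N s a = edge_sum N' t b" and N: "N = enat n"
  obtains \<rho> where "N' = N" "\<rho> permutes {..<n}"
    "\<And>i j. i < n \<Longrightarrow> j < n \<Longrightarrow> b (i, j) = a (\<rho> i, \<rho> j)"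
proof -
  have atoms: "(\<exists>i j. enat i < N \<and> enat j < N \<and> z = (s i, s j, a (i, j))) \<longleftrightarrow>
      (\<exists>i j. enat i < N' \<and> enat j < N' \<and> z = (t i, t j, b (i, j)))" for z
    unfolding edge_sum_atom_iff[symmetric] eq ..
  have image: "s ` {i. enat i < N} = t ` {i. enat i < N'}"
  proof (intro set_eqI iffI)
    fix x assume "x \<in> s ` {i. enat i < N}"
    then obtain i where "enat i < N" "x = s i" by blast
    then show "x \<in> t ` {i. enat i < N'}" using atoms[of "(s i, s i, a (i, i))"] by auto
  next
    fix x assume "x \<in> t ` {i. enat i < N'}"
    then obtain i where "enat i < N'" "x = t i" by blast
    then show "x \<in> s ` {i. enat i < N}" using atoms[of "(t i, t i, b (i, i))"] by auto
  qed
  have less_n: "{i. enat i < N} = {..<n}" by (auto simp: N)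
  have "finite (t ` {i. enat i < N'})" unfolding image[symmetric] less_n by simp
  then have fin: "finite {i. enat i < N'}"
    using finite_imageD inj(2) inj_on_subset by blast
  have "card {i. enat i < N'} = n"
    using card_image[of t "{i. enat i < N'}"] card_image[of s "{..<n}"] inj image less_n
    by (metis card_lessThan inj_on_subset subset_UNIV)
  have N': "N' = N"
  proof (cases N')
    case (enat m)
    then have "{i. enat i < N'} = {..<m}" by auto
    with \<open>card {i. enat i < N'} = n\<close> show ?thesis by (simp add: enat N)
  next
    case infinity
    with fin show ?thesis by simp
  qed
  define \<rho> where "\<rho> i = (if i < n then THE k. k < n \<and> t i = s k else i)" for i
  have \<rho>: "\<rho> i < n \<and> t i = s (\<rho> i)" if "i < n" for i
  proof -
    have "t i \<in> s ` {..<n}" using image that unfolding N' less_n by blast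
    then have "\<exists>!k. k < n \<and> t i = s k" using inj_eq[OF inj(1)] by auto
    from theI'[OF this] show ?thesis using that by (simp add: \<rho>_def)
  qed
  have "\<rho> permutes {..<n}"
  proof (rule bij_imp_permutes)
    have "inj_on \<rho> {..<n}"
      using \<rho> inj(2) by (metis inj_onI injD lessThan_iff)
    moreover have "\<rho> ` {..<n} \<subseteq> {..<n}" using \<rho> by auto
    ultimately show "bij_betw \<rho> {..<n} {..<n}"
      by (simp add: bij_betw_def endo_inj_surj)
  qed (simp add: \<rho>_def)
  moreover have "b (i, j) = a (\<rho> i, \<rho> j)" if "i < n" "j < n" for i j
  proof -
    have "\<exists>k l. enat k < N \<and> enat l < N \<and> (t i, t j, b (i, j)) = (s k, s l, a (k, l))"
      unfolding atoms by (rule exI[of _ i], rule exI[of _ j]) (use that in \<open>simp add: N' N\<close>)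
    then obtain k l where "k < n" "l < n" "t i = s k" "t j = s l" "b (i, j) = a (k, l)"
      by (auto simp: N)
    moreover have "k = \<rho> i" "l = \<rho> j"
      using \<rho>[OF that(1)] \<rho>[OF that(2)] calculation inj(1) by (metis injD)+
    ultimately show ?thesis by simp
  qed
  ultimately show ?thesis using that N' by blast
qed

lemma
  assumes "representation M W \<xi> N S A"
  shows representation_inj: "AE \<omega> in M. inj (\<lambda>i. S i \<omega>)"
    and representation_edge_sum: "AE \<omega> in M. \<xi> \<omega> = edge_sum (N \<omega>) (\<lambda>i. S i \<omega>) (A \<omega>)"
  using assms unfolding representation_def edge_sum_def by blast+

text \<open>
  The count and the matrix are independent, which makes the product of probabilities the
  probability that \<open>N = n\<close> and the pattern shows. By joint exchangeability every reordering of the first \<open>n\<close> indices 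
  contributes this same probability, so \<open>n!\<close> times it is the expected number, on \<open>N = n\<close>, of
  reorderings that show the pattern.
\<close>

lemma iid_entries_average:
  assumes prob: "prob_space M" and iid: "iid_representation M \<xi> N S A"
    and I: "finite I" "I \<subseteq> {..<n} \<times> {..<n}"
    and pos: "emeasure M {\<omega>\<in>space M. N \<omega> = enat n} \<noteq> 0"
  shows "of_nat (fact n) * (emeasure M {\<omega>\<in>space M. N \<omega> = enat n} *
      emeasure M {\<omega>\<in>space M. \<forall>p\<in>I. A \<omega> p = x p}) =
    (\<integral>\<^sup>+\<omega>. of_bool (N \<omega> = enat n) *
      (\<Sum>\<pi>\<in>{\<pi>. \<pi> permutes {..<n}}. of_bool (\<forall>(i, j)\<in>I. A \<omega> (\<pi> i, \<pi> j) = x (i, j))) \<partial>M)"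
proof -
  interpret M: prob_space M by fact
  obtain W where rep: "representation M W \<xi> N S A"
    using iid unfolding iid_representation_def by blast
  note A = measurable_representation_matrix[OF rep]
  note [measurable] = representation_count[OF rep] representation_entry[OF rep]
  let ?E = "{\<omega>\<in>space M. N \<omega> = enat n}"
  have E: "?E \<in> sets M" by measurable
  let ?C = "\<lambda>\<pi>. {\<omega>\<in>space M. \<forall>p\<in>I. A \<omega> (\<pi> (fst p), \<pi> (snd p)) = x p}"
  have C: "?C \<pi> \<in> sets M" for \<pi> :: "nat \<Rightarrow> nat" using I(1) by measurable
  have each: "emeasure M (?E \<inter> ?C \<pi>) = emeasure M ?E * emeasure M {\<omega>\<in>space M. \<forall>p\<in>I. A \<omega> p = x p}"
    if \<pi>: "\<pi> permutes {..<n}" for \<pi>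
  proof -
    define permute where "permute = (\<lambda>X (i, j). X (\<pi> i, \<pi> j) :: bool)"
    have permute: "permute \<in> matrix_space \<rightarrow>\<^sub>M matrix_space"
      unfolding permute_def by (rule measurable_reindex_matrix)
    have fin: "finite_permutation \<pi>"
      unfolding finite_permutation_def
      using permutes_bij[OF \<pi>] \<pi> by (auto intro: finite_subset[of _ "{..<n}"] simp: permutes_def)
    let ?U = "uniform_measure M ?E"
    have law: "distr ?U matrix_space A = distr M matrix_space A"
      using prob iid pos by (rule iid_conditional_law)
    have A_U: "A \<in> ?U \<rightarrow>\<^sub>M matrix_space"
      using A measurable_cong_sets[of ?U M matrix_space matrix_space] by simp
    have "emeasure M (?E \<inter> ?C \<pi>) = emeasure M ?E * emeasure ?U (?C \<pi>)"
    proof -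
      have "emeasure M ?E * emeasure ?U (?C \<pi>) = emeasure M (?E \<inter> ?C \<pi>) * emeasure M ?E / emeasure M ?E"
        by (simp only: emeasure_uniform_measure[OF E C] ennreal_times_divide mult.commute)
      also have "\<dots> = emeasure M (?E \<inter> ?C \<pi>)"
        using pos M.emeasure_finite[of ?E] by (intro mult_divide_eq_ennreal) (auto simp: infinity_ennreal_def)
      finally show ?thesis ..
    qed
    also have "emeasure ?U (?C \<pi>) = emeasure (distr (distr ?U matrix_space A) matrix_space permute) {X. \<forall>p\<in>I. X p = x p}"
    proof -
      have "distr (distr ?U matrix_space A) matrix_space permute =
          distr ?U matrix_space (\<lambda>\<omega>. permute (A \<omega>))"
        using distr_distr[OF permute A_U] by (simp only: comp_def)
      moreover have "?C \<pi> = {\<omega>\<in>space ?U. \<forall>p\<in>I. permute (A \<omega>) p = x p}"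
        by (auto simp: permute_def split_beta)
      ultimately show ?thesis
        using emeasure_distr_cylinder[OF measurable_compose[OF A_U permute] I(1), of x]
        by (simp only:)
    qed
    also have "\<dots> = emeasure (distr M matrix_space A) {X. \<forall>p\<in>I. X p = x p}"
      using jointly_exchangeable_iid[OF prob iid] fin
      unfolding law jointly_exchangeable_law_def permute_def by simp
    also have "\<dots> = emeasure M {\<omega>\<in>space M. \<forall>p\<in>I. A \<omega> p = x p}"
      using A I(1) by (rule emeasure_distr_cylinder)
    finally show ?thesis .
  qed
  have "(\<integral>\<^sup>+\<omega>. of_bool (N \<omega> = enat n) *
      (\<Sum>\<pi>\<in>{\<pi>. \<pi> permutes {..<n}}. of_bool (\<forall>(i, j)\<in>I. A \<omega> (\<pi> i, \<pi> j) = x (i, j))) \<partial>M) =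
    (\<integral>\<^sup>+\<omega>. (\<Sum>\<pi>\<in>{\<pi>. \<pi> permutes {..<n}}. indicator (?E \<inter> ?C \<pi>) \<omega>) \<partial>M)"
    by (intro nn_integral_cong) (auto simp: sum_distrib_left indicator_def split_beta intro!: sum.cong)
  also have "\<dots> = (\<Sum>\<pi>\<in>{\<pi>. \<pi> permutes {..<n}}. emeasure M (?E \<inter> ?C \<pi>))"
    using E C by (subst nn_integral_sum) auto
  also have "\<dots> = (\<Sum>\<pi>\<in>{\<pi>. \<pi> permutes {..<n}}.
      emeasure M ?E * emeasure M {\<omega>\<in>space M. \<forall>p\<in>I. A \<omega> p = x p})"
    using each by (intro sum.cong) auto
  also have "\<dots> = of_nat (fact n) * (emeasure M ?E * emeasure M {\<omega>\<in>space M. \<forall>p\<in>I. A \<omega> p = x p})"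
    by (simp add: card_permutations[of "{..<n}" n])
  finally show ?thesis ..
qed

lemma finite_subset_block:
  fixes I :: "(nat \<times> nat) set"
  assumes "finite I"
  obtains n where "n \<ge> 1" "I \<subseteq> {..<n} \<times> {..<n}"
proof -
  obtain m where m: "\<forall>k\<in>fst ` I \<union> snd ` I. k < m"
    using finite_nat_set_iff_bounded[of "fst ` I \<union> snd ` I"] assms by auto
  have "I \<subseteq> {..<max 1 m} \<times> {..<max 1 m}"
  proof
    fix p assume "p \<in> I"
    then have "fst p < m" "snd p < m" using m by blast+
    then show "p \<in> {..<max 1 m} \<times> {..<max 1 m}" by (cases p) simp
  qed
  then show ?thesis using that[of "max 1 m"] by simp
qed

lemma representations_permuted:
  assumes rep1: "representation M W1 \<xi> N1 S1 A1" and rep2: "representation M W2 \<xi> N2 S2 A2"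
  shows "AE \<omega> in M. (N1 \<omega> = enat n \<longleftrightarrow> N2 \<omega> = enat n) \<and>
      (N1 \<omega> = enat n \<longrightarrow> (\<exists>\<rho>. \<rho> permutes {..<n} \<and>
        (\<forall>i j. i < n \<longrightarrow> j < n \<longrightarrow> A2 \<omega> (i, j) = A1 \<omega> (\<rho> i, \<rho> j))))"
  using representation_inj[OF rep1] representation_inj[OF rep2]
    representation_edge_sum[OF rep1] representation_edge_sum[OF rep2]
proof eventually_elim
  case (elim \<omega>)
  have eq: "edge_sum (N1 \<omega>) (\<lambda>i. S1 i \<omega>) (A1 \<omega>) = edge_sum (N2 \<omega>) (\<lambda>i. S2 i \<omega>) (A2 \<omega>)"
    using elim by simp
  show ?case
  proof (cases "N1 \<omega> = enat n")
    case True
    from edge_sum_eq_imp_permuted[OF elim(1,2) eq True] obtain \<rho> where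
      "N2 \<omega> = N1 \<omega>" "\<rho> permutes {..<n}"
      "\<And>i j. i < n \<Longrightarrow> j < n \<Longrightarrow> A2 \<omega> (i, j) = A1 \<omega> (\<rho> i, \<rho> j)"
      by blast
    then show ?thesis using True by auto
  next
    case False
    have "N2 \<omega> \<noteq> enat n"
    proof
      assume "N2 \<omega> = enat n"
      from edge_sum_eq_imp_permuted[OF elim(2,1) eq[symmetric] this] have "N1 \<omega> = N2 \<omega>" by metis
      with \<open>N2 \<omega> = enat n\<close> False show False by simp
    qed
    with False show ?thesis by simp
  qed
qed

lemma iid_count_unique:
  assumes "prob_space M"
    and iid1: "iid_representation M \<xi> N1 S1 A1" and iid2: "iid_representation M \<xi> N2 S2 A2"
  shows "emeasure M {\<omega>\<in>space M. N1 \<omega> = enat n} = emeasure M {\<omega>\<in>space M. N2 \<omega> = enat n}"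
proof -
  obtain W1 where rep1: "representation M W1 \<xi> N1 S1 A1"
    using iid1 unfolding iid_representation_def by blast
  obtain W2 where rep2: "representation M W2 \<xi> N2 S2 A2"
    using iid2 unfolding iid_representation_def by blast
  note same = representations_permuted[OF rep1 rep2, of n]
  show ?thesis
  proof (rule emeasure_eq_AE)
    note [measurable] = representation_count[OF rep1] representation_count[OF rep2]
    show "{\<omega>\<in>space M. N1 \<omega> = enat n} \<in> sets M" "{\<omega>\<in>space M. N2 \<omega> = enat n} \<in> sets M"
      by measurable
    show "AE \<omega> in M. (\<omega> \<in> {\<omega>\<in>space M. N1 \<omega> = enat n}) = (\<omega> \<in> {\<omega>\<in>space M. N2 \<omega> = enat n})"
      using same by eventually_elim blast
  qed
qed

text \<open>
  The number of reorderings in \<open>iid_entries_average\<close> does not depend on the order of the points, so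
  almost surely it is the same for both representations.
\<close>

lemma iid_law_unique:
  assumes prob: "prob_space M"
    and iid1: "iid_representation M \<xi> N1 S1 A1" and iid2: "iid_representation M \<xi> N2 S2 A2"
    and pos: "\<And>n. n \<ge> 1 \<Longrightarrow> emeasure M {\<omega>\<in>space M. N1 \<omega> = enat n} \<noteq> 0"
  shows "distr M matrix_space A1 = distr M matrix_space A2"
proof -
  interpret M: prob_space M by fact
  obtain W1 where rep1: "representation M W1 \<xi> N1 S1 A1"
    using iid1 unfolding iid_representation_def by blast
  obtain W2 where rep2: "representation M W2 \<xi> N2 S2 A2"
    using iid2 unfolding iid_representation_def by blast
  note A1 = measurable_representation_matrix[OF rep1] and A2 = measurable_representation_matrix[OF rep2]
  note same = representations_permuted[OF rep1 rep2]
  note N_eq = iid_count_unique[OF prob iid1 iid2]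
  show ?thesis
  proof (rule bool_cube_measure_eqI)
    show "finite_measure (distr M matrix_space A1)"
      using A1 by (rule M.finite_measure_distr)
    fix I :: "(nat \<times> nat) set" and x :: "nat \<times> nat \<Rightarrow> bool" assume I: "finite I"
    obtain n where n: "n \<ge> 1" and I_n: "I \<subseteq> {..<n} \<times> {..<n}"
      using finite_subset_block[OF I] by blast
    let ?p = "emeasure M {\<omega>\<in>space M. N1 \<omega> = enat n}"
    let ?q = "\<lambda>A. emeasure M {\<omega>\<in>space M. \<forall>p\<in>I. (A \<omega> p :: bool) = x p}"
    let ?c = "\<lambda>A \<omega>. \<Sum>\<pi>\<in>{\<pi>. \<pi> permutes {..<n}}. of_bool (\<forall>(i, j)\<in>I. A \<omega> (\<pi> i, \<pi> j) = x (i, j)) :: ennreal"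
    have "of_nat (fact n) * (?p * ?q A1) = of_nat (fact n) * (?p * ?q A2)"
    proof -
      have "(\<integral>\<^sup>+\<omega>. of_bool (N1 \<omega> = enat n) * ?c A1 \<omega> \<partial>M) =
        (\<integral>\<^sup>+\<omega>. of_bool (N2 \<omega> = enat n) * ?c A2 \<omega> \<partial>M)"
      proof (rule nn_integral_cong_AE)
        show "AE \<omega> in M. of_bool (N1 \<omega> = enat n) * ?c A1 \<omega> = of_bool (N2 \<omega> = enat n) * ?c A2 \<omega>"
          using same[of n]
        proof eventually_elim
          case (elim \<omega>)
          show ?case
          proof (cases "N1 \<omega> = enat n")
            case True
            then obtain \<rho> where \<rho>: "\<rho> permutes {..<n}"
              "\<And>i j. i < n \<Longrightarrow> j < n \<Longrightarrow> A2 \<omega> (i, j) = A1 \<omega> (\<rho> i, \<rho> j)"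
              using elim by blast
            \<comment> \<open>Composition with \<open>\<rho>\<close> permutes the reorderings that are being counted.\<close>
            have "?c A1 \<omega> = (\<Sum>\<pi>\<in>{\<pi>. \<pi> permutes {..<n}}.
                of_bool (\<forall>(i, j)\<in>I. A1 \<omega> ((\<rho> \<circ> \<pi>) i, (\<rho> \<circ> \<pi>) j) = x (i, j)))"
              using \<rho>(1) by (rule setum_permutations_compose_left)
            also have "\<dots> = ?c A2 \<omega>"
            proof (rule sum.cong[OF refl])
              fix \<pi> assume "\<pi> \<in> {\<pi>. \<pi> permutes {..<n}}"
              then have less: "\<pi> i < n" if "i < n" for i
                using permutes_in_image[of \<pi> "{..<n}" i] that by simp
              have "A1 \<omega> ((\<rho> \<circ> \<pi>) i, (\<rho> \<circ> \<pi>) j) = A2 \<omega> (\<pi> i, \<pi> j)" if "(i, j) \<in> I" for i j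
                using \<rho>(2)[of "\<pi> i" "\<pi> j"] less[of i] less[of j] I_n that by auto
              then have "(\<forall>(i, j)\<in>I. A1 \<omega> ((\<rho> \<circ> \<pi>) i, (\<rho> \<circ> \<pi>) j) = x (i, j)) \<longleftrightarrow>
                  (\<forall>(i, j)\<in>I. A2 \<omega> (\<pi> i, \<pi> j) = x (i, j))"
                by (intro ball_cong refl) auto
              then show "of_bool (\<forall>(i, j)\<in>I. A1 \<omega> ((\<rho> \<circ> \<pi>) i, (\<rho> \<circ> \<pi>) j) = x (i, j)) =
                  (of_bool (\<forall>(i, j)\<in>I. A2 \<omega> (\<pi> i, \<pi> j) = x (i, j)) :: ennreal)"
                by (simp only:)
            qed
            finally show ?thesis using elim True by simp
          next
            case False
            then show ?thesis using elim by simp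
          qed
        qed
      qed
      then show ?thesis
        using iid_entries_average[OF prob iid1 I I_n pos[OF n], of x]
          iid_entries_average[OF prob iid2 I I_n pos[OF n, unfolded N_eq], of x]
        by (simp only: N_eq)
    qed
    moreover have "?p \<noteq> 0" "?p \<noteq> \<top>"
      using pos[OF n] M.emeasure_finite[of "{\<omega>\<in>space M. N1 \<omega> = enat n}"] by (auto simp: infinity_ennreal_def)
    ultimately have "?q A1 = ?q A2"
      by (simp add: ennreal_mult_cancel_left)
    then show "emeasure (distr M matrix_space A1) {X. \<forall>p\<in>I. X p = x p} =
        emeasure (distr M matrix_space A2) {X. \<forall>p\<in>I. X p = x p}"
      using A1 A2 I by (simp add: emeasure_distr_cylinder)
  qed simp_all
qed

section \<open>Associated laws and i.i.d. representations\<close>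

text \<open>
  Given the count \<open>n\<close>, the block of any other i.i.d. representation has the law of the block of \<open>A\<close>. So
  the condition on the blocks says that \<open>P\<close> and the law of \<open>A\<close> agree on all upper left blocks.
\<close>

lemma associated_law_iff:
  assumes prob: "prob_space M"
    and iid: "iid_representation M (\<lambda>\<omega>. adj_restrict B (\<xi> \<omega>)) N S A"
    and pos: "\<And>n. n \<ge> 1 \<Longrightarrow> emeasure M {\<omega>\<in>space M. N \<omega> = enat n} \<noteq> 0"
  shows "associated_law M \<xi> B P \<longleftrightarrow> P = distr M matrix_space A"
proof -
  interpret M: prob_space M by fact
  obtain W where rep: "representation M W (\<lambda>\<omega>. adj_restrict B (\<xi> \<omega>)) N S A"
    using iid unfolding iid_representation_def by blast
  note A = measurable_representation_matrix[OF rep]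
  let ?block = "\<lambda>n. \<Pi>\<^sub>M p\<in>{..<n} \<times> {..<n::nat}. count_space (UNIV :: bool set)"
  let ?cut = "\<lambda>n (X :: nat \<times> nat \<Rightarrow> bool). restrict X ({..<n} \<times> {..<n})"
  have cut: "?cut n \<in> matrix_space \<rightarrow>\<^sub>M ?block n" for n
    by (rule measurable_restrict_subset) simp
  have sample: "distr (uniform_measure M {\<omega>\<in>space M. N' \<omega> = enat n}) (?block n) (\<lambda>\<omega>. ?cut n (A' \<omega>)) =
      distr (distr M matrix_space A) (?block n) (?cut n)"
    if iid': "iid_representation M (\<lambda>\<omega>. adj_restrict B (\<xi> \<omega>)) N' S' A'" and n: "n \<ge> 1" for N' S' A' n
  proof -
    obtain W' where rep': "representation M W' (\<lambda>\<omega>. adj_restrict B (\<xi> \<omega>)) N' S' A'"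
      using iid' unfolding iid_representation_def by blast
    note A' = measurable_representation_matrix[OF rep']
    let ?U = "uniform_measure M {\<omega>\<in>space M. N' \<omega> = enat n}"
    have A'_U: "A' \<in> ?U \<rightarrow>\<^sub>M matrix_space"
      using A' measurable_cong_sets[of ?U M matrix_space matrix_space] by simp
    have pos': "emeasure M {\<omega>\<in>space M. N' \<omega> = enat n} \<noteq> 0"
      using pos[OF n] unfolding iid_count_unique[OF prob iid iid'] .
    have "distr ?U (?block n) (\<lambda>\<omega>. ?cut n (A' \<omega>)) = distr (distr ?U matrix_space A') (?block n) (?cut n)"
      using distr_distr[OF cut A'_U] by (simp only: comp_def)
    also have "distr ?U matrix_space A' = distr M matrix_space A"
      by (rule trans[OF iid_conditional_law[OF prob iid' pos'] iid_law_unique[OF prob iid iid' pos, symmetric]])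
    finally show ?thesis .
  qed
  show ?thesis
  proof
    assume P: "associated_law M \<xi> B P"
    then have sets_P: "sets P = sets matrix_space" by (simp add: associated_law_def)
    show "P = distr M matrix_space A"
    proof (rule bool_cube_measure_eqI)
      show "finite_measure P" using P by (simp add: associated_law_def prob_space.finite_measure)
      fix I :: "(nat \<times> nat) set" and x :: "nat \<times> nat \<Rightarrow> bool" assume I: "finite I"
      obtain n where n: "n \<ge> 1" "I \<subseteq> {..<n} \<times> {..<n}"
        using finite_subset_block[OF I] by blast
      have blocks: "distr P (?block n) (?cut n) = distr (distr M matrix_space A) (?block n) (?cut n)"
      proof -
        have "distr (uniform_measure M {\<omega>\<in>space M. N \<omega> = enat n}) (?block n) (\<lambda>\<omega>. ?cut n (A \<omega>)) =
            distr P (?block n) (?cut n)"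
          using P iid n(1) unfolding associated_law_def by blast
        then show ?thesis by (rule trans[OF sym sample[OF iid n(1)]])
      qed
      let ?D = "{X\<in>space (?block n). \<forall>p\<in>I. X p = x p}"
      have D: "?D \<in> sets (?block n)"
      proof -
        have [measurable]: "(\<lambda>X. X p) \<in> ?block n \<rightarrow>\<^sub>M count_space UNIV" if "p \<in> I" for p
          using n(2) that by (intro measurable_component_singleton) auto
        show ?thesis using I by measurable
      qed
      have vimage: "?cut n -` ?D \<inter> space R = {X. \<forall>p\<in>I. X p = x p}" if "space R = UNIV" for R
        using n(2) that by (auto simp: space_PiM subset_iff)
      have eq: "emeasure R {X. \<forall>p\<in>I. X p = x p} = emeasure (distr R (?block n) (?cut n)) ?D"
        if R: "sets R = sets matrix_space" for R
      proof -
        have "?cut n \<in> R \<rightarrow>\<^sub>M ?block n"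
          using cut measurable_cong_sets[OF R refl] by blast
        moreover have "space R = UNIV" using sets_eq_imp_space_eq[OF R] by simp
        ultimately show ?thesis using D vimage by (simp add: emeasure_distr)
      qed
      show "emeasure P {X. \<forall>p\<in>I. X p = x p} = emeasure (distr M matrix_space A) {X. \<forall>p\<in>I. X p = x p}"
        using eq[OF sets_P] eq[of "distr M matrix_space A"] by (simp only: blocks sets_distr)
    qed (use sets_P in simp_all)
  next
    assume P: "P = distr M matrix_space A"
    show "associated_law M \<xi> B P"
      unfolding associated_law_def P
    proof (intro conjI allI impI)
      show "prob_space (distr M matrix_space A)" using A by (rule M.prob_space_distr)
      show "jointly_exchangeable_law (distr M matrix_space A)"
        using prob iid by (rule jointly_exchangeable_iid)
    qed (simp, rule sample)
  qed
qed

lemma associated_matrix_iff: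
  assumes prob: "prob_space M"
    and iid: "iid_representation M (\<lambda>\<omega>. adj_restrict B (\<xi> \<omega>)) N S A"
    and pos: "\<And>n. n \<ge> 1 \<Longrightarrow> emeasure M {\<omega>\<in>space M. N \<omega> = enat n} \<noteq> 0"
  shows "associated_matrix M \<xi> B X \<longleftrightarrow>
    X \<in> M \<rightarrow>\<^sub>M matrix_space \<and> distr M matrix_space X = distr M matrix_space A"
proof -
  let ?L = "distr M matrix_space A"
  have iff: "associated_law M \<xi> B P \<longleftrightarrow> P = ?L" for P
    using assms by (rule associated_law_iff)
  show ?thesis
  proof
    assume X: "associated_matrix M \<xi> B X"
    then have "associated_law M \<xi> B (distr M matrix_space X)" "X \<in> M \<rightarrow>\<^sub>M matrix_space"
      by (simp_all only: associated_matrix_def)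
    then show "X \<in> M \<rightarrow>\<^sub>M matrix_space \<and> distr M matrix_space X = ?L"
      by (simp only: iff)
  next
    assume X: "X \<in> M \<rightarrow>\<^sub>M matrix_space \<and> distr M matrix_space X = ?L"
    then show "associated_matrix M \<xi> B X"
      by (simp only: associated_matrix_def iff) simp
  qed
qed

text \<open>
  Without an i.i.d. representation, the law of the matrix without any 1 and the law of the matrix
  without any 0 would both be associated.
\<close>

lemma associated_matrix_imp_iid_representation:
  assumes "associated_matrix M \<xi> B X"
  obtains N S A where "iid_representation M (\<lambda>\<omega>. adj_restrict B (\<xi> \<omega>)) N S A"
proof (rule ccontr)
  assume "\<not> thesis"
  then have none: "\<not> iid_representation M (\<lambda>\<omega>. adj_restrict B (\<xi> \<omega>)) N S A" for N S A
    by (rule contrapos_nn) (rule that)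
  \<comment> \<open>\<open>P b\<close> is the law of the matrix all of whose entries are \<open>b\<close>.\<close>
  define P where "P b = return matrix_space (\<lambda>_ :: nat \<times> nat. b)" for b :: bool
  have degenerate: "associated_law M \<xi> B (P b)" for b
    unfolding associated_law_def
  proof (intro conjI allI impI)
    show "prob_space (P b)" unfolding P_def by (rule prob_space_return) simp
    show "jointly_exchangeable_law (P b)"
      unfolding jointly_exchangeable_law_def
    proof (intro allI impI)
      fix \<pi> :: "nat \<Rightarrow> nat"
      show "distr (P b) matrix_space (\<lambda>X (i, j). X (\<pi> i, \<pi> j)) = P b"
      proof -
        have const: "(\<lambda>(i :: nat, j :: nat). b) = (\<lambda>_. b)" by auto
        show ?thesis
          unfolding P_def using distr_return[OF measurable_reindex_matrix, of "\<lambda>_. b"] by (simp add: const)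
      qed
    qed
  next
    show "sets (P b) = sets matrix_space" unfolding P_def by (rule sets_return)
  qed (rule notE[OF none])
  have unique: "\<forall>P. associated_law M \<xi> B P \<longrightarrow> P = distr M matrix_space X"
    using assms unfolding associated_matrix_def by (elim conjE)
  have "P b = distr M matrix_space X" for b
    by (rule mp[OF spec[OF unique] degenerate])
  from this[of True] this[of False] have "P True = P False" by (rule trans[OF _ sym])
  define D where "D = {X :: nat \<times> nat \<Rightarrow> bool. \<forall>p\<in>{(0, 0)}. X p = True}"
  have "emeasure (P b) D = indicator D (\<lambda>_. b)" for b
    unfolding P_def D_def by (rule emeasure_return) (rule measurable_cylinder, simp)
  then have "indicator D (\<lambda>_. True) = (indicator D (\<lambda>_. False) :: ennreal)"
    using arg_cong[OF \<open>P True = P False\<close>, of "\<lambda>P. emeasure P D"] by (simp only:)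
  then show False by (simp add: D_def)
qed

section \<open>Restricting the process to one side of a partition\<close>

lemma emeasure_adj_restrict:
  assumes sets: "sets m = sets adj_space" and B: "B \<in> sets borel" and X: "X \<in> sets adj_space"
  shows "emeasure (adj_restrict B m) X = emeasure m (B \<times> B \<times> UNIV \<inter> X)"
proof -
  have B3: "B \<times> B \<times> UNIV \<in> sets m"
    unfolding sets by (intro pair_measureI B) simp_all
  have "emeasure (adj_restrict B m) X = (\<integral>\<^sup>+z. indicator (B \<times> B \<times> UNIV) z * indicator X z \<partial>m)"
    unfolding adj_restrict_def
    by (rule emeasure_density) (use B3 X sets in \<open>simp_all only: borel_measurable_indicator\<close>)
  also have "\<dots> = (\<integral>\<^sup>+z. indicator (B \<times> B \<times> UNIV \<inter> X) z \<partial>m)"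
    by (intro nn_integral_cong) (rule indicator_inter_arith[symmetric])
  also have "\<dots> = emeasure m (B \<times> B \<times> UNIV \<inter> X)"
    by (rule nn_integral_indicator) (use B3 X sets in blast)
  finally show ?thesis .
qed

lemma sets_adj_restrict [simp]: "sets (adj_restrict B m) = sets m"
  by (simp add: adj_restrict_def)

lemma adj_restrict_adj_restrict:
  assumes sets: "sets m = sets adj_space" and B: "B \<in> sets borel" and C: "C \<in> sets borel"
  shows "adj_restrict C (adj_restrict B m) = adj_restrict (B \<inter> C) m"
proof (rule measure_eqI)
  fix X assume "X \<in> sets (adj_restrict C (adj_restrict B m))"
  then have X: "X \<in> sets adj_space" using sets by simp
  have C3: "C \<times> C \<times> UNIV \<inter> X \<in> sets adj_space"
    by (intro sets.Int X pair_measureI C) simp_all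
  have "B \<times> B \<times> UNIV \<inter> (C \<times> C \<times> UNIV \<inter> X) = (B \<inter> C) \<times> (B \<inter> C) \<times> UNIV \<inter> X" by auto
  then show "emeasure (adj_restrict C (adj_restrict B m)) X = emeasure (adj_restrict (B \<inter> C) m) X"
    using emeasure_adj_restrict[OF _ C X, of "adj_restrict B m"] emeasure_adj_restrict[OF sets B C3]
      emeasure_adj_restrict[OF sets sets.Int[OF B C] X] sets
    by (simp only: sets_adj_restrict)
qed simp

lemma sets_edge_sum [simp]: "sets (edge_sum N s a) = sets adj_space"
  by (simp add: edge_sum_def)

lemma hits_pick:
  assumes "both_infinite (hits D s)"
  shows "s i \<in> cell D k \<longleftrightarrow> i \<in> range (pick (hits D s) k)"
  using assms by (simp add: range_pick side_def hits_def cell_def)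

text \<open>
  Keep the points of one side and renumber them in their order.
\<close>

lemma adj_restrict_edge_sum:
  fixes s :: "nat \<Rightarrow> 's::polish_space" and k :: bool
  assumes D: "D \<in> sets borel" and inf: "both_infinite (hits D s)"
  defines "p \<equiv> pick (hits D s) k"
  shows "adj_restrict (cell D k) (edge_sum N s a) =
    edge_sum (pick_count (hits D s) k N) (\<lambda>i. s (p i)) (\<lambda>(i, j). a (p i, p j))"
proof (rule measure_eqI)
  let ?B = "cell D k"
  have B: "?B \<in> sets borel"
  proof (cases k)
    case True
    then have "?B = D" by (auto simp: cell_def)
    with D show ?thesis by simp
  next
    case False
    then have "?B = - D" by (auto simp: cell_def)
    with D show ?thesis by auto
  qed
  fix X assume "X \<in> sets (adj_restrict ?B (edge_sum N s a))"
  then have X: "X \<in> sets adj_space" by simp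
  have B3: "?B \<times> ?B \<times> UNIV \<inter> X \<in> sets adj_space"
    by (intro sets.Int X pair_measureI B) simp_all
  let ?L = "{(i, j). enat i < N \<and> enat j < N \<and> (s i, s j, a (i, j)) \<in> ?B \<times> ?B \<times> UNIV \<inter> X}"
  let ?R = "{(i, j). enat i < pick_count (hits D s) k N \<and> enat j < pick_count (hits D s) k N \<and>
    (s (p i), s (p j), a (p i, p j)) \<in> X}"
  have inj: "inj_on (map_prod p p) ?R"
    by (auto simp: inj_on_def p_def)
  have "?L = map_prod p p ` ?R"
  proof (intro set_eqI iffI)
    fix z assume "z \<in> ?L"
    then obtain i j where z: "z = (i, j)" and ij: "enat i < N" "enat j < N" "s i \<in> ?B" "s j \<in> ?B"
      "(s i, s j, a (i, j)) \<in> X"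
      by auto
    then obtain i' j' where "i = p i'" "j = p j'"
      using hits_pick[OF inf, of i k] hits_pick[OF inf, of j k] unfolding p_def by blast
    then show "z \<in> map_prod p p ` ?R"
      using ij by (auto simp: z less_pick_count_iff p_def intro!: rev_image_eqI[of "(i', j')"])
  next
    fix z assume "z \<in> map_prod p p ` ?R"
    then obtain i j where "z = (p i, p j)" "(i, j) \<in> ?R" by auto
    then show "z \<in> ?L"
      using hits_pick[OF inf, of "p i" k] hits_pick[OF inf, of "p j" k]
      by (auto simp: less_pick_count_iff p_def)
  qed
  then have "emeasure (count_space UNIV) ?L = emeasure (count_space UNIV) ?R"
    using inj by (simp add: emeasure_count_space card_image finite_image_iff)
  then show "emeasure (adj_restrict ?B (edge_sum N s a)) X =
      emeasure (edge_sum (pick_count (hits D s) k N) (\<lambda>i. s (p i)) (\<lambda>(i, j). a (p i, p j))) X"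
    using B X B3 by (simp add: emeasure_adj_restrict emeasure_edge_sum)
qed simp

lemma measurable_cell:
  fixes D :: "'s::topological_space set"
  assumes "D \<in> sets borel"
  shows "cell D k \<in> sets borel"
proof -
  have "cell D True = D" "cell D False = - D" by (auto simp: cell_def)
  with assms show ?thesis by (cases k) (auto intro: borel_comp)
qed

text \<open>
  The number of points kept is a function of the count and the labels, and the points kept are
  independent of both.
\<close>

lemma thinned_point_law:
  fixes S :: "nat \<Rightarrow> 'w \<Rightarrow> 's::polish_space"
  assumes prob: "prob_space M" and iid: "iid_representation M \<xi> N S A" and D: "D \<in> sets borel"
    and pos: "\<And>k. emeasure (distr M borel (S 0)) (cell D k) \<noteq> 0"
  defines "J \<equiv> \<lambda>\<omega>. hits D (\<lambda>i. S i \<omega>)"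
    and "\<rho> \<equiv> \<lambda>k. seq_law (uniform_measure (distr M borel (S 0)) (cell D k))"
  shows "distr M (count_space UNIV \<Otimes>\<^sub>M seq_law borel)
      (\<lambda>\<omega>. (pick_count (J \<omega>) k (N \<omega>), \<lambda>i. S (pick (J \<omega>) k i) \<omega>)) =
    distr M (count_space UNIV) (\<lambda>\<omega>. pick_count (J \<omega>) k (N \<omega>)) \<Otimes>\<^sub>M \<rho> k"
proof -
  interpret M: prob_space M by fact
  obtain W where rep: "representation M W \<xi> N S A"
    using iid unfolding iid_representation_def by blast
  note N = representation_count[OF rep] and S = representation_point[OF rep]
  let ?\<sigma> = "distr M borel (S 0)"
  have \<sigma>: "prob_space ?\<sigma>" using S by (rule M.prob_space_distr)
  interpret P: prob_space "seq_law ?\<sigma>" using \<sigma> by (rule prob_space_seq_law)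
  have u: "prob_space (uniform_measure ?\<sigma> (cell D k))"
    using pos by (rule prob_space_uniform_measure)
      (use prob_space.finite_measure[OF \<sigma>] finite_measure.emeasure_finite in auto)
  interpret R: prob_space "\<rho> k" unfolding \<rho>_def using u by (rule prob_space_seq_law)
  have sets_P: "sets (seq_law ?\<sigma>) = sets (seq_law borel)"
    by (intro sets_PiM_cong) simp_all
  have sets_\<rho>: "sets (\<rho> k) = sets (seq_law borel)"
    unfolding \<rho>_def by (intro sets_PiM_cong) simp_all
  have space_seq: "space (seq_law (borel :: 's measure)) = UNIV" by (simp add: space_PiM)
  let ?law = "distr M (count_space UNIV \<Otimes>\<^sub>M seq_law borel) (\<lambda>\<omega>. (N \<omega>, \<lambda>i. S i \<omega>))"
  have NS: "(\<lambda>\<omega>. (N \<omega>, \<lambda>i. S i \<omega>)) \<in> M \<rightarrow>\<^sub>M count_space UNIV \<Otimes>\<^sub>M seq_law borel"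
    using N S by (rule measurable_point_algebra)
  have hits: "hits D \<in> seq_law borel \<rightarrow>\<^sub>M bool_cube" using D by (rule measurable_hits)
  define sel where "sel = (\<lambda>s :: nat \<Rightarrow> 's. \<lambda>i. s (pick (hits D s) k i))"
  have sel: "sel \<in> seq_law borel \<rightarrow>\<^sub>M seq_law borel"
    unfolding sel_def by (rule measurable_pick_seq[OF hits measurable_ident_sets[OF refl]])
  define \<psi> where "\<psi> = (\<lambda>(n, s). (pick_count (hits D s) k n, sel s))"
  have \<psi>: "\<psi> \<in> count_space UNIV \<Otimes>\<^sub>M seq_law borel \<rightarrow>\<^sub>M count_space UNIV \<Otimes>\<^sub>M seq_law borel"
    unfolding \<psi>_def split_beta'
    by (intro measurable_Pair measurable_pick_count measurable_compose[OF measurable_snd hits]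
      measurable_fst measurable_compose[OF measurable_snd sel])
  let ?N' = "\<lambda>\<omega>. pick_count (J \<omega>) k (N \<omega>)"
  have \<psi>_eq: "\<psi> (N \<omega>, \<lambda>i. S i \<omega>) = (?N' \<omega>, \<lambda>i. S (pick (J \<omega>) k i) \<omega>)" for \<omega>
    by (simp add: \<psi>_def sel_def J_def)
  have N': "?N' \<in> M \<rightarrow>\<^sub>M count_space UNIV"
    using measurable_compose[OF measurable_compose[OF NS \<psi>] measurable_fst] by (simp add: \<psi>_eq)
  have joint: "emeasure (distr M (count_space UNIV \<Otimes>\<^sub>M seq_law borel) (\<lambda>\<omega>. \<psi> (N \<omega>, \<lambda>i. S i \<omega>))) (G \<times> H) =
    (\<integral>\<^sup>+n. emeasure (distr (seq_law ?\<sigma>) bool_cube (hits D)) {j. pick_count j k n \<in> G} \<partial>distr M (count_space UNIV) N) *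
      emeasure (\<rho> k) H"
    if H: "H \<in> sets (seq_law borel)" for G :: "enat set" and H
  proof -
    let ?B = "\<psi> -` (G \<times> H)"
    have GH: "G \<times> H \<in> sets (count_space UNIV \<Otimes>\<^sub>M seq_law borel)" using H by (intro pair_measureI) auto
    have B: "?B \<in> sets (count_space UNIV \<Otimes>\<^sub>M seq_law borel)"
      using measurable_sets[OF \<psi> GH] by (simp add: space_pair_measure space_seq)
    have "emeasure (distr M (count_space UNIV \<Otimes>\<^sub>M seq_law borel) (\<lambda>\<omega>. \<psi> (N \<omega>, \<lambda>i. S i \<omega>))) (G \<times> H) =
        emeasure ?law ?B"
      using GH B NS measurable_compose[OF NS \<psi>] by (simp add: emeasure_distr vimage_def)
    also have "\<dots> = emeasure (distr M (count_space UNIV) N \<Otimes>\<^sub>M seq_law ?\<sigma>) ?B"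
      by (simp only: iid_representation_law(1)[OF prob iid])
    also have "\<dots> = (\<integral>\<^sup>+n. emeasure (seq_law ?\<sigma>) (Pair n -` ?B) \<partial>distr M (count_space UNIV) N)"
    proof (rule P.emeasure_pair_measure_alt)
      have "sets (distr M (count_space UNIV) N \<Otimes>\<^sub>M seq_law ?\<sigma>) = sets (count_space UNIV \<Otimes>\<^sub>M seq_law borel)"
        by (intro sets_pair_measure_cong sets_P) simp
      with B show "?B \<in> sets (distr M (count_space UNIV) N \<Otimes>\<^sub>M seq_law ?\<sigma>)" by blast
    qed
    also have "\<dots> = (\<integral>\<^sup>+n. emeasure (distr (seq_law ?\<sigma>) bool_cube (hits D)) {j. pick_count j k n \<in> G} *
        emeasure (\<rho> k) H \<partial>distr M (count_space UNIV) N)"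
    proof (rule nn_integral_cong)
      fix n
      let ?K = "{j. pick_count j k n \<in> G}"
      have K: "?K \<in> sets bool_cube"
      proof -
        have "(\<lambda>j. pick_count j k n) \<in> bool_cube \<rightarrow>\<^sub>M count_space UNIV"
          by (intro measurable_pick_count measurable_ident_sets refl) simp
        from measurable_sets[OF this, of G] show ?thesis by (simp add: vimage_def)
      qed
      have H': "H \<in> sets (\<rho> k)" using H sets_\<rho> by blast
      have f: "(\<lambda>s. (hits D s, sel s)) \<in> seq_law ?\<sigma> \<rightarrow>\<^sub>M bool_cube \<Otimes>\<^sub>M \<rho> k"
      proof (rule measurable_Pair)
        show "hits D \<in> seq_law ?\<sigma> \<rightarrow>\<^sub>M bool_cube"
          using hits measurable_cong_sets[OF sets_P refl] by blast
        show "sel \<in> seq_law ?\<sigma> \<rightarrow>\<^sub>M \<rho> k"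
          using sel measurable_cong_sets[OF sets_P sets_\<rho>] by blast
      qed
      have law: "distr (seq_law ?\<sigma>) (bool_cube \<Otimes>\<^sub>M \<rho> k) (\<lambda>s. (hits D s, sel s)) =
          distr (seq_law ?\<sigma>) bool_cube (hits D) \<Otimes>\<^sub>M \<rho> k"
        unfolding sel_def \<rho>_def using D pos by (intro seq_law_side(1) \<sigma>) simp_all
      have "Pair n -` ?B = (\<lambda>s. (hits D s, sel s)) -` (?K \<times> H) \<inter> space (seq_law ?\<sigma>)"
        by (auto simp: \<psi>_def space_PiM)
      then have "emeasure (seq_law ?\<sigma>) (Pair n -` ?B) =
          emeasure (distr (seq_law ?\<sigma>) (bool_cube \<Otimes>\<^sub>M \<rho> k) (\<lambda>s. (hits D s, sel s))) (?K \<times> H)"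
        using K H' by (subst emeasure_distr[OF f]) auto
      also have "\<dots> = emeasure (distr (seq_law ?\<sigma>) bool_cube (hits D)) ?K * emeasure (\<rho> k) H"
        unfolding law using K H' by (intro R.emeasure_pair_measure_Times) simp_all
      finally show "emeasure (seq_law ?\<sigma>) (Pair n -` ?B) =
          emeasure (distr (seq_law ?\<sigma>) bool_cube (hits D)) ?K * emeasure (\<rho> k) H" .
    qed
    also have "\<dots> = (\<integral>\<^sup>+n. emeasure (distr (seq_law ?\<sigma>) bool_cube (hits D)) {j. pick_count j k n \<in> G}
        \<partial>distr M (count_space UNIV) N) * emeasure (\<rho> k) H"
      by (rule nn_integral_multc) (simp add: measurable_distr_eq1)
    finally show ?thesis .
  qed
  have marginal: "emeasure (distr M (count_space UNIV) ?N') G =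
    (\<integral>\<^sup>+n. emeasure (distr (seq_law ?\<sigma>) bool_cube (hits D)) {j. pick_count j k n \<in> G} \<partial>distr M (count_space UNIV) N)"
    for G
  proof -
    have "emeasure (distr M (count_space UNIV) ?N') G =
        emeasure (distr M (count_space UNIV \<Otimes>\<^sub>M seq_law borel) (\<lambda>\<omega>. \<psi> (N \<omega>, \<lambda>i. S i \<omega>))) (G \<times> UNIV)"
      using N' measurable_compose[OF NS \<psi>] pair_measureI[of G "count_space UNIV" UNIV "seq_law (borel :: 's measure)"]
        sets.top[of "seq_law (borel :: 's measure)"] space_seq
      by (simp add: emeasure_distr \<psi>_eq vimage_def)
    also have "\<dots> = (\<integral>\<^sup>+n. emeasure (distr (seq_law ?\<sigma>) bool_cube (hits D)) {j. pick_count j k n \<in> G}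
        \<partial>distr M (count_space UNIV) N) * emeasure (\<rho> k) UNIV"
      using sets.top[of "seq_law (borel :: 's measure)"] space_seq by (intro joint) simp
    also have "emeasure (\<rho> k) UNIV = 1"
      using R.emeasure_space_1 sets_eq_imp_space_eq[OF sets_\<rho>] space_seq by simp
    finally show ?thesis by simp
  qed
  have "distr M (count_space UNIV) ?N' \<Otimes>\<^sub>M \<rho> k =
    distr M (count_space UNIV \<Otimes>\<^sub>M seq_law borel) (\<lambda>\<omega>. \<psi> (N \<omega>, \<lambda>i. S i \<omega>))"
  proof (rule pair_measure_eqI)
    interpret DN: prob_space "distr M (count_space UNIV) ?N'" using N' by (rule M.prob_space_distr)
    show "sigma_finite_measure (distr M (count_space UNIV) ?N')" "sigma_finite_measure (\<rho> k)"
      by unfold_locales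
    show "sets (distr M (count_space UNIV) ?N' \<Otimes>\<^sub>M \<rho> k) =
      sets (distr M (count_space UNIV \<Otimes>\<^sub>M seq_law borel) (\<lambda>\<omega>. \<psi> (N \<omega>, \<lambda>i. S i \<omega>)))"
      unfolding sets_distr by (intro sets_pair_measure_cong sets_\<rho>) simp
    fix G H assume "H \<in> sets (\<rho> k)"
    then have "H \<in> sets (seq_law borel)" using sets_\<rho> by blast
    from joint[OF this, of G]
    show "emeasure (distr M (count_space UNIV) ?N') G * emeasure (\<rho> k) H =
      emeasure (distr M (count_space UNIV \<Otimes>\<^sub>M seq_law borel) (\<lambda>\<omega>. \<psi> (N \<omega>, \<lambda>i. S i \<omega>))) (G \<times> H)"
      by (simp only: marginal)
  qed
  then show ?thesis by (simp only: \<psi>_eq)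
qed

lemma AE_both_infinite_hits:
  fixes S :: "nat \<Rightarrow> 'w \<Rightarrow> 's::polish_space"
  assumes prob: "prob_space M" and iid: "iid_representation M \<xi> N S A" and D: "D \<in> sets borel"
    and pos: "\<And>k. emeasure (distr M borel (S 0)) (cell D k) \<noteq> 0"
  shows "AE \<omega> in M. both_infinite (hits D (\<lambda>i. S i \<omega>))"
proof -
  interpret M: prob_space M by fact
  obtain W where rep: "representation M W \<xi> N S A"
    using iid unfolding iid_representation_def by blast
  note S = representation_point[OF rep]
  let ?\<sigma> = "distr M borel (S 0)"
  have \<sigma>: "prob_space ?\<sigma>" using S by (rule M.prob_space_distr)
  have "AE s in seq_law ?\<sigma>. infinite {i. s i \<in> cell D k}" for k
    using \<sigma> measurable_cell[OF D] pos by (intro AE_seq_law_infinitely_often) simp_all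
  then have inf: "AE \<omega> in M. infinite {i. S i \<omega> \<in> cell D k}" for k
    using AE_distrD[OF measurable_seqI[of "\<lambda>\<omega> i. S i \<omega>"], OF S]
    unfolding iid_representation_law(2)[OF prob iid] by blast
  from inf[of True] inf[of False] show ?thesis
    by eventually_elim (simp add: both_infinite_def hits_def cell_def)
qed

text \<open>
  The points kept and their number are functions of the original points and count, so they generate
  a smaller \<open>\<sigma>\<close>-algebra. The conditional law given the larger one depends on the points kept only,
  and is therefore the conditional law given the smaller one too.
\<close>

lemma thinned_cond_exp:
  fixes S :: "nat \<Rightarrow> 'w \<Rightarrow> 's::polish_space" and k :: bool
  assumes prob: "prob_space M" and W: "connection_function W" and rep: "representation M W \<xi> N S A"
    and D: "D \<in> sets borel"
  defines "J \<equiv> \<lambda>\<omega>. hits D (\<lambda>i. S i \<omega>)"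
  defines "N' \<equiv> \<lambda>\<omega>. pick_count (J \<omega>) k (N \<omega>)" and "S' \<equiv> \<lambda>i \<omega>. S (pick (J \<omega>) k i) \<omega>"
  assumes I: "finite I" "I \<subseteq> {(i, j). i < j}"
  shows "AE \<omega> in M. real_cond_exp M (point_algebra M N' S')
      (indicator {\<omega>\<in>space M. \<forall>p\<in>I. (case p of (i, j) \<Rightarrow> A \<omega> (pick (J \<omega>) k i, pick (J \<omega>) k j)) = a p}) \<omega> =
    (\<Prod>(i, j)\<in>I. pmf (bernoulli_pmf (W (S' i \<omega>, S' j \<omega>))) (a (i, j)))"
proof -
  interpret M: prob_space M by fact
  note N = representation_count[OF rep] and S = representation_point[OF rep]
  let ?G = "point_algebra M N S" and ?G' = "point_algebra M N' S'"
  let ?F = "{\<omega>\<in>space M. \<forall>p\<in>I. (case p of (i, j) \<Rightarrow> A \<omega> (pick (J \<omega>) k i, pick (J \<omega>) k j)) = a p}"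
  let ?g = "\<lambda>\<omega>. \<Prod>(i, j)\<in>I. pmf (bernoulli_pmf (W (S' i \<omega>, S' j \<omega>))) (a (i, j))"
  have sub: "subalgebra M ?G" using N S by (rule subalgebra_point_algebra)
  have NG: "N \<in> ?G \<rightarrow>\<^sub>M count_space UNIV" and SG: "(\<lambda>\<omega> i. S i \<omega>) \<in> ?G \<rightarrow>\<^sub>M seq_law borel"
    by (rule point_algebra_count[OF N S], rule point_algebra_points[OF N S])
  have JG: "J \<in> ?G \<rightarrow>\<^sub>M bool_cube"
    unfolding J_def using SG measurable_hits[OF D] by (rule measurable_compose)
  have N'G: "N' \<in> ?G \<rightarrow>\<^sub>M count_space UNIV"
    unfolding N'_def using JG NG by (rule measurable_pick_count)
  have S'G: "(\<lambda>\<omega> i. S' i \<omega>) \<in> ?G \<rightarrow>\<^sub>M seq_law borel"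
    unfolding S'_def using JG SG by (rule measurable_pick_seq)
  have pickG: "(\<lambda>\<omega>. pick (J \<omega>) k i) \<in> ?G \<rightarrow>\<^sub>M count_space UNIV" for i
    using JG measurable_pick by (rule measurable_compose)
  have G'_G: "sets ?G' \<subseteq> sets ?G"
    by (rule sets_image_in_sets[OF _ measurable_Pair[OF N'G S'G]]) simp
  have N'_M: "N' \<in> M \<rightarrow>\<^sub>M count_space UNIV"
    using sub N'G by (rule measurable_from_subalg)
  have S'_M: "S' i \<in> M \<rightarrow>\<^sub>M borel" for i
    using measurable_compose[OF measurable_from_subalg[OF sub S'G] measurable_seq_component[of i]] by simp
  have sub': "subalgebra M ?G'" using N'_M S'_M by (rule subalgebra_point_algebra)
  interpret G': finite_measure_subalgebra M ?G'
    using sub' by unfold_locales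
  have pick_M: "(\<lambda>\<omega>. pick (J \<omega>) k i) \<in> M \<rightarrow>\<^sub>M count_space UNIV" for i
    using sub pickG by (rule measurable_from_subalg)
  have entry: "(\<lambda>\<omega>. A \<omega> (pick (J \<omega>) k i, pick (J \<omega>) k j)) \<in> M \<rightarrow>\<^sub>M count_space UNIV" for i j
    by (rule measurable_compose_countable[OF measurable_compose_countable[OF representation_entry[OF rep] pick_M] pick_M])
  have F: "?F \<in> sets M"
  proof -
    note [measurable] = entry
    show ?thesis using I(1) unfolding split_beta by measurable
  qed
  have g_ennreal: "ennreal (?g \<omega>) = (\<Prod>p\<in>I. edge_weight W (a p) (S' (fst p) \<omega>) (S' (snd p) \<omega>))" for \<omega>
    by (simp add: edge_weight_def split_beta prod_ennreal)
  have g_nonneg: "0 \<le> ?g \<omega>" for \<omega> by (simp add: prod_nonneg split_beta)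
  have g_G': "?g \<in> borel_measurable ?G'"
  proof -
    have "(\<lambda>\<omega>. \<Prod>p\<in>I. edge_weight W (a p) (S' (fst p) \<omega>) (S' (snd p) \<omega>)) \<in> borel_measurable ?G'"
    proof -
      have "(\<lambda>\<omega> i. S' i \<omega>) \<in> ?G' \<rightarrow>\<^sub>M seq_law borel"
        by (rule point_algebra_points[OF N'_M S'_M])
      from measurable_compose[OF this measurable_edge_weight_prod[OF W]] show ?thesis .
    qed
    from borel_measurable_enn2real[OF this]
    show ?thesis unfolding g_ennreal[symmetric] enn2real_ennreal[OF g_nonneg] .
  qed
  have g_M: "?g \<in> borel_measurable M" using sub' g_G' by (rule measurable_from_subalg)
  have g_int: "integrable M ?g"
  proof (rule M.integrable_const_bound[of _ 1])
    have "?g \<omega> \<le> 1" for \<omega>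
      by (intro prod_le_1) (auto simp: pmf_le_1)
    then show "AE \<omega> in M. norm (?g \<omega>) \<le> 1" using g_nonneg by simp
  qed (rule g_M)
  show ?thesis
  proof (rule G'.real_cond_exp_charact)
    fix E assume "E \<in> sets ?G'"
    then have E: "E \<in> sets ?G" using G'_G by blast
    then have E_M: "E \<in> sets M" using sub by (auto simp: subalgebra_def)
    have distinct: "distinct_pairs I (\<lambda>p. pick (J \<omega>) k (fst p)) (\<lambda>p. pick (J \<omega>) k (snd p))" for \<omega>
      using I(2) by (rule distinct_pairs_upper) (simp add: inj_def)
    have "emeasure M (E \<inter> ?F) =
        emeasure M {\<omega>\<in>E. \<forall>p\<in>I. A \<omega> (pick (J \<omega>) k (fst p), pick (J \<omega>) k (snd p)) = a p}"
      using sets.sets_into_space[OF E_M] by (intro arg_cong[where f="emeasure M"]) (auto simp: split_beta)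
    also have "\<dots> = (\<integral>\<^sup>+\<omega>\<in>E. (\<Prod>p\<in>I. edge_weight W (a p) (S' (fst p) \<omega>) (S' (snd p) \<omega>)) \<partial>M)"
      unfolding S'_def using distinct pickG E by (intro emeasure_random_entries[OF prob W rep I(1)])
    finally have nn: "emeasure M (E \<inter> ?F) = (\<integral>\<^sup>+\<omega>\<in>E. ennreal (?g \<omega>) \<partial>M)"
      by (simp only: g_ennreal)
    have "(\<integral>\<omega>\<in>E. indicator ?F \<omega> \<partial>M) = M.prob (E \<inter> ?F)"
      using E_M F by (simp add: set_lebesgue_integral_def indicator_inter_arith[symmetric])
    also have "\<dots> = enn2real (\<integral>\<^sup>+\<omega>. ennreal (indicator E \<omega> * ?g \<omega>) \<partial>M)"
    proof -
      have "ennreal (indicator E \<omega> * ?g \<omega>) = ennreal (?g \<omega>) * indicator E \<omega>" for \<omega>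
        by (auto simp: indicator_def)
      then show ?thesis unfolding measure_def nn by simp
    qed
    also have "\<dots> = (\<integral>\<omega>. indicator E \<omega> * ?g \<omega> \<partial>M)"
      using E_M g_M g_nonneg by (intro integral_eq_nn_integral[symmetric]) auto
    finally show "(\<integral>\<omega>\<in>E. indicator ?F \<omega> \<partial>M) = (\<integral>\<omega>\<in>E. ?g \<omega> \<partial>M)"
      by (simp add: set_lebesgue_integral_def)
  next
    show "integrable M (indicator ?F :: 'w \<Rightarrow> real)"
      using F by (intro integrable_real_indicator) (auto simp: M.emeasure_eq_measure)
  qed (fact g_int g_G')+
qed

text \<open>
  The law of the points is \<open>thinned_point_law\<close>, that of the matrix given the points is
  \<open>thinned_cond_exp\<close>, and \<open>adj_restrict_edge_sum\<close> identifies the process that they represent.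
\<close>

lemma iid_representation_thinned:
  fixes \<xi> :: "'w \<Rightarrow> ('s::polish_space \<times> 's \<times> bool) measure"
  assumes prob: "prob_space M" and iid: "iid_representation M (\<lambda>\<omega>. adj_restrict E (\<xi> \<omega>)) N S A"
    and sets: "\<And>\<omega>. \<omega> \<in> space M \<Longrightarrow> sets (\<xi> \<omega>) = sets adj_space"
    and E: "E \<in> sets borel" and D: "D \<in> sets borel"
    and pos: "\<And>k. emeasure (distr M borel (S 0)) (cell D k) \<noteq> 0"
  defines "J \<equiv> \<lambda>\<omega>. hits D (\<lambda>i. S i \<omega>)"
  shows "iid_representation M (\<lambda>\<omega>. adj_restrict (E \<inter> cell D k) (\<xi> \<omega>))
    (\<lambda>\<omega>. pick_count (J \<omega>) k (N \<omega>)) (\<lambda>i \<omega>. S (pick (J \<omega>) k i) \<omega>)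
    (\<lambda>\<omega> (i, j). A \<omega> (pick (J \<omega>) k i, pick (J \<omega>) k j))"
proof -
  interpret M: prob_space M by fact
  obtain W where W: "connection_function W"
    and rep: "representation M W (\<lambda>\<omega>. adj_restrict E (\<xi> \<omega>)) N S A"
    using iid unfolding iid_representation_def by blast
  note N = representation_count[OF rep] and S = representation_point[OF rep]
  let ?\<sigma> = "distr M borel (S 0)"
  have \<sigma>: "prob_space ?\<sigma>" using S by (rule M.prob_space_distr)
  let ?N' = "\<lambda>\<omega>. pick_count (J \<omega>) k (N \<omega>)" and ?S' = "\<lambda>i \<omega>. S (pick (J \<omega>) k i) \<omega>"
  let ?A' = "\<lambda>\<omega> (i, j). A \<omega> (pick (J \<omega>) k i, pick (J \<omega>) k j)"
  let ?u = "uniform_measure ?\<sigma> (cell D k)"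
  have seq: "(\<lambda>\<omega> i. S i \<omega>) \<in> M \<rightarrow>\<^sub>M seq_law borel"
    by (rule measurable_seqI) (rule S)
  have J: "J \<in> M \<rightarrow>\<^sub>M bool_cube"
    unfolding J_def using seq measurable_hits[OF D] by (rule measurable_compose)
  have pick: "(\<lambda>\<omega>. pick (J \<omega>) k i) \<in> M \<rightarrow>\<^sub>M count_space UNIV" for i
    using J measurable_pick by (rule measurable_compose)
  have N': "?N' \<in> M \<rightarrow>\<^sub>M count_space UNIV"
    using J N by (rule measurable_pick_count)
  have S': "?S' i \<in> M \<rightarrow>\<^sub>M borel" for i
    by (rule measurable_compose_countable[OF S pick])
  have seq': "(\<lambda>\<omega> i. ?S' i \<omega>) \<in> M \<rightarrow>\<^sub>M seq_law borel"
    by (rule measurable_seqI) (rule S')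
  have A': "(\<lambda>\<omega>. ?A' \<omega> p) \<in> M \<rightarrow>\<^sub>M count_space UNIV" for p
  proof (cases p)
    case (Pair i j)
    then show ?thesis
      using measurable_compose_countable[OF measurable_compose_countable[OF representation_entry[OF rep] pick[of j]] pick[of i]]
      by simp
  qed
  have "representation M W (\<lambda>\<omega>. adj_restrict (E \<inter> cell D k) (\<xi> \<omega>)) ?N' ?S' ?A'"
    unfolding representation_def
  proof (intro conjI allI impI)
    show "AE \<omega> in M. inj (\<lambda>i. ?S' i \<omega>)"
      using representation_inj[OF rep]
    proof eventually_elim
      case (elim \<omega>)
      show ?case
      proof (rule injI)
        fix i j assume "S (pick (J \<omega>) k i) \<omega> = S (pick (J \<omega>) k j) \<omega>"
        from injD[OF elim this] show "i = j" by simp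
      qed
    qed
    show "AE \<omega> in M. \<forall>i. \<not> ?A' \<omega> (i, i)" "AE \<omega> in M. \<forall>i j. ?A' \<omega> (j, i) = ?A' \<omega> (i, j)"
      using representation_hollow_symmetric[OF rep]
      by (eventually_elim, simp add: hollow_symmetric_def)+
    fix I :: "(nat \<times> nat) set" and a assume "finite I" "I \<subseteq> {(i, j). i < j}"
    with prob W rep D show "AE \<omega> in M. real_cond_exp M (point_algebra M ?N' ?S')
        (indicator {\<omega>\<in>space M. \<forall>p\<in>I. ?A' \<omega> p = a p}) \<omega> =
      (\<Prod>(i, j)\<in>I. pmf (bernoulli_pmf (W (?S' i \<omega>, ?S' j \<omega>))) (a (i, j)))"
      unfolding J_def by (rule thinned_cond_exp)
  next
    show "AE \<omega> in M. adj_restrict (E \<inter> cell D k) (\<xi> \<omega>) =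
      distr (count_space {(i, j). enat i < ?N' \<omega> \<and> enat j < ?N' \<omega>}) adj_space
        (\<lambda>(i, j). (?S' i \<omega>, ?S' j \<omega>, ?A' \<omega> (i, j)))"
      using representation_edge_sum[OF rep] AE_both_infinite_hits[OF prob iid D pos] AE_space
    proof eventually_elim
      case (elim \<omega>)
      have "adj_restrict (E \<inter> cell D k) (\<xi> \<omega>) = adj_restrict (cell D k) (adj_restrict E (\<xi> \<omega>))"
        using sets[OF elim(3)] E measurable_cell[OF D] by (rule adj_restrict_adj_restrict[symmetric])
      also have "\<dots> = edge_sum (?N' \<omega>) (\<lambda>i. ?S' i \<omega>) (?A' \<omega>)"
        unfolding elim(1) J_def using D elim(2) by (rule adj_restrict_edge_sum)
      finally show ?case by (simp only: edge_sum_def)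
    qed
  qed (fact N' S' A')+
  moreover have joint: "distr M (count_space UNIV \<Otimes>\<^sub>M seq_law borel) (\<lambda>\<omega>. (?N' \<omega>, \<lambda>i. ?S' i \<omega>)) =
      distr M (count_space UNIV) ?N' \<Otimes>\<^sub>M seq_law ?u"
    unfolding J_def using prob iid D pos by (rule thinned_point_law)
  have u: "prob_space ?u"
    using pos by (rule prob_space_uniform_measure)
      (use prob_space.finite_measure[OF \<sigma>] finite_measure.emeasure_finite in auto)
  have sets_u: "sets (seq_law ?u) = sets (seq_law (borel :: 's measure))"
    by (intro sets_PiM_cong) simp_all
  have law: "distr M (seq_law borel) (\<lambda>\<omega> i. ?S' i \<omega>) = seq_law ?u"
  proof -
    have "distr M (seq_law borel) (\<lambda>\<omega> i. ?S' i \<omega>) =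
        distr (distr M (count_space UNIV \<Otimes>\<^sub>M seq_law borel) (\<lambda>\<omega>. (?N' \<omega>, \<lambda>i. ?S' i \<omega>))) (seq_law borel) snd"
      using distr_distr[OF measurable_snd measurable_Pair[OF N' seq']] by (simp add: comp_def)
    also have "\<dots> = distr (distr M (count_space UNIV) ?N' \<Otimes>\<^sub>M seq_law ?u) (seq_law ?u) snd"
      unfolding joint using sets_u by (intro distr_cong) simp_all
    also have "\<dots> = seq_law ?u"
      by (rule distr_pair_snd[OF M.prob_space_distr[OF N'] prob_space_seq_law[OF u]])
    finally show ?thesis .
  qed
  have component: "distr M borel (?S' i) = ?u" for i
  proof -
    have "distr M borel (?S' i) = distr (distr M (seq_law borel) (\<lambda>\<omega> i. ?S' i \<omega>)) borel (\<lambda>s. s i)"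
      using distr_distr[OF measurable_seq_component[of i borel] seq'] by (simp add: comp_def)
    also have "\<dots> = distr (seq_law ?u) ?u (\<lambda>s. s i)"
      unfolding law by (intro distr_cong) simp_all
    also have "\<dots> = ?u"
      using distr_PiM_component[of "UNIV :: nat set" "\<lambda>_. ?u" i] u by simp
    finally show ?thesis .
  qed
  have "M.indep_vars (\<lambda>_. borel) ?S' UNIV"
  proof -
    have "distr M (seq_law borel) (\<lambda>\<omega>. \<lambda>i\<in>UNIV. ?S' i \<omega>) = (\<Pi>\<^sub>M i\<in>UNIV. distr M borel (?S' i))"
      unfolding component restrict_UNIV by (rule law)
    then show ?thesis
      using M.indep_vars_iff_distr_eq_PiM'[where I=UNIV and M'="\<lambda>_. borel" and X="?S'"] S' by blast
  qed
  moreover have "M.indep_set (sets (vimage_algebra (space M) ?N' (count_space UNIV)))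
      (sets (vimage_algebra (space M) (\<lambda>\<omega> i. ?S' i \<omega>) (seq_law borel)))"
    unfolding M.indep_set_vimage_iff_distr_eq[OF N' seq'] law by (rule joint)
  ultimately show ?thesis
    unfolding iid_representation_def component using W by blast
qed

section \<open>The block between the two sides\<close>

text \<open>
  A pattern has as probability an integral of edge weights over a pair of independent i.i.d.
  sequences, one for the rows and one for the columns, and each of them may be reordered.
  Symmetry of the matrix imposes nothing on this block, as the two index sets are disjoint.
\<close>

lemma separately_exchangeable_cross_block:
  fixes S :: "nat \<Rightarrow> 'w \<Rightarrow> 's::polish_space"
  assumes prob: "prob_space M" and iid: "iid_representation M \<xi> N S A" and D: "D \<in> sets borel"
    and pos: "\<And>k. emeasure (distr M borel (S 0)) (cell D k) \<noteq> 0"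
  defines "J \<equiv> \<lambda>\<omega>. hits D (\<lambda>i. S i \<omega>)"
  shows "separately_exchangeable M (\<lambda>\<omega> (i, j). A \<omega> (pick (J \<omega>) True i, pick (J \<omega>) False j))"
proof -
  interpret M: prob_space M by fact
  obtain W where W: "connection_function W" and rep: "representation M W \<xi> N S A"
    using iid unfolding iid_representation_def by blast
  note N = representation_count[OF rep] and S = representation_point[OF rep]
  let ?\<sigma> = "distr M borel (S 0)"
  have \<sigma>: "prob_space ?\<sigma>" using S by (rule M.prob_space_distr)
  interpret P: prob_space "seq_law ?\<sigma>" using \<sigma> by (rule prob_space_seq_law)
  define \<rho> where "\<rho> k = seq_law (uniform_measure ?\<sigma> (cell D k))" for k
  have u: "prob_space (uniform_measure ?\<sigma> (cell D k))" for k
    using pos by (rule prob_space_uniform_measure)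
      (use prob_space.finite_measure[OF \<sigma>] finite_measure.emeasure_finite in auto)
  have \<rho>: "prob_space (\<rho> k)" for k unfolding \<rho>_def using u by (rule prob_space_seq_law)
  interpret RT: prob_space "\<rho> True" by (rule \<rho>)
  interpret RF: prob_space "\<rho> False" by (rule \<rho>)
  interpret R: pair_prob_space "\<rho> True" "\<rho> False" ..
  let ?Q = "\<rho> True \<Otimes>\<^sub>M \<rho> False"
  have sets_P: "sets (seq_law ?\<sigma>) = sets (seq_law borel)"
    by (intro sets_PiM_cong) simp_all
  have sets_\<rho>: "sets (\<rho> k) = sets (seq_law borel)" for k
    unfolding \<rho>_def by (intro sets_PiM_cong) simp_all
  have seq: "(\<lambda>\<omega> i. S i \<omega>) \<in> M \<rightarrow>\<^sub>M seq_law borel"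
    by (rule measurable_seqI) (rule S)
  have hits: "hits D \<in> seq_law borel \<rightarrow>\<^sub>M bool_cube" using D by (rule measurable_hits)
  have J: "J \<in> M \<rightarrow>\<^sub>M bool_cube"
    unfolding J_def using seq hits by (rule measurable_compose)
  have SG: "(\<lambda>\<omega> i. S i \<omega>) \<in> point_algebra M N S \<rightarrow>\<^sub>M seq_law borel"
    by (rule point_algebra_points[OF N S])
  have pickG: "(\<lambda>\<omega>. pick (J \<omega>) k i) \<in> point_algebra M N S \<rightarrow>\<^sub>M count_space UNIV" for k i
    unfolding J_def by (rule measurable_compose[OF measurable_compose[OF SG hits] measurable_pick])
  have pick_M: "(\<lambda>\<omega>. pick (J \<omega>) k i) \<in> M \<rightarrow>\<^sub>M count_space UNIV" for k i
    using J measurable_pick by (rule measurable_compose)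
  define X where "X \<pi> \<tau> \<omega> = (\<lambda>(i, j). A \<omega> (pick (J \<omega>) True (\<pi> i), pick (J \<omega>) False (\<tau> j)))"
    for \<pi> \<tau> :: "nat \<Rightarrow> nat" and \<omega>
  have X: "X \<pi> \<tau> \<in> M \<rightarrow>\<^sub>M matrix_space" for \<pi> \<tau>
  proof (rule measurable_bool_cubeI)
    fix p :: "nat \<times> nat"
    show "(\<lambda>\<omega>. X \<pi> \<tau> \<omega> p) \<in> M \<rightarrow>\<^sub>M count_space UNIV"
      unfolding X_def split_beta
      by (rule measurable_compose_countable[OF measurable_compose_countable[OF representation_entry[OF rep] pick_M] pick_M])
  qed
  define split where "split s = (hits D s, \<lambda>i. s (pick (hits D s) True i), \<lambda>i. s (pick (hits D s) False i))"
    for s :: "nat \<Rightarrow> 's"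
  have split: "split \<in> seq_law ?\<sigma> \<rightarrow>\<^sub>M bool_cube \<Otimes>\<^sub>M ?Q"
  proof -
    have "hits D \<in> seq_law ?\<sigma> \<rightarrow>\<^sub>M bool_cube"
      using hits measurable_cong_sets[OF sets_P refl] by blast
    moreover have "(\<lambda>s i. s (pick (hits D s) k i)) \<in> seq_law ?\<sigma> \<rightarrow>\<^sub>M \<rho> k" for k
      unfolding measurable_cong_sets[OF sets_P sets_\<rho>]
      by (rule measurable_pick_seq[OF hits measurable_ident_sets[OF refl]])
    ultimately show ?thesis unfolding split_def by (intro measurable_Pair)
  qed
  have split_law: "distr (seq_law ?\<sigma>) (bool_cube \<Otimes>\<^sub>M ?Q) split = distr (seq_law ?\<sigma>) bool_cube (hits D) \<Otimes>\<^sub>M ?Q"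
    unfolding split_def \<rho>_def using D pos by (intro seq_law_side(2) \<sigma>) simp_all
  have cyl: "emeasure M {\<omega>\<in>space M. \<forall>p\<in>I. X \<pi> \<tau> \<omega> p = x p} =
      (\<integral>\<^sup>+q. (\<Prod>p\<in>I. edge_weight W (x p) (fst q (fst p)) (snd q (snd p))) \<partial>?Q)"
    if I: "finite I" and inj: "inj \<pi>" "inj \<tau>" for I x \<pi> \<tau>
  proof -
    define \<Phi> where "\<Phi> \<pi> \<tau> q = (\<Prod>p\<in>I. edge_weight W (x p) (fst q (\<pi> (fst p))) (snd q (\<tau> (snd p))))"
      for \<pi> \<tau> :: "nat \<Rightarrow> nat" and q
    have \<Phi>: "\<Phi> \<pi> \<tau> \<in> borel_measurable ?Q" for \<pi> \<tau>
    proof -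
      have "(\<lambda>q. fst q i) \<in> ?Q \<rightarrow>\<^sub>M borel" "(\<lambda>q. snd q i) \<in> ?Q \<rightarrow>\<^sub>M borel" for i
      proof -
        have "(\<lambda>s. s i) \<in> \<rho> k \<rightarrow>\<^sub>M borel" for k
          unfolding measurable_cong_sets[OF sets_\<rho> refl] by (rule measurable_seq_component)
        then show "(\<lambda>q. fst q i) \<in> ?Q \<rightarrow>\<^sub>M borel" "(\<lambda>q. snd q i) \<in> ?Q \<rightarrow>\<^sub>M borel"
          by (rule measurable_compose[OF measurable_fst], rule measurable_compose[OF measurable_snd])
      qed
      then show ?thesis
        unfolding \<Phi>_def by (intro borel_measurable_prod_ennreal measurable_edge_weight[OF W])
    qed
    have \<Phi>_snd: "(\<lambda>z. \<Phi> \<pi> \<tau> (snd z)) \<in> borel_measurable (L \<Otimes>\<^sub>M ?Q)" for \<pi> \<tau> and L :: "'z measure"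
      using measurable_snd \<Phi> by (rule measurable_compose)
    have distinct: "distinct_pairs I (\<lambda>p. pick (J \<omega>) True (\<pi> (fst p))) (\<lambda>p. pick (J \<omega>) False (\<tau> (snd p)))" for \<omega>
      unfolding distinct_pairs_def inj_on_def
    proof (intro conjI ballI impI)
      fix p q :: "nat \<times> nat"
      assume "{pick (J \<omega>) True (\<pi> (fst p)), pick (J \<omega>) False (\<tau> (snd p))} =
        {pick (J \<omega>) True (\<pi> (fst q)), pick (J \<omega>) False (\<tau> (snd q))}"
      then have "\<pi> (fst p) = \<pi> (fst q)" "\<tau> (snd p) = \<tau> (snd q)"
        using pick_neq[of "J \<omega>"] by (auto simp: doubleton_eq_iff)
      then show "p = q" using inj by (auto dest: injD intro: prod_eqI)
    qed (rule pick_neq)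
    have top: "space M \<in> sets (point_algebra M N S)"
      using sets.top[of "point_algebra M N S"] by simp
    have "emeasure M {\<omega>\<in>space M. \<forall>p\<in>I. X \<pi> \<tau> \<omega> p = x p} =
        emeasure M {\<omega>\<in>space M. \<forall>p\<in>I. A \<omega> (pick (J \<omega>) True (\<pi> (fst p)), pick (J \<omega>) False (\<tau> (snd p))) = x p}"
      unfolding X_def split_beta ..
    also have "\<dots> = (\<integral>\<^sup>+\<omega>\<in>space M. (\<Prod>p\<in>I. edge_weight W (x p)
        (S (pick (J \<omega>) True (\<pi> (fst p))) \<omega>) (S (pick (J \<omega>) False (\<tau> (snd p))) \<omega>)) \<partial>M)"
      using distinct pickG top by (intro emeasure_random_entries[OF prob W rep I])
    also have "\<dots> = (\<integral>\<^sup>+\<omega>. \<Phi> \<pi> \<tau> (snd (split (\<lambda>i. S i \<omega>))) \<partial>M)"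
      by (intro nn_integral_cong) (simp add: \<Phi>_def split_def J_def)
    also have "\<dots> = (\<integral>\<^sup>+s. \<Phi> \<pi> \<tau> (snd (split s)) \<partial>distr M (seq_law borel) (\<lambda>\<omega> i. S i \<omega>))"
    proof -
      have "split \<in> seq_law borel \<rightarrow>\<^sub>M bool_cube \<Otimes>\<^sub>M ?Q"
        using split measurable_cong_sets[OF sets_P refl] by blast
      from nn_integral_distr_cod[OF seq measurable_compose[OF this \<Phi>_snd]] show ?thesis by (simp only:)
    qed
    also have "\<dots> = (\<integral>\<^sup>+s. \<Phi> \<pi> \<tau> (snd (split s)) \<partial>seq_law ?\<sigma>)"
      by (simp only: iid_representation_law(2)[OF prob iid])
    also have "\<dots> = (\<integral>\<^sup>+z. \<Phi> \<pi> \<tau> (snd z) \<partial>distr (seq_law ?\<sigma>) (bool_cube \<Otimes>\<^sub>M ?Q) split)"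
      using nn_integral_distr_cod[OF split \<Phi>_snd] by (simp only:)
    also have "\<dots> = (\<integral>\<^sup>+z. \<Phi> \<pi> \<tau> (snd z) \<partial>(distr (seq_law ?\<sigma>) bool_cube (hits D) \<Otimes>\<^sub>M ?Q))"
      by (simp only: split_law)
    also have "\<dots> = (\<integral>\<^sup>+q. \<Phi> \<pi> \<tau> q \<partial>?Q)"
    proof -
      have "hits D \<in> seq_law ?\<sigma> \<rightarrow>\<^sub>M bool_cube"
        using hits measurable_cong_sets[OF sets_P refl] by blast
      then have "prob_space (distr (seq_law ?\<sigma>) bool_cube (hits D))" by (rule P.prob_space_distr)
      note snd = distr_pair_snd[OF this R.prob_space_axioms]
      show ?thesis
        using nn_integral_distr_cod[OF measurable_snd \<Phi>, of "distr (seq_law ?\<sigma>) bool_cube (hits D)" \<pi> \<tau>]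
        unfolding snd by simp
    qed
    also have "\<dots> = (\<integral>\<^sup>+q. \<Phi> (\<lambda>i. i) (\<lambda>i. i) q \<partial>?Q)"
    proof -
      have meas: "(\<lambda>s i. s (f i)) \<in> \<rho> k \<rightarrow>\<^sub>M \<rho> k" for f :: "nat \<Rightarrow> nat" and k
        unfolding measurable_cong_sets[OF sets_\<rho> sets_\<rho>] by (intro measurable_seqI measurable_seq_component)
      let ?r = "\<lambda>(x :: nat \<Rightarrow> 's, y :: nat \<Rightarrow> 's). (\<lambda>i. x (\<pi> i), \<lambda>i. y (\<tau> i))"
      have reindex: "distr (\<rho> k) (\<rho> k) (\<lambda>s i. s (f i)) = \<rho> k" if "inj f" for k f
        unfolding \<rho>_def using u that by (rule distr_seq_law_reindex)
      have r: "?r \<in> ?Q \<rightarrow>\<^sub>M ?Q"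
        unfolding split_beta'
        by (intro measurable_Pair measurable_compose[OF measurable_fst meas] measurable_compose[OF measurable_snd meas])
      have "distr ?Q ?Q ?r = ?Q"
        using pair_measure_distr[OF meas[of \<pi> True] meas[of \<tau> False]]
        by (simp only: reindex[OF inj(1)] reindex[OF inj(2)] RF.sigma_finite_measure_axioms)
      then have "(\<integral>\<^sup>+q. \<Phi> (\<lambda>i. i) (\<lambda>i. i) q \<partial>?Q) = (\<integral>\<^sup>+q. \<Phi> (\<lambda>i. i) (\<lambda>i. i) (?r q) \<partial>?Q)"
        using nn_integral_distr_cod[OF r \<Phi>[of "\<lambda>i. i" "\<lambda>i. i"]] by simp
      also have "\<dots> = (\<integral>\<^sup>+q. \<Phi> \<pi> \<tau> q \<partial>?Q)"
        by (intro nn_integral_cong) (simp add: \<Phi>_def split_beta)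
      finally show ?thesis ..
    qed
    finally show ?thesis by (simp only: \<Phi>_def)
  qed
  have law: "distr M matrix_space (X \<pi> \<tau>) = distr M matrix_space (X (\<lambda>i. i) (\<lambda>i. i))"
    if "inj \<pi>" "inj \<tau>" for \<pi> \<tau>
  proof (rule bool_cube_measure_eqI)
    show "finite_measure (distr M matrix_space (X \<pi> \<tau>))" using X by (rule M.finite_measure_distr)
    fix I :: "(nat \<times> nat) set" and x :: "nat \<times> nat \<Rightarrow> bool" assume I: "finite I"
    show "emeasure (distr M matrix_space (X \<pi> \<tau>)) {y. \<forall>p\<in>I. y p = x p} =
        emeasure (distr M matrix_space (X (\<lambda>i. i) (\<lambda>i. i))) {y. \<forall>p\<in>I. y p = x p}"
      using cyl[OF I that, of x] cyl[OF I inj_on_id2 inj_on_id2, of x]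
      by (simp only: emeasure_distr_cylinder[OF X I])
  qed simp_all
  have "X (\<lambda>i. i) (\<lambda>i. i) = (\<lambda>\<omega> (i, j). A \<omega> (pick (J \<omega>) True i, pick (J \<omega>) False j))"
    by (simp add: X_def fun_eq_iff)
  moreover have "separately_exchangeable M (X (\<lambda>i. i) (\<lambda>i. i))"
    unfolding separately_exchangeable_def
  proof (intro conjI allI impI)
    fix \<pi> \<tau> assume "finite_permutation \<pi>" "finite_permutation \<tau>"
    then have inj: "inj \<pi>" "inj \<tau>" by (auto simp: finite_permutation_def bij_is_inj)
    have "(\<lambda>\<omega> (i, j). X (\<lambda>i. i) (\<lambda>i. i) \<omega> (\<pi> i, \<tau> j)) = X \<pi> \<tau>"
      by (simp add: X_def fun_eq_iff)
    then show "distr M matrix_space (\<lambda>\<omega> (i, j). X (\<lambda>i. i) (\<lambda>i. i) \<omega> (\<pi> i, \<tau> j)) =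
        distr M matrix_space (X (\<lambda>i. i) (\<lambda>i. i))"
      using law[OF inj] by (simp only:)
  qed (rule X)
  ultimately show ?thesis by (simp only:)
qed

lemma separately_exchangeable_cong_law:
  assumes Y: "separately_exchangeable M Y" and X: "X \<in> M \<rightarrow>\<^sub>M matrix_space"
    and law: "distr M matrix_space X = distr M matrix_space Y"
  shows "separately_exchangeable M X"
  unfolding separately_exchangeable_def
proof (intro conjI allI impI)
  fix \<pi> \<sigma> :: "nat \<Rightarrow> nat" assume fin: "finite_permutation \<pi>" "finite_permutation \<sigma>"
  define permute where "permute = (\<lambda>X (i, j). X (\<pi> i, \<sigma> j) :: bool)"
  have permute: "permute \<in> matrix_space \<rightarrow>\<^sub>M matrix_space"
    unfolding permute_def by (rule measurable_reindex_matrix)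
  have Y_meas: "Y \<in> M \<rightarrow>\<^sub>M matrix_space" using Y by (simp add: separately_exchangeable_def)
  have "distr M matrix_space (\<lambda>\<omega>. permute (X \<omega>)) = distr M matrix_space (\<lambda>\<omega>. permute (Y \<omega>))"
    using distr_distr[OF permute X] distr_distr[OF permute Y_meas] law by (simp only: comp_def)
  also have "\<dots> = distr M matrix_space Y"
    using Y fin by (simp add: separately_exchangeable_def permute_def)
  finally show "distr M matrix_space (\<lambda>\<omega> (i, j). X \<omega> (\<pi> i, \<sigma> j)) = distr M matrix_space X"
    by (simp add: law permute_def)
qed (rule X)

section \<open>The number of points and their law\<close>

lemma sigma_finite_simple_measure:
  fixes m :: "'s::polish_space measure"
  assumes "simple_measure borel bounded m"
  shows "sigma_finite_measure m"
proof
  have sets: "sets m = sets borel" using assms by (auto simp: simple_measure_def)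
  fix x0 :: 's
  let ?balls = "range (\<lambda>n. cball x0 (real n))"
  have "\<Union>?balls = UNIV"
  proof (intro equalityI subset_UNIV subsetI)
    fix x
    obtain n where "dist x0 x \<le> real n" using real_arch_simple by blast
    then show "x \<in> \<Union>?balls" by auto
  qed
  moreover have "emeasure m (cball x0 (real n)) \<noteq> \<infinity>" for n
    using assms by (auto simp: simple_measure_def less_top)
  ultimately show "\<exists>A. countable A \<and> A \<subseteq> sets m \<and> \<Union>A = space m \<and> (\<forall>a\<in>A. emeasure m a \<noteq> \<infinity>)"
    using sets sets_eq_imp_space_eq[OF sets] by (intro exI[of _ ?balls]) auto
qed

lemma
  fixes \<xi> :: "('s::polish_space \<times> 's \<times> bool) measure"
  assumes "directed_by \<xi> \<nu>"
  shows sets_directed_by: "sets \<xi> = sets adj_space"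
    and emeasure_directed_by_square:
      "B \<in> sets borel \<Longrightarrow> emeasure \<xi> (B \<times> B \<times> UNIV) = emeasure \<nu> B * emeasure \<nu> B"
proof -
  show "sets \<xi> = sets adj_space"
    using assms by (auto simp: directed_by_def simple_measure_def)
  assume B: "B \<in> sets borel"
  have simple: "simple_measure borel bounded \<nu>" using assms by (simp add: directed_by_def)
  then have sets: "sets \<nu> = sets borel" by (auto simp: simple_measure_def)
  interpret sigma_finite_measure \<nu> using simple by (rule sigma_finite_simple_measure)
  have "B \<times> B \<in> sets (borel \<Otimes>\<^sub>M borel)" using B by (intro pair_measureI)
  then have "emeasure \<xi> {(x, y, a). (x, y) \<in> B \<times> B} = emeasure (\<nu> \<Otimes>\<^sub>M \<nu>) (B \<times> B)"
    using assms unfolding directed_by_def by blast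
  also have "\<dots> = emeasure \<nu> B * emeasure \<nu> B"
    using B sets by (intro emeasure_pair_measure_Times) simp_all
  also have "{(x, y, a). (x, y) \<in> B \<times> B} = B \<times> B \<times> (UNIV :: bool set)" by auto
  finally show "emeasure \<xi> (B \<times> B \<times> UNIV) = emeasure \<nu> B * emeasure \<nu> B" .
qed

lemma emeasure_edge_sum_UNIV:
  "emeasure (edge_sum N s a) UNIV = emeasure (count_space UNIV) {i. enat i < N} * emeasure (count_space UNIV) {i. enat i < N}"
proof (cases N)
  case (enat n)
  have "{(i, j). enat i < N \<and> enat j < N \<and> (s i, s j, a (i, j)) \<in> UNIV} = {..<n} \<times> {..<n}"
    "{i. enat i < N} = {..<n}"
    by (auto simp: enat)
  moreover have "UNIV \<in> sets (adj_space :: ('a \<times> 'a \<times> bool) measure)"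
    using sets.top[of "adj_space :: ('a \<times> 'a \<times> bool) measure"] by (simp add: space_pair_measure)
  ultimately show ?thesis
    by (simp add: emeasure_edge_sum emeasure_count_space_finite card_cartesian_product)
next
  case infinity
  have "{(i, j). enat i < N \<and> enat j < N \<and> (s i, s j, a (i, j)) \<in> UNIV} = UNIV"
    "{i. enat i < N} = UNIV"
    by (auto simp: infinity)
  moreover have "UNIV \<in> sets (adj_space :: ('a \<times> 'a \<times> bool) measure)"
    using sets.top[of "adj_space :: ('a \<times> 'a \<times> bool) measure"] by (simp add: space_pair_measure)
  ultimately show ?thesis
    by (simp add: emeasure_edge_sum finite_prod)
qed

text \<open>
  The total mass of the restriction is the square of the number of points, for \<open>\<nu>\<close> as well as for the
  representation.
\<close>

lemma directed_count_eq:
  fixes \<xi> :: "('s::polish_space \<times> 's \<times> bool) measure"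
  assumes dir: "directed_by \<xi> \<nu>" and B: "B \<in> sets borel"
    and eq: "adj_restrict B \<xi> = edge_sum N s a" and n: "emeasure \<nu> B = of_nat n"
  shows "N = enat n"
proof -
  note sets = sets_directed_by[OF dir]
  have top: "UNIV \<in> sets (adj_space :: ('s \<times> 's \<times> bool) measure)"
    using sets.top[of "adj_space :: ('s \<times> 's \<times> bool) measure"] by (simp add: space_pair_measure)
  have "emeasure (adj_restrict B \<xi>) UNIV = of_nat n * of_nat n"
    using emeasure_adj_restrict[OF sets B top] emeasure_directed_by_square[OF dir B] n by simp
  then have square: "emeasure (count_space UNIV) {i. enat i < N} * emeasure (count_space UNIV) {i. enat i < N} =
      of_nat n * of_nat n"
    unfolding eq emeasure_edge_sum_UNIV .
  show ?thesis
  proof (cases N)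
    case (enat m)
    have "{i. enat i < N} = {..<m}" by (auto simp: enat)
    then have "(of_nat (m * m) :: ennreal) = of_nat (n * n)"
      using square by (simp add: emeasure_count_space_finite)
    then have "m * m = n * n" by (simp only: of_nat_eq_iff)
    then have "m = n" by (metis power2_eq_square power2_eq_imp_eq zero_le)
    then show ?thesis by (simp add: enat)
  next
    case infinity
    then have "{i. enat i < N} = UNIV" by auto
    then have "(\<top> :: ennreal) = of_nat (n * n)"
      using square by (simp add: ennreal_mult_top)
    then show ?thesis by (metis ennreal_of_nat_neq_top)
  qed
qed

lemma measure_eq_0_AE:
  assumes "AE \<omega> in M. \<omega> \<notin> F"
  shows "measure M F = 0"
proof (cases "F \<in> sets M")
  case True
  then have "emeasure M F = emeasure M {}"
    using assms by (intro emeasure_eq_AE) auto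
  then show ?thesis by (simp add: measure_def)
qed (rule measure_notin_sets)

lemma emeasure_count_pos:
  fixes \<xi> :: "'w \<Rightarrow> ('s::polish_space \<times> 's \<times> bool) measure"
  assumes "prob_space M" and dir: "\<forall>\<omega>\<in>space M. directed_by (\<xi> \<omega>) (\<nu> \<omega>)" and B: "B \<in> sets borel"
    and rep: "representation M W (\<lambda>\<omega>. adj_restrict B (\<xi> \<omega>)) N S A"
    and pos: "measure M {\<omega>\<in>space M. emeasure (\<nu> \<omega>) B = of_nat n} > 0"
  shows "emeasure M {\<omega>\<in>space M. N \<omega> = enat n} \<noteq> 0"
proof
  interpret M: prob_space M by fact
  assume "emeasure M {\<omega>\<in>space M. N \<omega> = enat n} = 0"
  moreover have "{\<omega>\<in>space M. N \<omega> = enat n} \<in> sets M"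
  proof -
    note [measurable] = representation_count[OF rep]
    show ?thesis by measurable
  qed
  ultimately have "AE \<omega> in M. \<omega> \<notin> {\<omega>\<in>space M. N \<omega> = enat n}"
    by (intro AE_not_in) (auto simp: null_sets_def)
  then have "AE \<omega> in M. \<omega> \<notin> {\<omega>\<in>space M. emeasure (\<nu> \<omega>) B = of_nat n}"
    using representation_edge_sum[OF rep] AE_space
  proof eventually_elim
    case (elim \<omega>)
    then show ?case using directed_count_eq[of "\<xi> \<omega>" "\<nu> \<omega>" B] dir B by auto
  qed
  then have "measure M {\<omega>\<in>space M. emeasure (\<nu> \<omega>) B = of_nat n} = 0"
    by (rule measure_eq_0_AE)
  with pos show False by simp
qed

text \<open>
  Otherwise almost surely no point of the representation would lie in \<open>B\<close>, and then \<open>\<nu>\<close> would have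
  no mass there.
\<close>

lemma emeasure_point_law_pos:
  fixes \<xi> :: "'w \<Rightarrow> ('s::polish_space \<times> 's \<times> bool) measure"
  assumes prob: "prob_space M" and dir: "\<forall>\<omega>\<in>space M. directed_by (\<xi> \<omega>) (\<nu> \<omega>)"
    and E: "E \<in> sets borel" and B: "B \<in> sets borel" "B \<subseteq> E"
    and iid: "iid_representation M (\<lambda>\<omega>. adj_restrict E (\<xi> \<omega>)) N S A"
    and pos: "measure M {\<omega>\<in>space M. emeasure (\<nu> \<omega>) B = of_nat n} > 0" and n: "n \<noteq> 0"
  shows "emeasure (distr M borel (S 0)) B \<noteq> 0"
proof
  interpret M: prob_space M by fact
  obtain W where rep: "representation M W (\<lambda>\<omega>. adj_restrict E (\<xi> \<omega>)) N S A"
    using iid unfolding iid_representation_def by blast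
  assume null: "emeasure (distr M borel (S 0)) B = 0"
  have "AE \<omega> in M. S i \<omega> \<notin> B" for i
  proof -
    have "distr M borel (S i) = distr M borel (S 0)"
      using iid unfolding iid_representation_def by blast
    then have "AE x in distr M borel (S i). x \<notin> B"
      using null B(1) by (intro AE_not_in) (auto simp: null_sets_def)
    then show ?thesis by (rule AE_distrD[OF representation_point[OF rep]])
  qed
  then have "AE \<omega> in M. \<forall>i. S i \<omega> \<notin> B" by (simp add: AE_all_countable)
  then have "AE \<omega> in M. \<omega> \<notin> {\<omega>\<in>space M. emeasure (\<nu> \<omega>) B = of_nat n}"
    using representation_edge_sum[OF rep] AE_space
  proof eventually_elim
    case (elim \<omega>)
    have dir': "directed_by (\<xi> \<omega>) (\<nu> \<omega>)" using dir elim(3) by blast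
    have B3: "B \<times> B \<times> UNIV \<in> sets (adj_space :: ('s \<times> 's \<times> bool) measure)"
      by (intro pair_measureI B) simp_all
    have "emeasure (\<nu> \<omega>) B * emeasure (\<nu> \<omega>) B = emeasure (\<xi> \<omega>) (E \<times> E \<times> UNIV \<inter> B \<times> B \<times> UNIV)"
    proof -
      have "E \<times> E \<times> UNIV \<inter> B \<times> B \<times> UNIV = B \<times> B \<times> (UNIV :: bool set)" using B(2) by auto
      then show ?thesis using emeasure_directed_by_square[OF dir' B(1)] by simp
    qed
    also have "\<dots> = emeasure (edge_sum (N \<omega>) (\<lambda>i. S i \<omega>) (A \<omega>)) (B \<times> B \<times> UNIV)"
      using emeasure_adj_restrict[OF sets_directed_by[OF dir'] E B3] elim(2) by simp
    also have "\<dots> = 0"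
    proof -
      have "{(i, j). enat i < N \<omega> \<and> enat j < N \<omega> \<and> (S i \<omega>, S j \<omega>, A \<omega> (i, j)) \<in> B \<times> B \<times> UNIV} = {}"
        using elim(1) by auto
      then show ?thesis by (simp only: emeasure_edge_sum[OF B3] emeasure_empty)
    qed
    finally have "emeasure (\<nu> \<omega>) B = 0" by simp
    with n show ?case by simp
  qed
  then have "measure M {\<omega>\<in>space M. emeasure (\<nu> \<omega>) B = of_nat n} = 0"
    by (rule measure_eq_0_AE)
  with pos show False by simp
qed

text \<open>
  Write \<open>A'\<close> and \<open>J\<close> into one sequence \<open>Z\<close> of bits and represent its law by a uniform variable. Reading off
  the matrix from this representation gives a representation of the law of \<open>A\<close>, which is realised
  almost surely on \<open>M\<close>; reading off the labels gives \<open>I\<close>.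
\<close>

lemma realised_pair:
  fixes A A' :: "'w \<Rightarrow> nat \<times> nat \<Rightarrow> bool" and J :: "'w \<Rightarrow> nat \<Rightarrow> bool"
  assumes "prob_space M" and rich: "realises_representations M matrix_space A"
    and A: "A \<in> M \<rightarrow>\<^sub>M matrix_space" and A': "A' \<in> M \<rightarrow>\<^sub>M matrix_space" and J: "J \<in> M \<rightarrow>\<^sub>M bool_cube"
    and law: "distr M matrix_space A = distr M matrix_space A'"
  obtains I where "I \<in> M \<rightarrow>\<^sub>M bool_cube"
    and "distr M (matrix_space \<Otimes>\<^sub>M bool_cube) (\<lambda>\<omega>. (A \<omega>, I \<omega>)) =
      distr M (matrix_space \<Otimes>\<^sub>M bool_cube) (\<lambda>\<omega>. (A' \<omega>, J \<omega>))"
proof -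
  interpret M: prob_space M by fact
  \<comment> \<open>\<open>sum_encode\<close> interleaves the entries of the matrix with the labels.\<close>
  define Z where "Z \<omega> k = (case sum_decode k of Inl m \<Rightarrow> A' \<omega> (prod_decode m) | Inr i \<Rightarrow> J \<omega> i)" for \<omega> k
  define mat where "mat z p = z (sum_encode (Inl (prod_encode p)))" for z :: "nat \<Rightarrow> bool" and p
  define lab where "lab z i = z (sum_encode (Inr i))" for z :: "nat \<Rightarrow> bool" and i
  have Z: "Z \<in> M \<rightarrow>\<^sub>M bool_cube"
  proof (rule measurable_bool_cubeI)
    fix k
    show "(\<lambda>\<omega>. Z \<omega> k) \<in> M \<rightarrow>\<^sub>M count_space UNIV"
      unfolding Z_def using measurable_bool_cubeD[OF A'] measurable_bool_cubeD[OF J]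
      by (cases "sum_decode k") simp_all
  qed
  have mat: "mat \<in> bool_cube \<rightarrow>\<^sub>M matrix_space"
    unfolding mat_def by (intro measurable_bool_cubeI measurable_component_singleton UNIV_I)
  have lab: "lab \<in> bool_cube \<rightarrow>\<^sub>M bool_cube"
    unfolding lab_def by (intro measurable_bool_cubeI measurable_component_singleton UNIV_I)
  have mat_Z: "mat (Z \<omega>) = A' \<omega>" and lab_Z: "lab (Z \<omega>) = J \<omega>" for \<omega>
    by (simp_all add: mat_def lab_def Z_def fun_eq_iff)
  let ?u = "uniform_measure lborel {0..1::real}"
  let ?U = "\<Pi>\<^sub>M k\<in>(UNIV :: nat set). ?u"
  have u: "prob_space ?u" by (rule prob_space_uniform_measure) auto
  obtain f where f: "f \<in> borel \<rightarrow>\<^sub>M bool_cube" and f_law: "distr ?u bool_cube f = distr M bool_cube Z"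
    using bool_seq_law_from_uniform[OF M.prob_space_distr[OF Z]] by (auto simp: sets_distr)
  have f': "f \<in> ?u \<rightarrow>\<^sub>M bool_cube"
    using f measurable_cong_sets[of ?u borel bool_cube bool_cube] by simp
  have coord: "(\<lambda>v. v 0) \<in> ?U \<rightarrow>\<^sub>M ?u" by (rule measurable_component_singleton) simp
  have digits_law: "distr ?U bool_cube (\<lambda>v. f (v 0)) = distr M bool_cube Z"
  proof -
    have "distr ?U bool_cube (\<lambda>v. f (v 0)) = distr (distr ?U ?u (\<lambda>v. v 0)) bool_cube f"
      using distr_distr[OF f' coord] by (simp only: comp_def)
    also have "distr ?U ?u (\<lambda>v. v 0) = ?u"
      using u by (intro distr_PiM_component) simp_all
    finally show ?thesis by (simp only: f_law)
  qed
  have f_U: "(\<lambda>v. f (v 0)) \<in> ?U \<rightarrow>\<^sub>M bool_cube"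
    using coord f' by (rule measurable_compose)
  have borel_coord: "(\<lambda>v. f (v 0)) \<in> (\<Pi>\<^sub>M k\<in>(UNIV :: nat set). borel) \<rightarrow>\<^sub>M bool_cube"
    by (rule measurable_compose[OF _ f]) (rule measurable_component_singleton, simp)
  have "distr ?U matrix_space (\<lambda>v. mat (f (v 0))) = distr M matrix_space A"
  proof -
    have "distr ?U matrix_space (\<lambda>v. mat (f (v 0))) = distr (distr ?U bool_cube (\<lambda>v. f (v 0))) matrix_space mat"
      using distr_distr[OF mat f_U] by (simp only: comp_def)
    also have "\<dots> = distr M matrix_space (\<lambda>\<omega>. mat (Z \<omega>))"
      using distr_distr[OF mat Z] by (simp only: digits_law comp_def)
    finally show ?thesis by (simp only: mat_Z law)
  qed
  then obtain V where V: "V \<in> M \<rightarrow>\<^sub>M (\<Pi>\<^sub>M k\<in>(UNIV :: nat set). borel)"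
    and V_law: "distr M (\<Pi>\<^sub>M k\<in>UNIV. borel) V = ?U"
    and A_eq: "AE \<omega> in M. A \<omega> = mat (f (V \<omega> 0))"
    using rich measurable_compose[OF borel_coord mat] unfolding realises_representations_def by blast
  define Y where "Y = (\<lambda>\<omega>. f (V \<omega> 0))"
  have Y: "Y \<in> M \<rightarrow>\<^sub>M bool_cube"
    unfolding Y_def using V borel_coord by (rule measurable_compose)
  have Y_law: "distr M bool_cube Y = distr M bool_cube Z"
    using distr_distr[OF borel_coord V] by (simp add: V_law comp_def Y_def digits_law)
  define I where "I \<omega> = lab (Y \<omega>)" for \<omega>
  have I: "I \<in> M \<rightarrow>\<^sub>M bool_cube" unfolding I_def using Y lab by (rule measurable_compose)
  have both: "(\<lambda>z. (mat z, lab z)) \<in> bool_cube \<rightarrow>\<^sub>M matrix_space \<Otimes>\<^sub>M bool_cube"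
    using mat lab by (rule measurable_Pair)
  have "distr M (matrix_space \<Otimes>\<^sub>M bool_cube) (\<lambda>\<omega>. (A \<omega>, I \<omega>)) =
      distr M (matrix_space \<Otimes>\<^sub>M bool_cube) (\<lambda>\<omega>. (mat (Y \<omega>), lab (Y \<omega>)))"
  proof (rule distr_cong_AE)
    show "AE \<omega> in M. (A \<omega>, I \<omega>) = (mat (Y \<omega>), lab (Y \<omega>))"
      using A_eq by eventually_elim (simp add: I_def Y_def)
    show "(\<lambda>\<omega>. (A \<omega>, I \<omega>)) \<in> M \<rightarrow>\<^sub>M matrix_space \<Otimes>\<^sub>M bool_cube" using A I by (rule measurable_Pair)
    show "(\<lambda>\<omega>. (mat (Y \<omega>), lab (Y \<omega>))) \<in> M \<rightarrow>\<^sub>M matrix_space \<Otimes>\<^sub>M bool_cube"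
      using Y both by (rule measurable_compose)
  qed (rule refl)+
  also have "\<dots> = distr M (matrix_space \<Otimes>\<^sub>M bool_cube) (\<lambda>\<omega>. (mat (Z \<omega>), lab (Z \<omega>)))"
    using distr_distr[OF both Y] distr_distr[OF both Z] by (simp only: Y_law comp_def)
  finally show ?thesis using I that by (simp only: mat_Z lab_Z)
qed

section \<open>Splitting an associated matrix\<close>

theorem proposition27:
  fixes M :: "'w measure"
    and W :: "'s::polish_space \<times> 's \<Rightarrow> real"
    and \<xi> :: "'w \<Rightarrow> ('s \<times> 's \<times> bool) measure"
    and \<nu> :: "'w \<Rightarrow> 's measure"
    and B C :: "'s set"
    and A :: "'w \<Rightarrow> nat \<times> nat \<Rightarrow> bool"
  assumes "prob_space M"
    and "graph_process M W \<xi>"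
    and "boundedly_exchangeable M \<xi> \<nu>"
    and "B \<in> sets borel" "bounded B"
    and "C \<in> sets borel" "bounded C"
    and "B \<inter> C = {}"
    and "measure M {\<omega> \<in> space M. emeasure (\<nu> \<omega>) B = 0} < 1"
    and "measure M {\<omega> \<in> space M. emeasure (\<nu> \<omega>) C = 0} < 1"
    and "associated_matrix M \<xi> (B \<union> C) A"
    and "realises_representations M matrix_space A"
  shows "\<exists>b c :: 'w \<Rightarrow> nat \<Rightarrow> nat.
    (\<forall>i. (\<lambda>\<omega>. b \<omega> i) \<in> M \<rightarrow>\<^sub>M count_space UNIV) \<and>
    (\<forall>i. (\<lambda>\<omega>. c \<omega> i) \<in> M \<rightarrow>\<^sub>M count_space UNIV) \<and>
    (AE \<omega> in M. strict_mono (b \<omega>) \<and> strict_mono (c \<omega>) \<and>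
       range (b \<omega>) \<inter> range (c \<omega>) = {} \<and> range (b \<omega>) \<union> range (c \<omega>) = UNIV) \<and>
    associated_matrix M \<xi> B (\<lambda>\<omega> (i, j). A \<omega> (b \<omega> i, b \<omega> j)) \<and>
    associated_matrix M \<xi> C (\<lambda>\<omega> (i, j). A \<omega> (c \<omega> i, c \<omega> j)) \<and>
    separately_exchangeable M (\<lambda>\<omega> (i, j). A \<omega> (b \<omega> i, c \<omega> j))"
proof -
  interpret M: prob_space M by fact
  have prob: "prob_space M" by fact
  have dir: "\<forall>\<omega>\<in>space M. directed_by (\<xi> \<omega>) (\<nu> \<omega>)"
    using assms(3) by (simp add: boundedly_exchangeable_def)
  have sets: "sets (\<xi> \<omega>) = sets adj_space" if "\<omega> \<in> space M" for \<omega>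
    by (rule sets_directed_by[OF bspec[OF dir that]])
  have atoms: "measure M {\<omega>\<in>space M. emeasure (\<nu> \<omega>) F = of_nat n} > 0"
    if "F \<in> sets borel" "bounded F" "measure M {\<omega>\<in>space M. emeasure (\<nu> \<omega>) F = 0} < 1" "n \<ge> 1" for F n
    using assms(3) that unfolding boundedly_exchangeable_def by blast
  note atoms_B = atoms[OF assms(4,5,9)] and atoms_C = atoms[OF assms(6,7,10)]
  have BC: "B \<union> C \<in> sets borel" using assms(4,6) by (rule sets.Un)
  \<comment> \<open>With positive probability there is a point in \<open>B\<close>, so \<open>B \<union> C\<close> is not almost surely empty.\<close>
  have atoms_BC: "measure M {\<omega>\<in>space M. emeasure (\<nu> \<omega>) (B \<union> C) = of_nat n} > 0" if "n \<ge> 1" for n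
  proof (rule atoms[OF BC _ _ that])
    show "bounded (B \<union> C)" using assms(5,7) by (simp add: bounded_Un)
    show "measure M {\<omega>\<in>space M. emeasure (\<nu> \<omega>) (B \<union> C) = 0} < 1"
    proof (rule ccontr)
      assume "\<not> ?thesis"
      then have "M.prob {\<omega>\<in>space M. emeasure (\<nu> \<omega>) (B \<union> C) = 0} = 1"
        using M.prob_le_1 by (meson le_less_linear order_antisym)
      then have "AE \<omega> in M. \<omega> \<in> {\<omega>\<in>space M. emeasure (\<nu> \<omega>) (B \<union> C) = 0}"
        using measure_notin_sets M.prob_eq_1 by (metis zero_neq_one)
      then have "AE \<omega> in M. \<omega> \<notin> {\<omega>\<in>space M. emeasure (\<nu> \<omega>) B = of_nat 1}"
        using AE_space
      proof eventually_elim
        case (elim \<omega>)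
        have "directed_by (\<xi> \<omega>) (\<nu> \<omega>)" using dir elim(2) by blast
        then have "sets (\<nu> \<omega>) = sets borel" by (auto simp: directed_by_def simple_measure_def)
        then have "emeasure (\<nu> \<omega>) B \<le> emeasure (\<nu> \<omega>) (B \<union> C)"
          using BC by (intro emeasure_mono) auto
        with elim(1) show ?case by simp
      qed
      then have "M.prob {\<omega>\<in>space M. emeasure (\<nu> \<omega>) B = of_nat 1} = 0" by (rule measure_eq_0_AE)
      with atoms_B[of 1] show False by simp
    qed
  qed
  obtain N S A' where iid: "iid_representation M (\<lambda>\<omega>. adj_restrict (B \<union> C) (\<xi> \<omega>)) N S A'"
    using assms(11) by (rule associated_matrix_imp_iid_representation)
  obtain W' where rep: "representation M W' (\<lambda>\<omega>. adj_restrict (B \<union> C) (\<xi> \<omega>)) N S A'"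
    using iid unfolding iid_representation_def by blast
  note A'_meas = measurable_representation_matrix[OF rep]
  have count_BC: "emeasure M {\<omega>\<in>space M. N \<omega> = enat n} \<noteq> 0" if "n \<ge> 1" for n
    using prob dir BC rep atoms_BC[OF that] by (rule emeasure_count_pos)
  have A: "A \<in> M \<rightarrow>\<^sub>M matrix_space" and A_law: "distr M matrix_space A = distr M matrix_space A'"
    using assms(11) associated_matrix_iff[OF prob iid count_BC] by blast+
  let ?\<sigma> = "distr M borel (S 0)"
  have pos: "emeasure ?\<sigma> (cell B k) \<noteq> 0" for k
  proof (cases k)
    case True
    have "emeasure ?\<sigma> B \<noteq> 0"
      using prob dir BC assms(4) _ iid atoms_B[of 1] by (rule emeasure_point_law_pos) auto
    then show ?thesis using True by (simp add: cell_def)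
  next
    case False
    have "emeasure ?\<sigma> C \<noteq> 0"
      using prob dir BC assms(6) _ iid atoms_C[of 1] by (rule emeasure_point_law_pos) auto
    moreover have "emeasure ?\<sigma> C \<le> emeasure ?\<sigma> (cell B k)"
      using assms(8) False measurable_cell[OF assms(4), of k] by (intro emeasure_mono) (auto simp: cell_def)
    ultimately show ?thesis by auto
  qed
  define J where "J = (\<lambda>\<omega>. hits B (\<lambda>i. S i \<omega>))"
  have J: "J \<in> M \<rightarrow>\<^sub>M bool_cube"
    unfolding J_def
    using measurable_seqI[of "\<lambda>\<omega> i. S i \<omega>", OF representation_point[OF rep]] measurable_hits[OF assms(4)]
    by (rule measurable_compose)
  obtain I where I: "I \<in> M \<rightarrow>\<^sub>M bool_cube"
    and pair_law: "distr M (matrix_space \<Otimes>\<^sub>M bool_cube) (\<lambda>\<omega>. (A \<omega>, I \<omega>)) =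
      distr M (matrix_space \<Otimes>\<^sub>M bool_cube) (\<lambda>\<omega>. (A' \<omega>, J \<omega>))"
    using prob assms(12) A A'_meas J A_law by (rule realised_pair)
  \<comment> \<open>The rows with label \<open>k\<close> and the columns with label \<open>l\<close>, as a function of a matrix and
    a label sequence: this is what the equality of joint laws carries from \<open>A'\<close> to \<open>A\<close>.\<close>
  define block where "block k l = (\<lambda>(X, j) (m, n). X (pick j k m, pick j l n) :: bool)" for k l
  have block: "block k l \<in> matrix_space \<Otimes>\<^sub>M bool_cube \<rightarrow>\<^sub>M matrix_space" for k l
  proof (rule measurable_bool_cubeI)
    fix p :: "nat \<times> nat"
    have entry: "(\<lambda>z. fst z q) \<in> matrix_space \<Otimes>\<^sub>M bool_cube \<rightarrow>\<^sub>M count_space UNIV" for q :: "nat \<times> nat"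
      by (rule measurable_bool_cubeD[OF measurable_fst])
    have picked: "(\<lambda>z. pick (snd z) k' n) \<in> matrix_space \<Otimes>\<^sub>M bool_cube \<rightarrow>\<^sub>M count_space UNIV" for k' n
      using measurable_snd measurable_pick by (rule measurable_compose)
    show "(\<lambda>z. block k l z p) \<in> matrix_space \<Otimes>\<^sub>M bool_cube \<rightarrow>\<^sub>M count_space UNIV"
      unfolding block_def split_beta
      by (rule measurable_compose_countable[OF measurable_compose_countable[OF entry picked] picked])
  qed
  have block_meas: "(\<lambda>\<omega>. block k l (A \<omega>, I \<omega>)) \<in> M \<rightarrow>\<^sub>M matrix_space" for k l
    using measurable_Pair[OF A I] block by (rule measurable_compose)
  have block_law: "distr M matrix_space (\<lambda>\<omega>. block k l (A \<omega>, I \<omega>)) =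
      distr M matrix_space (\<lambda>\<omega>. block k l (A' \<omega>, J \<omega>))" for k l
    using distr_distr[OF block measurable_Pair[OF A I]] distr_distr[OF block measurable_Pair[OF A'_meas J]]
    by (simp only: pair_law comp_def)
  have block_eq: "(\<lambda>\<omega> (m, n). X \<omega> (pick (j \<omega>) k m, pick (j \<omega>) l n)) = (\<lambda>\<omega>. block k l (X \<omega>, j \<omega>))"
    for X :: "'w \<Rightarrow> nat \<times> nat \<Rightarrow> bool" and j k l
    by (simp add: block_def)
  have associated: "associated_matrix M \<xi> F (\<lambda>\<omega>. block k k (A \<omega>, I \<omega>))"
    if F: "F \<in> sets borel" "F = (B \<union> C) \<inter> cell B k"
      and atoms_F: "\<And>n. n \<ge> 1 \<Longrightarrow> measure M {\<omega>\<in>space M. emeasure (\<nu> \<omega>) F = of_nat n} > 0" for F k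
  proof -
    let ?N = "\<lambda>\<omega>. pick_count (J \<omega>) k (N \<omega>)" and ?S = "\<lambda>i \<omega>. S (pick (J \<omega>) k i) \<omega>"
    have iid_F: "iid_representation M (\<lambda>\<omega>. adj_restrict F (\<xi> \<omega>)) ?N ?S (\<lambda>\<omega>. block k k (A' \<omega>, J \<omega>))"
      unfolding F(2) block_eq[symmetric] J_def
      using prob iid sets BC assms(4) pos by (rule iid_representation_thinned)
    then obtain W\<^sub>F where "representation M W\<^sub>F (\<lambda>\<omega>. adj_restrict F (\<xi> \<omega>)) ?N ?S (\<lambda>\<omega>. block k k (A' \<omega>, J \<omega>))"
      unfolding iid_representation_def by blast
    then have "emeasure M {\<omega>\<in>space M. ?N \<omega> = enat n} \<noteq> 0" if "n \<ge> 1" for n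
      using atoms_F[OF that] by (rule emeasure_count_pos[OF prob dir F(1)])
    from associated_matrix_iff[OF prob iid_F this] show ?thesis
      using block_meas block_law by blast
  qed
  let ?b = "\<lambda>\<omega>. pick (I \<omega>) True" and ?c = "\<lambda>\<omega>. pick (I \<omega>) False"
  have "(\<lambda>\<omega>. pick (I \<omega>) k i) \<in> M \<rightarrow>\<^sub>M count_space UNIV" for k i
    using I measurable_pick by (rule measurable_compose)
  moreover have "AE \<omega> in M. strict_mono (?b \<omega>) \<and> strict_mono (?c \<omega>) \<and>
      range (?b \<omega>) \<inter> range (?c \<omega>) = {} \<and> range (?b \<omega>) \<union> range (?c \<omega>) = UNIV"
    by (auto simp: strict_mono_pick range_pick)
  moreover have "associated_matrix M \<xi> B (\<lambda>\<omega> (i, j). A \<omega> (?b \<omega> i, ?b \<omega> j))"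
    unfolding block_eq using assms(4) _ atoms_B by (rule associated) (auto simp: cell_def)
  moreover have "associated_matrix M \<xi> C (\<lambda>\<omega> (i, j). A \<omega> (?c \<omega> i, ?c \<omega> j))"
    unfolding block_eq using assms(6) _ atoms_C by (rule associated) (use assms(8) in \<open>auto simp: cell_def\<close>)
  moreover have "separately_exchangeable M (\<lambda>\<omega> (i, j). A \<omega> (?b \<omega> i, ?c \<omega> j))"
    unfolding block_eq
  proof (rule separately_exchangeable_cong_law[OF _ block_meas block_law])
    show "separately_exchangeable M (\<lambda>\<omega>. block True False (A' \<omega>, J \<omega>))"
      unfolding block_eq[symmetric] J_def
      using prob iid assms(4) pos by (rule separately_exchangeable_cross_block)
  qed
  ultimately show ?thesis by (intro exI[of _ ?b] exI[of _ ?c] conjI allI)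
qed

end
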